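(* If the Cubic Bipartite NAE Decomposition Problem is $\mathbf{NP}$-complete, then the Minimum Edge Deletion Bipartition Problem restricted to 3-regular graphs is $\mathbf{NP}$-hard.
   Context: All graphs are finite and simple. A Not-All-Equal (NAE) decomposition of a graph $G$ is a partition of $V(G)$ into two parts such that every vertex of $G$ has at least one neighbor in each part. Cubic Bipartite NAE Decomposition Problem: given a 3-regular bipartite graph $G$, does $G$ have a NAE decomposition? Minimum Edge Deletion Bipartition Problem: given a graph $G$, determine the minimum number of edges of $G$ whose removal leaves a bipartite graph. *)

theory Defs
  imports "HOL-Computational_Algebra.Polynomial"
begin

section \<open>Multi-tape oracle Turing machines\<close>

text \<open>
  Tapes are infinite in both directions and are given by their contents and the position of the
  head. The tape alphabet is \<open>{blank, 0, 1}\<close>, with \<open>None\<close> for the blank. Tape 0 carries the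
  input and the output, tape 1 is the oracle tape, and the number of tapes is arbitrary.
\<close>

type_synonym symbol = "bool option"
type_synonym tape = "(int \<Rightarrow> symbol) \<times> int"
type_synonym config = "nat \<times> tape list"

datatype dir = MoveLeft | Stay | MoveRight

text \<open>The states are the numbers below \<open>num_states\<close>; a machine with \<open>query = None\<close> is an
  ordinary Turing machine.\<close>

record tm =
  num_tapes :: nat
  num_states :: nat
  start :: nat
  halt :: nat
  query :: "nat option"
  resume :: nat
  delta :: "nat \<Rightarrow> symbol list \<Rightarrow> nat \<times> (symbol \<times> dir) list"

definition wf_tm :: "tm \<Rightarrow> bool" where
  "wf_tm M \<longleftrightarrow>
     2 \<le> num_tapes M \<and> start M < num_states M \<and> halt M < num_states M \<and> resume M < num_states M \<and>
     (\<forall>q. query M = Some q \<longrightarrow> q < num_states M) \<and>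
     (\<forall>q ss. q < num_states M \<longrightarrow> length ss = num_tapes M \<longrightarrow>
        fst (delta M q ss) < num_states M \<and> length (snd (delta M q ss)) = num_tapes M)"

definition tape_of :: "bool list \<Rightarrow> tape" where
  "tape_of x = (\<lambda>i. if 0 \<le> i \<and> i < int (length x) then Some (x ! nat i) else None, 0)"

text \<open>The string on a tape is read from the head up to the first blank. On a tape reached by a
  computation all but finitely many cells are blank, so the minimum exists.\<close>

definition tape_string :: "tape \<Rightarrow> bool list" where
  "tape_string = (\<lambda>(c, h).
     map (\<lambda>i. the (c (h + int i))) [0..<(LEAST n. c (h + int n) = None)])"

fun act :: "symbol \<times> dir \<Rightarrow> tape \<Rightarrow> tape" where
  "act (s, d) (c, h) =
     (c(h := s), case d of MoveLeft \<Rightarrow> h - 1 | Stay \<Rightarrow> h | MoveRight \<Rightarrow> h + 1)"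

text \<open>In the query state the string on tape 1 is replaced in one step by the answer of the oracle.\<close>

definition step :: "tm \<Rightarrow> (bool list \<Rightarrow> bool list) \<Rightarrow> config \<Rightarrow> config" where
  "step M orc = (\<lambda>(q, ts).
     if q = halt M then (q, ts)
     else if query M = Some q then (resume M, ts[1 := tape_of (orc (tape_string (ts ! 1)))])
     else (let (q', as) = delta M q (map (\<lambda>(c, h). c h) ts) in (q', map2 act as ts)))"

definition init :: "tm \<Rightarrow> bool list \<Rightarrow> config" where
  "init M x = (start M, tape_of x # replicate (num_tapes M - 1) (tape_of []))"

definition computes_in_time ::
  "tm \<Rightarrow> (bool list \<Rightarrow> bool list) \<Rightarrow> (bool list \<Rightarrow> bool list) \<Rightarrow> (nat \<Rightarrow> nat) \<Rightarrow> bool" where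
  "computes_in_time M orc f T \<longleftrightarrow>
     (\<forall>x. \<exists>t \<le> T (length x). \<exists>ts.
        (step M orc ^^ t) (init M x) = (halt M, ts) \<and> tape_string (ts ! 0) = f x)"

section \<open>Polynomial time, NP and NP-hardness\<close>

definition polytime :: "(bool list \<Rightarrow> bool list) \<Rightarrow> bool" where
  "polytime f \<longleftrightarrow>
     (\<exists>M (p :: nat poly). wf_tm M \<and> query M = None \<and> computes_in_time M (\<lambda>_. []) f (poly p))"

definition char_fun :: "bool list set \<Rightarrow> bool list \<Rightarrow> bool list" where
  "char_fun L x = [x \<in> L]"

definition P_class :: "bool list set set" where
  "P_class = {L. polytime (char_fun L)}"

definition pair :: "bool list \<Rightarrow> bool list \<Rightarrow> bool list" where
  "pair x w = concat (map (\<lambda>b. [True, b]) x) @ False # w"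

definition NP_class :: "bool list set set" where
  "NP_class = {L. \<exists>R \<in> P_class. \<exists>p :: nat poly.
     \<forall>x. x \<in> L \<longleftrightarrow> (\<exists>w. length w \<le> poly p (length x) \<and> pair x w \<in> R)}"

definition karp_reducible :: "bool list set \<Rightarrow> bool list set \<Rightarrow> bool" where
  "karp_reducible L L' \<longleftrightarrow> (\<exists>f. polytime f \<and> (\<forall>x. x \<in> L \<longleftrightarrow> f x \<in> L'))"

definition NP_complete :: "bool list set \<Rightarrow> bool" where
  "NP_complete L \<longleftrightarrow> L \<in> NP_class \<and> (\<forall>L' \<in> NP_class. karp_reducible L' L)"

text \<open>
  A function problem, such as determining an optimal value, is the set of all pairs of an instance
  and its answer. Many-one reductions make no sense between a decision problem and a function
  problem, so hardness of the latter means hardness under polynomial-time Turing reductions.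
  The answers to queries that are not instances are unconstrained: the reduction must be correct
  and run in time for all of them.
\<close>

type_synonym fun_problem = "(bool list \<times> bool list) set"

definition turing_reducible :: "bool list set \<Rightarrow> fun_problem \<Rightarrow> bool" where
  "turing_reducible L F \<longleftrightarrow>
     (\<exists>M (p :: nat poly). wf_tm M \<and>
        (\<forall>orc. (\<forall>(x, y) \<in> F. orc x = y) \<longrightarrow> computes_in_time M orc (char_fun L) (poly p)))"

definition NP_hard :: "fun_problem \<Rightarrow> bool" where
  "NP_hard F \<longleftrightarrow> (\<forall>L \<in> NP_class. turing_reducible L F)"

section \<open>Graphs\<close>

type_synonym 'a ugraph = "'a set \<times> 'a set set"

abbreviation verts :: "'a ugraph \<Rightarrow> 'a set" where "verts \<equiv> fst"
abbreviation edges :: "'a ugraph \<Rightarrow> 'a set set" where "edges \<equiv> snd"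

definition simple_graph :: "'a ugraph \<Rightarrow> bool" where
  "simple_graph G \<longleftrightarrow> finite (verts G) \<and> (\<forall>e \<in> edges G. e \<subseteq> verts G \<and> card e = 2)"

definition neighbors :: "'a ugraph \<Rightarrow> 'a \<Rightarrow> 'a set" where
  "neighbors G v = {u. {u, v} \<in> edges G}"

definition regular :: "nat \<Rightarrow> 'a ugraph \<Rightarrow> bool" where
  "regular k G \<longleftrightarrow> (\<forall>v \<in> verts G. card (neighbors G v) = k)"

definition bipartite :: "'a ugraph \<Rightarrow> bool" where
  "bipartite G \<longleftrightarrow>
     (\<exists>A B. A \<union> B = verts G \<and> A \<inter> B = {} \<and> (\<forall>e \<in> edges G. e \<inter> A \<noteq> {} \<and> e \<inter> B \<noteq> {}))"

definition NAE_decomposition :: "'a ugraph \<Rightarrow> 'a set \<Rightarrow> 'a set \<Rightarrow> bool" where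
  "NAE_decomposition G A B \<longleftrightarrow>
     A \<union> B = verts G \<and> A \<inter> B = {} \<and>
     (\<forall>v \<in> verts G. neighbors G v \<inter> A \<noteq> {} \<and> neighbors G v \<inter> B \<noteq> {})"

definition min_edge_deletion :: "'a ugraph \<Rightarrow> nat" where
  "min_edge_deletion G = Min {card F | F. F \<subseteq> edges G \<and> bipartite (verts G, edges G - F)}"

text \<open>The minimum is over a finite nonempty set.\<close>

lemma min_edge_deletion_welldefined:
  assumes "simple_graph G"
  shows "finite {card F | F. F \<subseteq> edges G \<and> bipartite (verts G, edges G - F)}"
    and "{card F | F. F \<subseteq> edges G \<and> bipartite (verts G, edges G - F)} \<noteq> {}"
proof -
  have "edges G \<subseteq> Pow (verts G)" "finite (verts G)"
    using assms by (auto simp: simple_graph_def)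
  then have "finite (edges G)"
    by (meson finite_Pow_iff finite_subset)
  then have "finite (card ` Pow (edges G))" by simp
  then show "finite {card F | F. F \<subseteq> edges G \<and> bipartite (verts G, edges G - F)}"
    by (rule rev_finite_subset) auto
  have "bipartite (verts G, edges G - edges G)"
    by (auto simp: bipartite_def intro: exI[of _ "{}"])
  then show "{card F | F. F \<subseteq> edges G \<and> bipartite (verts G, edges G - F)} \<noteq> {}"
    by auto
qed

section \<open>The two problems\<close>

text \<open>
  Instances are graphs on \<open>{0, ..., n - 1}\<close>, encoded by \<open>n\<close> in unary, a terminating zero, and the
  adjacency matrix row by row.
\<close>

definition graph_instance :: "nat ugraph \<Rightarrow> bool" where
  "graph_instance G \<longleftrightarrow> simple_graph G \<and> (\<exists>n. verts G = {..<n})"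

definition encode_graph :: "nat ugraph \<Rightarrow> bool list" where
  "encode_graph G = (let n = card (verts G) in
     replicate n True @ False # [{i, j} \<in> edges G. i \<leftarrow> [0..<n], j \<leftarrow> [0..<n]])"

text \<open>Unary answers: the optimum is at most the number of edges, hence at most the length of the
  encoded graph, so unary and binary notation are interchangeable in polynomial time.\<close>

definition encode_nat :: "nat \<Rightarrow> bool list" where
  "encode_nat m = replicate m True"

definition cubic_bipartite_NAE :: "bool list set" where
  "cubic_bipartite_NAE = {encode_graph G | G.
     graph_instance G \<and> regular 3 G \<and> bipartite G \<and> (\<exists>A B. NAE_decomposition G A B)}"

definition cubic_min_edge_deletion_bipartition :: fun_problem where
  "cubic_min_edge_deletion_bipartition =
     {(encode_graph G, encode_nat (min_edge_deletion G)) | G. graph_instance G \<and> regular 3 G}"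

lemma encode_graph_inject:
  assumes "graph_instance G" "graph_instance H" "encode_graph G = encode_graph H"
  shows "G = H"
proof -
  obtain n m where n: "verts G = {..<n}" and m: "verts H = {..<m}"
    using assms by (auto simp: graph_instance_def)
  have len: "length (takeWhile id (replicate k True @ False # xs)) = k" for k xs
    by (induction k) auto
  have enc: "replicate n True @ False # [{i, j} \<in> edges G. i \<leftarrow> [0..<n], j \<leftarrow> [0..<n]] =
     replicate m True @ False # [{i, j} \<in> edges H. i \<leftarrow> [0..<m], j \<leftarrow> [0..<m]]"
    using assms(3) by (simp add: encode_graph_def n m)
  then have nm: "n = m" using len by metis
  have split: "concat (map f is) = concat (map g is) \<Longrightarrow>
      (\<And>i. length (f i) = length (g i)) \<Longrightarrow> \<forall>i \<in> set is. f i = g i"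
    for f g :: "nat \<Rightarrow> bool list" and "is"
    by (induction "is") (auto simp: append_eq_append_conv)
  have "concat (map (\<lambda>i. map (\<lambda>j. {i, j} \<in> edges G) [0..<n]) [0..<n]) =
     concat (map (\<lambda>i. map (\<lambda>j. {i, j} \<in> edges H) [0..<n]) [0..<n])"
    using enc unfolding nm by simp
  from split[OF this] have adj: "({i, j} \<in> edges G) = ({i, j} \<in> edges H)" if "i < n" "j < n" for i j
    using that by auto
  have "e \<in> edges G \<longleftrightarrow> e \<in> edges H" for e
  proof -
    have "\<exists>i j. e = {i, j} \<and> i < n \<and> j < n" if "e \<in> edges G \<or> e \<in> edges H"
    proof -
      have "e \<subseteq> {..<n}" "card e = 2"
        using that assms(1,2) n m nm by (auto simp: graph_instance_def simple_graph_def)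
      then show ?thesis by (auto simp: card_2_iff)
    qed
    then show ?thesis using adj by blast
  qed
  then show ?thesis using n m nm by (auto simp: prod_eq_iff)
qed

lemma single_valued_cubic_min_edge_deletion_bipartition:
  "single_valued cubic_min_edge_deletion_bipartition"
  unfolding single_valued_def cubic_min_edge_deletion_bipartition_def
  using encode_graph_inject by blast

end

theory Submission
  imports Defs
begin

text \<open>
  Let \<open>G\<close> be cubic on \<open>n\<close> vertices. Take a triangle for every vertex \<open>v\<close>, whose corners stand for
  the neighbours of \<open>v\<close>, join a new vertex \<open>s u\<close> to the three corners that stand for \<open>u\<close>, and add
  a disjoint copy of \<open>G\<close>. The result \<open>H\<close> is cubic. The \<open>n\<close> triangles are disjoint and each needs a
  deletion; \<open>n\<close> deletions suffice iff the copy of \<open>G\<close> is bipartite and some 2-colouring of the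
  vertices \<open>s u\<close> leaves no triangle monochromatic, which is a NAE decomposition of \<open>G\<close>. So a
  single query for \<open>H\<close> decides whether \<open>G\<close> is bipartite with a NAE decomposition.

  That \<open>H\<close> can be computed in polynomial time is shown for machines whose heads only move over
  copies of the instance: a head position is a number, loops over positions are bounded
  quantifiers, and arithmetic reduces to counting.
\<close>

section \<open>Structured programs and their compilation\<close>

text \<open>The gadget works because the lower bound is tight: a cut that deletes only
  \<open>n\<close> edges spends exactly one in each triangle, so every edge at a vertex
  \<open>s u\<close> and every edge of the copy of \<open>G\<close> survives. Hence the corners for
  \<open>u\<close> all take the colour opposite to \<open>s u\<close>, and a vertex whose neighbours
  share a colour would have a triangle with three uncut edges. The copy of \<open>G\<close> hands
  bipartiteness over to the oracle: stated directly it quantifies over vertex sets, which are not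
  head positions, whereas being cubic is a statement about positions only. The reduction starts from
  an arbitrary language, for which only some machine computing a Karp reduction is given, so that
  machine has to be simulated before the programs on words can start. Its output may encode no cubic
  graph at all. The query is then not an instance and the answer may be a word of any length;
  therefore validity is tested separately, and the answer is read no further than position
  \<open>n\<close>.\<close>

type_synonym tapes = "nat \<Rightarrow> tape"

datatype com =
    Act "(nat \<Rightarrow> symbol) \<Rightarrow> nat \<Rightarrow> symbol \<times> dir"
  | Seq com com
  | If "(nat \<Rightarrow> symbol) \<Rightarrow> bool" com com
  | While "(nat \<Rightarrow> symbol) \<Rightarrow> bool" com

text \<open>Programs do not mention the number of tapes, so the symbol function must be total; it
  reads a blank beyond the last tape.\<close>

definition syms :: "nat \<Rightarrow> tapes \<Rightarrow> nat \<Rightarrow> symbol" where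
  "syms K T i = (if i < K then fst (T i) (snd (T i)) else None)"

definition act_all :: "nat \<Rightarrow> ((nat \<Rightarrow> symbol) \<Rightarrow> nat \<Rightarrow> symbol \<times> dir) \<Rightarrow> tapes \<Rightarrow> tapes" where
  "act_all K f T = (\<lambda>i. if i < K then act (f (syms K T) i) (T i) else T i)"

text \<open>The times are the exact step counts of the compiled code: a branch costs one step, and
  the first branch of \<open>If\<close> and each round of \<open>While\<close> end with a jump that
  costs another.\<close>

inductive exec :: "nat \<Rightarrow> com \<Rightarrow> tapes \<Rightarrow> nat \<Rightarrow> tapes \<Rightarrow> bool" for K where
  Act: "exec K (Act f) T 1 (act_all K f T)"
| Seq: "exec K c T t T' \<Longrightarrow> exec K d T' u T'' \<Longrightarrow> exec K (Seq c d) T (t + u) T''"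
| IfT: "b (syms K T) \<Longrightarrow> exec K c T t T' \<Longrightarrow> exec K (If b c d) T (t + 2) T'"
| IfF: "\<not> b (syms K T) \<Longrightarrow> exec K d T t T' \<Longrightarrow> exec K (If b c d) T (t + 1) T'"
| WhileF: "\<not> b (syms K T) \<Longrightarrow> exec K (While b c) T 1 T"
| WhileT: "b (syms K T) \<Longrightarrow> exec K c T t T' \<Longrightarrow> exec K (While b c) T' u T'' \<Longrightarrow>
    exec K (While b c) T (t + 2 + u) T''"

text \<open>\<open>IBr b k\<close> continues with the next instruction if \<open>b\<close> holds and jumps by \<open>k\<close> otherwise.\<close>

datatype instr =
    IAct "(nat \<Rightarrow> symbol) \<Rightarrow> nat \<Rightarrow> symbol \<times> dir"
  | IBr "(nat \<Rightarrow> symbol) \<Rightarrow> bool" int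

text \<open>Offsets are relative, so a block runs at any address and blocks are combined by
  appending. The branch on \<open>\<lambda>_. False\<close> is the unconditional jump.\<close>

fun code :: "com \<Rightarrow> instr list" where
  "code (Act f) = [IAct f]"
| "code (Seq c d) = code c @ code d"
| "code (If b c d) = IBr b (int (length (code c)) + 2) # code c @
     IBr (\<lambda>_. False) (int (length (code d)) + 1) # code d"
| "code (While b c) = IBr b (int (length (code c)) + 2) # code c @
     [IBr (\<lambda>_. False) (- (int (length (code c)) + 1))]"

definition idle :: "(nat \<Rightarrow> symbol) \<Rightarrow> nat \<Rightarrow> symbol \<times> dir" where
  "idle s i = (s i, Stay)"

definition read_syms :: "nat \<Rightarrow> symbol list \<Rightarrow> nat \<Rightarrow> symbol" where
  "read_syms K ss i = (if i < K then ss ! i else None)"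

text \<open>Clamping the target to \<open>length P\<close> and leaving the program for state 0 keep
  every successor below the number of states, which \<open>wf_tm\<close> demands even of transitions
  that no run takes.\<close>

definition instr_delta :: "nat \<Rightarrow> instr list \<Rightarrow> nat \<Rightarrow> symbol list \<Rightarrow> nat \<times> (symbol \<times> dir) list" where
  "instr_delta K P q ss = (let s = read_syms K ss in
     if q < length P then
       (case P ! q of
          IAct f \<Rightarrow> (q + 1, map (f s) [0..<K])
        | IBr b k \<Rightarrow> (if b s then q + 1 else min (length P) (nat (int q + k)), map (idle s) [0..<K]))
     else (0, map (idle s) [0..<K]))"

text \<open>The instruction at the query position is a placeholder: it is never executed.\<close>

definition query_prog :: "com \<Rightarrow> com \<Rightarrow> instr list" where
  "query_prog c d = code c @ IAct idle # code d"

definition query_tm :: "nat \<Rightarrow> com \<Rightarrow> com \<Rightarrow> tm" where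
  "query_tm K c d =
     \<lparr>num_tapes = K, num_states = length (query_prog c d) + 1, start = 0,
      halt = length (query_prog c d), query = Some (length (code c)),
      resume = length (code c) + 1, delta = instr_delta K (query_prog c d)\<rparr>"

lemma wf_query_tm: "2 \<le> K \<Longrightarrow> wf_tm (query_tm K c d)"
  by (auto simp: wf_tm_def query_tm_def query_prog_def instr_delta_def Let_def split: instr.split)

lemma read_syms_tapes: "read_syms K (map ((\<lambda>(c, h). c h) \<circ> T) [0..<K]) = syms K T"
  by (auto simp: read_syms_def syms_def split_beta)

lemma act_idle: "act (idle (syms K T) i) (T i) = T i" if "i < K"
  using that by (cases "T i") (auto simp: idle_def syms_def)

lemma map2_upt: "map2 g (map f [0..<K]) (map T [0..<K]) = map (\<lambda>i. g (f i) (T i)) [0..<K]"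
  by (intro nth_equalityI) auto

lemma step_IAct:
  assumes "q < length (query_prog c d)" "q \<noteq> length (code c)" "query_prog c d ! q = IAct f"
  shows "step (query_tm K c d) orc (q, map T [0..<K]) = (q + 1, map (act_all K f T) [0..<K])"
  using assms
  by (auto simp: step_def query_tm_def instr_delta_def read_syms_tapes act_all_def map2_upt)

lemma step_IBr:
  assumes "q < length (query_prog c d)" "q \<noteq> length (code c)" "query_prog c d ! q = IBr b k"
  shows "step (query_tm K c d) orc (q, map T [0..<K]) =
    (if b (syms K T) then q + 1 else min (length (query_prog c d)) (nat (int q + k)), map T [0..<K])"
  using assms
  by (auto simp: step_def query_tm_def instr_delta_def read_syms_tapes act_idle map2_upt)

definition code_at :: "instr list \<Rightarrow> nat \<Rightarrow> instr list \<Rightarrow> bool" where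
  "code_at P i c \<longleftrightarrow> i + length c \<le> length P \<and> (\<forall>k < length c. P ! (i + k) = c ! k)"

lemma code_at_Cons: "code_at P i (x # c) \<longleftrightarrow> i < length P \<and> P ! i = x \<and> code_at P (Suc i) c"
  unfolding code_at_def by (auto simp: less_Suc_eq_0_disj nth_Cons split: nat.splits)

lemma code_at_length: "code_at P i c \<Longrightarrow> i + length c \<le> length P"
  by (simp add: code_at_def)

lemma code_at_append:
  "code_at P i (c @ d) \<longleftrightarrow> code_at P i c \<and> code_at P (i + length c) d"
proof (induction c arbitrary: i)
  case Nil
  then show ?case by (auto simp: code_at_def)
next
  case (Cons a c)
  then show ?case by (auto simp: code_at_Cons)
qed

lemma funpow_trans:
  fixes f :: "'a \<Rightarrow> 'a"
  assumes "(f ^^ t) x = y" "(f ^^ u) y = z"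
  shows "(f ^^ (t + u)) x = z"
  using assms by (subst add.commute) (simp add: funpow_add)

lemma funpow_one: "f x = y \<Longrightarrow> (f ^^ 1) x = y" for f :: "'a \<Rightarrow> 'a"
  by simp

text \<open>Induction on the execution, with the address of the block arbitrary. The last premise
  keeps the block off the query position: control may arrive there at the end of a block, but no
  instruction of the block lies on it.\<close>

lemma exec_steps:
  assumes "exec K c T t T'" "code_at (query_prog c1 c2) i (code c)"
    "i + length (code c) \<le> length (code c1) \<or> length (code c1) < i"
  shows "(step (query_tm K c1 c2) orc ^^ t) (i, map T [0..<K]) =
    (i + length (code c), map T' [0..<K])"
  using assms
proof (induction arbitrary: i rule: exec.induct)
  case (Act f T)
  then show ?case
    using step_IAct[of i c1 c2 f K orc T] by (auto simp: code_at_Cons)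
next
  case (Seq c T t T' d u T'')
  have 1: "(step (query_tm K c1 c2) orc ^^ t) (i, map T [0..<K]) =
    (i + length (code c), map T' [0..<K])"
    by (rule Seq.IH) (use Seq.prems in \<open>auto simp: code_at_append\<close>)
  have 2: "(step (query_tm K c1 c2) orc ^^ u) (i + length (code c), map T' [0..<K]) =
    (i + length (code c) + length (code d), map T'' [0..<K])"
    by (rule Seq.IH) (use Seq.prems in \<open>auto simp: code_at_append\<close>)
  show ?case
    using funpow_trans[OF 1 2] by (simp add: add.assoc)
next
  case (IfT b T c t T' d)
  have 0: "step (query_tm K c1 c2) orc (i, map T [0..<K]) = (Suc i, map T [0..<K])"
    using IfT step_IBr[of i c1 c2 b "int (length (code c)) + 2" K orc T] by (auto simp: code_at_Cons)
  have 1: "(step (query_tm K c1 c2) orc ^^ t) (Suc i, map T [0..<K]) =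
    (Suc i + length (code c), map T' [0..<K])"
    by (rule IfT.IH) (use IfT.prems in \<open>auto simp: code_at_Cons code_at_append\<close>)
  have 2: "step (query_tm K c1 c2) orc (Suc i + length (code c), map T' [0..<K]) =
     (Suc i + length (code c) + length (code d) + 1, map T' [0..<K])"
    by (subst step_IBr[where k = "int (length (code d)) + 1" and b = "\<lambda>_. False"])
      (use IfT.prems code_at_length[OF IfT.prems(1)] in \<open>auto simp: code_at_Cons code_at_append\<close>)
  show ?case
    using funpow_trans[OF funpow_one[of "step (query_tm K c1 c2) orc", OF 0] funpow_trans[OF 1 funpow_one[of "step (query_tm K c1 c2) orc", OF 2]]]
    by (simp del: funpow.simps add: algebra_simps)
next
  case (IfF b T d t T' c)
  have 0: "step (query_tm K c1 c2) orc (i, map T [0..<K]) = (Suc i + length (code c) + 1, map T [0..<K])"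
    using IfF step_IBr[of i c1 c2 b "int (length (code c)) + 2" K orc T]
      code_at_length[OF IfF.prems(1)]
    by (auto simp: code_at_Cons code_at_append)
  have 1: "(step (query_tm K c1 c2) orc ^^ t) (Suc i + length (code c) + 1, map T [0..<K]) =
    (Suc i + length (code c) + 1 + length (code d), map T' [0..<K])"
    by (rule IfF.IH) (use IfF.prems in \<open>auto simp: code_at_Cons code_at_append\<close>)
  show ?case
    using funpow_trans[OF funpow_one[of "step (query_tm K c1 c2) orc", OF 0] 1]
    by (simp del: funpow.simps add: algebra_simps)
next
  case (WhileF b T c)
  then show ?case
    using step_IBr[of i c1 c2 b "int (length (code c)) + 2" K orc T]
      code_at_length[OF WhileF.prems(1)]
    by (auto simp: code_at_Cons code_at_append)
next
  case (WhileT b T c t T' u T'')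
  have 0: "step (query_tm K c1 c2) orc (i, map T [0..<K]) = (Suc i, map T [0..<K])"
    using WhileT step_IBr[of i c1 c2 b "int (length (code c)) + 2" K orc T] by (auto simp: code_at_Cons)
  have 1: "(step (query_tm K c1 c2) orc ^^ t) (Suc i, map T [0..<K]) =
    (Suc i + length (code c), map T' [0..<K])"
    by (rule WhileT.IH) (use WhileT.prems in \<open>auto simp: code_at_Cons code_at_append\<close>)
  have 2: "step (query_tm K c1 c2) orc (Suc i + length (code c), map T' [0..<K]) =
     (i, map T' [0..<K])"
    by (subst step_IBr[where k = "- (int (length (code c)) + 1)" and b = "\<lambda>_. False"])
      (use WhileT.prems in \<open>auto simp: code_at_Cons code_at_append\<close>)
  have 3: "(step (query_tm K c1 c2) orc ^^ u) (i, map T' [0..<K]) =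
    (i + length (code (While b c)), map T'' [0..<K])"
    by (rule WhileT.IH) (use WhileT.prems in auto)
  show ?case
    using funpow_trans[OF funpow_one[of "step (query_tm K c1 c2) orc", OF 0] funpow_trans[OF 1 funpow_trans[OF funpow_one[of "step (query_tm K c1 c2) orc", OF 2] 3]]]
    by (simp del: funpow.simps code.simps add: algebra_simps)
qed

text \<open>Falling off the code of \<open>c\<close> means being in the query state, and falling off
  the code of \<open>d\<close> means being in the halting state. The \<open>1\<close> is the oracle
  step.\<close>

lemma query_tm_run:
  assumes "exec K c T t T1" "2 \<le> K"
    "exec K d (T1(1 := tape_of (orc (tape_string (T1 1))))) u T2"
  shows "(step (query_tm K c d) orc ^^ (t + 1 + u)) (0, map T [0..<K]) =
    (halt (query_tm K c d), map T2 [0..<K])"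
proof -
  let ?f = "step (query_tm K c d) orc"
  have 1: "(?f ^^ t) (0, map T [0..<K]) = (length (code c), map T1 [0..<K])"
    using exec_steps[OF assms(1), of c d 0 orc]
    by (auto simp: code_at_def query_prog_def nth_append)
  have q: "?f (length (code c), map T1 [0..<K]) =
    (length (code c) + 1, (map T1 [0..<K])[1 := tape_of (orc (tape_string (map T1 [0..<K] ! 1)))])"
    by (auto simp: step_def query_tm_def query_prog_def)
  have "(map T1 [0..<K])[1 := tape_of (orc (tape_string (map T1 [0..<K] ! 1)))] =
    map (T1(1 := tape_of (orc (tape_string (T1 1))))) [0..<K]"
    using assms(2) by (intro nth_equalityI) (auto simp: nth_list_update)
  then have 2: "?f (length (code c), map T1 [0..<K]) =
    (length (code c) + 1, map (T1(1 := tape_of (orc (tape_string (T1 1))))) [0..<K])"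
    using q by simp
  have 3: "(?f ^^ u) (length (code c) + 1, map (T1(1 := tape_of (orc (tape_string (T1 1))))) [0..<K])
    = (halt (query_tm K c d), map T2 [0..<K])"
    using exec_steps[OF assms(3), of c d "length (code c) + 1" orc]
    by (auto simp: code_at_def query_prog_def nth_append query_tm_def)
  show ?thesis
    using funpow_trans[OF 1 funpow_trans[OF funpow_one[of ?f, OF 2] 3]]
    by (simp del: funpow.simps add: algebra_simps)
qed

section \<open>Multi-head programs\<close>

text \<open>Upper bounds instead of exact times allow branches and loop rounds of different cost to
  share one bound.\<close>

definition runs :: "nat \<Rightarrow> com \<Rightarrow> tapes \<Rightarrow> nat \<Rightarrow> tapes \<Rightarrow> bool" where
  "runs K c T B T' \<longleftrightarrow> (\<exists>t \<le> B. exec K c T t T')"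

lemma runs_mono: "runs K c T B T' \<Longrightarrow> B \<le> B' \<Longrightarrow> runs K c T B' T'"
  unfolding runs_def using order_trans by blast

lemma runs_Act: "act_all K f T = T' \<Longrightarrow> runs K (Act f) T 1 T'"
  unfolding runs_def using exec.Act by blast

lemma runs_Seq: "runs K c T A T' \<Longrightarrow> runs K d T' B T'' \<Longrightarrow> runs K (Seq c d) T (A + B) T''"
  unfolding runs_def by (meson add_mono exec.Seq)

lemma runs_If:
  assumes "b (syms K T) \<Longrightarrow> runs K c T B T'" "\<not> b (syms K T) \<Longrightarrow> runs K d T B T'"
  shows "runs K (If b c d) T (B + 2) T'"
proof (cases "b (syms K T)")
  case True
  with assms(1) show ?thesis unfolding runs_def by (meson add_le_mono1 exec.IfT)
next
  case False
  with assms(2) obtain t where "t \<le> B" "exec K d T t T'" unfolding runs_def by blast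
  then show ?thesis using exec.IfF[of b K T d t T' c] False unfolding runs_def
    by (intro exI[of _ "t + 1"]) simp
qed

text \<open>The invariant is indexed by the number of completed rounds, \<open>m\<close> in all. It
  is a relation rather than a function because the loops that count or print leave an unspecified
  bit on tape 2.\<close>

lemma runs_While_inv:
  assumes "I i T" "i \<le> m"
    and step: "\<And>i T. I i T \<Longrightarrow> i < m \<Longrightarrow> b (syms K T) \<and> (\<exists>T'. runs K c T B T' \<and> I (Suc i) T')"
    and stop: "\<And>T. I m T \<Longrightarrow> \<not> b (syms K T)"
  shows "\<exists>T'. runs K (While b c) T ((m - i) * (B + 2) + 1) T' \<and> I m T'"
  using assms(1,2)
proof (induction "m - i" arbitrary: i T)
  case 0
  then show ?case using stop exec.WhileF[of b K T c] by (auto simp: runs_def)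
next
  case (Suc k)
  have "i < m" using Suc.hyps(2) by simp
  then obtain T1 where T1: "b (syms K T)" "runs K c T B T1" "I (Suc i) T1"
    using step[OF Suc.prems(1)] by blast
  obtain T2 where T2: "runs K (While b c) T1 ((m - Suc i) * (B + 2) + 1) T2" "I m T2"
    using Suc.hyps(1)[of "Suc i" T1] Suc.hyps(2) T1(3) \<open>i < m\<close> by fastforce
  obtain t u where t: "t \<le> B" "exec K c T t T1"
    and u: "u \<le> (m - Suc i) * (B + 2) + 1" "exec K (While b c) T1 u T2"
    using T1 T2 by (auto simp: runs_def)
  have "m - i = Suc (m - Suc i)" using Suc by simp
  then have "(m - i) * (B + 2) + 1 = B + 2 + ((m - Suc i) * (B + 2) + 1)" by simp
  then have "t + 2 + u \<le> (m - i) * (B + 2) + 1" using t u by linarith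
  moreover have "exec K (While b c) T (t + 2 + u) T2"
    using T1(1) t(2) u(2) by (rule exec.WhileT)
  ultimately show ?case using T2(2) unfolding runs_def by blast
qed

lemma runs_While:
  assumes "\<And>i. i < m \<Longrightarrow> b (syms K (S i)) \<and> runs K c (S i) B (S (Suc i))"
    and "\<not> b (syms K (S m))" "S 0 = T" "S m = T'"
  shows "runs K (While b c) T (m * (B + 2) + 1) T'"
  using runs_While_inv[of "\<lambda>i T. T = S i" 0 T m b K c B] assms by auto

section \<open>Elementary actions on single tapes\<close>

fun shift :: "dir \<Rightarrow> tape \<Rightarrow> tape" where
  "shift MoveLeft (c, h) = (c, h - 1)"
| "shift Stay (c, h) = (c, h)"
| "shift MoveRight (c, h) = (c, h + 1)"

definition mv :: "nat set \<Rightarrow> dir \<Rightarrow> com" where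
  "mv A d = Act (\<lambda>s i. (s i, if i \<in> A then d else Stay))"

definition wr :: "nat \<Rightarrow> ((nat \<Rightarrow> symbol) \<Rightarrow> bool) \<Rightarrow> dir \<Rightarrow> com" where
  "wr j g d = Act (\<lambda>s i. if i = j then (Some (g s), d) else (s i, Stay))"

definition skip :: com where "skip = mv {} Stay"

fun put :: "bool \<Rightarrow> tape \<Rightarrow> tape" where "put b (c, h) = (c(h := Some b), h)"

fun cell :: "tape \<Rightarrow> symbol" where "cell (c, h) = c h"

lemma syms_cell: "syms K T i = (if i < K then cell (T i) else None)"
  by (cases "T i") (simp add: syms_def)

lemma put_put [simp]: "put b (put b' t) = put b t"
  by (cases t) simp

lemma cell_put [simp]: "cell (put b t) = Some b"
  by (cases t) simp

lemma act_read: "i < K \<Longrightarrow> act (syms K T i, d) (T i) = shift d (T i)"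
  by (cases "T i"; cases d) (auto simp: syms_def)

lemma act_write: "act (Some b, d) t = shift d (put b t)"
  by (cases t; cases d) auto

lemma shift_Stay [simp]: "shift Stay t = t"
  by (cases t) simp

lemma runs_mv: "(\<And>i. T' i = (if i \<in> A \<and> i < K then shift d (T i) else T i)) \<Longrightarrow> runs K (mv A d) T 1 T'"
  unfolding mv_def by (rule runs_Act) (auto simp: act_all_def act_read fun_eq_iff)

lemma runs_wr: "j < K \<Longrightarrow> runs K (wr j g d) T 1 (T(j := shift d (put (g (syms K T)) (T j))))"
  unfolding wr_def by (rule runs_Act) (auto simp: act_all_def act_read act_write fun_eq_iff)

lemma runs_skip: "runs K skip T 1 T"
  unfolding skip_def by (rule runs_mv) auto

abbreviation wtape :: "bool list \<Rightarrow> int \<Rightarrow> tape" where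
  "wtape y p \<equiv> (fst (tape_of y), p)"

lemma cell_wtape: "cell (wtape y p) = (if 0 \<le> p \<and> p < int (length y) then Some (y ! nat p) else None)"
  by (simp add: tape_of_def)

lemma put_wtape: "put b (wtape y (int (length y))) = wtape (y @ [b]) (int (length y))"
  by (auto simp: tape_of_def fun_eq_iff nth_append)

text \<open>The initial move to the left makes the loop work also when the head stands on the blank
  just behind the word.\<close>

definition rewind :: "nat \<Rightarrow> com" where
  "rewind j = Seq (mv {j} MoveLeft) (Seq (While (\<lambda>s. s j \<noteq> None) (mv {j} MoveLeft)) (mv {j} MoveRight))"

lemma runs_rewind:
  assumes "j < K" "T j = wtape y (int k)" "k \<le> length y"
  shows "runs K (rewind j) T (3 * length y + 3) (T(j := wtape y 0))"
proof -
  have "runs K (While (\<lambda>s. s j \<noteq> None) (mv {j} MoveLeft)) (T(j := wtape y (int k - 1)))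
     (k * (1 + 2) + 1) (T(j := wtape y (- 1)))"
  proof (rule runs_While[where S = "\<lambda>i. T(j := wtape y (int k - 1 - int i))"])
    fix i assume "i < k"
    then have "syms K (T(j := wtape y (int k - 1 - int i))) j \<noteq> None"
      using assms by (simp add: syms_cell cell_wtape del: cell.simps)
    moreover have "runs K (mv {j} MoveLeft) (T(j := wtape y (int k - 1 - int i))) 1
          (T(j := wtape y (int k - 1 - int (Suc i))))"
      by (rule runs_mv) (use assms in auto)
    ultimately show "syms K (T(j := wtape y (int k - 1 - int i))) j \<noteq> None \<and>
         runs K (mv {j} MoveLeft) (T(j := wtape y (int k - 1 - int i))) 1
          (T(j := wtape y (int k - 1 - int (Suc i))))" ..
  qed (use assms in \<open>auto simp: syms_cell tape_of_def\<close>)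
  moreover have "runs K (mv {j} MoveLeft) T 1 (T(j := wtape y (int k - 1)))"
    by (rule runs_mv) (use assms in auto)
  moreover have "runs K (mv {j} MoveRight) (T(j := wtape y (- 1))) 1 (T(j := wtape y 0))"
    by (rule runs_mv) (use assms in auto)
  ultimately have "runs K (rewind j) T (1 + ((k * (1 + 2) + 1) + 1)) (T(j := wtape y 0))"
    unfolding rewind_def by (intro runs_Seq)
  then show ?thesis by (rule runs_mono) (use assms(3) in simp)
qed

text \<open>Tape 2 receives the truth value of a test, tape 3 is scratch space for comparisons, and the
  tapes \<open>4 + v\<close> with \<open>v < V\<close> are the variables: each carries a copy of the input word, and the
  value is the position of the head.\<close>

locale layout =
  fixes K V :: nat
  assumes V: "4 + V \<le> K"
begin

section \<open>Polynomial-time tests on head positions\<close>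

definition vars :: "bool list \<Rightarrow> nat \<Rightarrow> (nat \<Rightarrow> nat) \<Rightarrow> tapes \<Rightarrow> bool" where
  "vars y d e T \<longleftrightarrow> T 3 = wtape y 0 \<and>
     (\<forall>v < V. T (4 + v) = wtape y (int (e v)) \<and> e v \<le> length y \<and> (d \<le> v \<longrightarrow> e v = 0))"

text \<open>The index \<open>d\<close> is a nesting depth: the variables from \<open>d\<close> on
  stand at 0 and are free as loop variables. A test restores every tape except tape 2, which is what
  makes tests composable under connectives and quantifiers.\<close>

definition dec :: "nat \<Rightarrow> (bool list \<Rightarrow> (nat \<Rightarrow> nat) \<Rightarrow> bool) \<Rightarrow> bool" where
  "dec d P \<longleftrightarrow> (\<exists>c (p :: nat poly). \<forall>y e T. vars y d e T \<longrightarrow>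
     runs K c T (poly p (length y)) (T(2 := put (P y e) (T 2))))"

lemma varsD:
  assumes "vars y d e T" "v < V"
  shows "T (4 + v) = wtape y (int (e v))" "e v \<le> length y" "d \<le> v \<Longrightarrow> e v = 0"
  using assms by (auto simp: vars_def)

lemma vars_upd [simp]: "j < 3 \<Longrightarrow> vars y d e (T(j := r)) \<longleftrightarrow> vars y d e T"
  by (auto simp: vars_def)

lemma vars_set:
  assumes "vars y d e T" "w < d'" "d \<le> d'" "k \<le> length y"
  shows "vars y d' (e(w := k)) (T(4 + w := wtape y (int k)))"
  using assms by (auto simp: vars_def)

lemma dec_const: "dec d (\<lambda>_ _. b)"
  unfolding dec_def
proof (intro exI allI impI)
  fix y e T
  show "runs K (wr 2 (\<lambda>_. b) Stay) T (poly [:1:] (length y)) (T(2 := put b (T 2)))"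
    using runs_wr[of 2 K "\<lambda>_. b" Stay T] V by simp
qed

lemma dec_bit:
  assumes "v < V"
  shows "dec d (\<lambda>y e. e v < length y \<and> y ! e v)"
  unfolding dec_def
proof (intro exI allI impI)
  fix y e T assume *: "vars y d e T"
  have "(syms K T (4 + v) = Some True) = (e v < length y \<and> y ! e v)"
    using varsD[OF * assms] V assms by (auto simp: syms_cell cell_wtape simp del: cell.simps)
  then show "runs K (wr 2 (\<lambda>s. s (4 + v) = Some True) Stay) T (poly [:1:] (length y))
      (T(2 := put (e v < length y \<and> y ! e v) (T 2)))"
    using runs_wr[of 2 K "\<lambda>s. s (4 + v) = Some True" Stay T] V by simp
qed

lemma dec_not:
  assumes "dec d P" shows "dec d (\<lambda>y e. \<not> P y e)"
proof -
  obtain c p where c: "\<And>y e T. vars y d e T \<Longrightarrow>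
     runs K c T (poly p (length y)) (T(2 := put (P y e) (T 2)))"
    using assms unfolding dec_def by blast
  show ?thesis unfolding dec_def
  proof (intro exI allI impI)
    fix y e T assume *: "vars y d e T"
    have "runs K (wr 2 (\<lambda>s. s 2 \<noteq> Some True) Stay) (T(2 := put (P y e) (T 2))) 1
        (T(2 := put (\<not> P y e) (T 2)))"
      using runs_wr[of 2 K "\<lambda>s. s 2 \<noteq> Some True" Stay "T(2 := put (P y e) (T 2))"] V
      by (auto simp: syms_cell)
    from runs_Seq[OF c[OF *] this]
    show "runs K (Seq c (wr 2 (\<lambda>s. s 2 \<noteq> Some True) Stay)) T (poly (p + [:1:]) (length y))
        (T(2 := put (\<not> P y e) (T 2)))" by simp
  qed
qed

lemma dec_conj:
  assumes "dec d P" "dec d Q" shows "dec d (\<lambda>y e. P y e \<and> Q y e)"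
proof -
  obtain c p where c: "\<And>y e T. vars y d e T \<Longrightarrow>
     runs K c T (poly p (length y)) (T(2 := put (P y e) (T 2)))"
    using assms(1) unfolding dec_def by blast
  obtain c' q where c': "\<And>y e T. vars y d e T \<Longrightarrow>
     runs K c' T (poly q (length y)) (T(2 := put (Q y e) (T 2)))"
    using assms(2) unfolding dec_def by blast
  show ?thesis unfolding dec_def
  proof (intro exI allI impI)
    fix y e T assume *: "vars y d e T"
    have "runs K (If (\<lambda>s. s 2 = Some True) c' skip) (T(2 := put (P y e) (T 2)))
        (poly q (length y) + 1 + 2) (T(2 := put (P y e \<and> Q y e) (T 2)))"
      using V c'[of y e "T(2 := put (P y e) (T 2))"] *
      by (intro runs_If) (auto simp: syms_cell intro: runs_mono runs_mono[OF runs_skip])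
    from runs_Seq[OF c[OF *] this]
    show "runs K (Seq c (If (\<lambda>s. s 2 = Some True) c' skip)) T (poly (p + (q + [:3:])) (length y))
        (T(2 := put (P y e \<and> Q y e) (T 2)))" by (rule runs_mono) simp
  qed
qed

lemma dec_imp:
  assumes "dec d P" "dec d Q" shows "dec d (\<lambda>y e. P y e \<longrightarrow> Q y e)"
  using dec_not[OF dec_conj[OF assms(1) dec_not[OF assms(2)]]] by simp

lemma dec_disj:
  assumes "dec d P" "dec d Q" shows "dec d (\<lambda>y e. P y e \<or> Q y e)"
  using dec_imp[OF dec_not[OF assms(1)] assms(2)] by (simp add: disj_imp)

text \<open>The head of variable \<open>d\<close> sweeps over the word while tape 2 holds the
  disjunction so far. Once it is true, the remaining rounds must skip the test, since running it
  would overwrite tape 2.\<close>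

lemma dec_ex:
  assumes "dec (Suc d) P" "d < V" shows "dec d (\<lambda>y e. \<exists>a < length y. P y (e(d := a)))"
proof -
  obtain c p where c: "\<And>y e T. vars y (Suc d) e T \<Longrightarrow>
     runs K c T (poly p (length y)) (T(2 := put (P y e) (T 2)))"
    using assms unfolding dec_def by blast
  define body where "body = Seq (If (\<lambda>s. s 2 = Some True) skip c) (mv {4 + d} MoveRight)"
  show ?thesis unfolding dec_def
  proof (intro exI allI impI)
    fix y e T assume *: "vars y d e T"
    define S where "S = (\<lambda>i. T(2 := put (\<exists>a < i. P y (e(d := a))) (T 2), 4 + d := wtape y (int i)))"
    have T_d: "T (4 + d) = wtape y 0"
      using varsD[OF *, of d] assms(2) by simp
    have 1: "runs K (wr 2 (\<lambda>_. False) Stay) T 1 (S 0)"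
      using runs_wr[of 2 K "\<lambda>_. False" Stay T] V T_d by (simp add: S_def fun_upd_idem)
    have 2: "runs K (While (\<lambda>s. s (4 + d) \<noteq> None) body) (S 0)
      (length y * ((poly p (length y) + 1 + 2 + 1) + 2) + 1) (S (length y))"
    proof (rule runs_While[where S = S])
      fix i assume i: "i < length y"
      have "vars y (Suc d) (e(d := i)) (S i)"
        using vars_set[of y d e "T(2 := put (\<exists>a < i. P y (e(d := a))) (T 2))" d "Suc d" i] * i
        by (simp add: S_def)
      from c[OF this] have c_i: "runs K c (S i) (poly p (length y))
          (T(2 := put (P y (e(d := i))) (T 2), 4 + d := wtape y (int i)))"
        by (simp add: S_def fun_upd_twist)
      have or: "(\<exists>a < Suc i. P y (e(d := a))) \<longleftrightarrow> (\<exists>a < i. P y (e(d := a))) \<or> P y (e(d := i))"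
        by (auto simp: less_Suc_eq)
      have S_2: "syms K (S i) 2 = Some (\<exists>a < i. P y (e(d := a)))"
        using V by (auto simp: S_def syms_cell)
      have "runs K (If (\<lambda>s. s 2 = Some True) skip c) (S i) (poly p (length y) + 1 + 2)
          (T(2 := put (\<exists>a < Suc i. P y (e(d := a))) (T 2), 4 + d := wtape y (int i)))"
      proof (rule runs_If; unfold S_2 or)
        assume "Some (\<exists>a < i. P y (e(d := a))) = Some True"
        then have "((\<exists>a < i. P y (e(d := a))) \<or> P y (e(d := i))) = (\<exists>a < i. P y (e(d := a)))" by blast
        then show "runs K skip (S i) (poly p (length y) + 1)
          (T(2 := put ((\<exists>a < i. P y (e(d := a))) \<or> P y (e(d := i))) (T 2), 4 + d := wtape y (int i)))"
          using runs_mono[OF runs_skip[of K "S i"], of "poly p (length y) + 1"] by (simp only: S_def)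
      next
        assume "Some (\<exists>a < i. P y (e(d := a))) \<noteq> Some True"
        then have "((\<exists>a < i. P y (e(d := a))) \<or> P y (e(d := i))) = P y (e(d := i))" by blast
        then show "runs K c (S i) (poly p (length y) + 1)
          (T(2 := put ((\<exists>a < i. P y (e(d := a))) \<or> P y (e(d := i))) (T 2), 4 + d := wtape y (int i)))"
          using runs_mono[OF c_i, of "poly p (length y) + 1"] by (simp only: )
      qed
      moreover have "runs K (mv {4 + d} MoveRight)
          (T(2 := put (\<exists>a < Suc i. P y (e(d := a))) (T 2), 4 + d := wtape y (int i))) 1 (S (Suc i))"
        by (rule runs_mv) (use V assms(2) in \<open>auto simp: S_def\<close>)
      ultimately have "runs K body (S i) (poly p (length y) + 1 + 2 + 1) (S (Suc i))"
        unfolding body_def by (rule runs_Seq)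
      moreover have "syms K (S i) (4 + d) \<noteq> None"
        using V assms(2) i by (simp add: S_def syms_cell cell_wtape del: cell.simps)
      ultimately show "syms K (S i) (4 + d) \<noteq> None \<and> runs K body (S i) (poly p (length y) + 1 + 2 + 1) (S (Suc i))"
        by blast
    qed (auto simp: S_def syms_cell cell_wtape simp del: cell.simps)
    have 3: "runs K (rewind (4 + d)) (S (length y)) (3 * length y + 3)
        (T(2 := put (\<exists>a < length y. P y (e(d := a))) (T 2)))"
      using runs_rewind[of "4 + d" K "S (length y)" y "length y"] V assms(2) T_d
      by (simp add: S_def fun_upd_idem fun_upd_twist[of "4 + d" 2])
    from runs_Seq[OF 1 runs_Seq[OF 2 3]]
    show "runs K (Seq (wr 2 (\<lambda>_. False) Stay) (Seq (While (\<lambda>s. s (4 + d) \<noteq> None) body) (rewind (4 + d)))) T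
       (poly ([:1:] + ([:0,1:] * (p + [:6:]) + [:1:] + ([:3:] * [:0,1:] + [:3:]))) (length y))
       (T(2 := put (\<exists>a < length y. P y (e(d := a))) (T 2)))"
      by (rule runs_mono) (simp add: algebra_simps)
  qed
qed

lemma dec_all:
  assumes "dec (Suc d) P" "d < V" shows "dec d (\<lambda>y e. \<forall>a < length y. P y (e(d := a)))"
  using dec_not[OF dec_ex[OF dec_not[OF assms(1)] assms(2)]] by simp

section \<open>Comparing two positions\<close>

definition compare :: "nat \<Rightarrow> nat \<Rightarrow> (bool \<Rightarrow> bool \<Rightarrow> bool) \<Rightarrow> com" where
  "compare u v g =
     Seq (While (\<lambda>s. s (4 + u) \<noteq> None \<and> s (4 + v) \<noteq> None)
            (Seq (mv {4 + u, 4 + v} MoveLeft) (mv {3} MoveRight)))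
    (Seq (wr 2 (\<lambda>s. g (s (4 + u) = None) (s (4 + v) = None)) Stay)
    (Seq (mv {3} MoveLeft)
    (Seq (While (\<lambda>s. s 3 \<noteq> None) (Seq (mv {4 + u, 4 + v} MoveRight) (mv {3} MoveLeft)))
         (mv {3} MoveRight))))"

text \<open>Both heads move left in lockstep until one falls off the word; tape 3 counts the moves, so
  that they can be undone.\<close>

lemma runs_compare:
  assumes "vars y d e T" "u < V" "v < V" "u \<noteq> v" "e u < length y" "e v < length y"
  shows "runs K (compare u v g) T (8 * length y + 6)
    (T(2 := put (g (e u \<le> e v) (e v \<le> e u)) (T 2)))"
proof -
  \<comment> \<open>The head nearer to the left end needs one move more than its position to reach
    cell -1. Tape 3 then stands on cell \<open>m\<close>, possibly the blank behind its word, so one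
    move to the left precedes the way back.\<close>
  define m where "m = Suc (min (e u) (e v))"
  define S where "S = (\<lambda>i. T(4 + u := wtape y (int (e u) - int i), 4 + v := wtape y (int (e v) - int i),
     3 := wtape y (int i)))"
  define T2 where "T2 = T(2 := put (g (e u \<le> e v) (e v \<le> e u)) (T 2))"
  define S' where "S' = (\<lambda>i. T2(4 + u := wtape y (int (e u) - int m + int i),
     4 + v := wtape y (int (e v) - int m + int i), 3 := wtape y (int m - 1 - int i)))"
  have T: "T (4 + u) = wtape y (int (e u))" "T (4 + v) = wtape y (int (e v))" "T 3 = wtape y 0"
    using assms by (auto simp: vars_def)
  have K: "4 + u < K" "4 + v < K" "3 < K" "2 < K" using V assms by auto
  have 1: "runs K (While (\<lambda>s. s (4 + u) \<noteq> None \<and> s (4 + v) \<noteq> None)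
      (Seq (mv {4 + u, 4 + v} MoveLeft) (mv {3} MoveRight))) T (m * ((1 + 1) + 2) + 1) (S m)"
  proof (rule runs_While[where S = S])
    fix i assume i: "i < m"
    have "runs K (Seq (mv {4 + u, 4 + v} MoveLeft) (mv {3} MoveRight)) (S i) (1 + 1) (S (Suc i))"
      by (rule runs_Seq[where T' = "(S (Suc i))(3 := wtape y (int i))"];
          rule runs_mv; use K assms(4) in \<open>auto simp: S_def\<close>)
    moreover have "syms K (S i) (4 + u) \<noteq> None" "syms K (S i) (4 + v) \<noteq> None"
      using K assms i by (auto simp: S_def syms_cell cell_wtape m_def simp del: cell.simps)
    ultimately show "(syms K (S i) (4 + u) \<noteq> None \<and> syms K (S i) (4 + v) \<noteq> None) \<and>
       runs K (Seq (mv {4 + u, 4 + v} MoveLeft) (mv {3} MoveRight)) (S i) (1 + 1) (S (Suc i))"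
      by blast
  next
    show "\<not> (syms K (S m) (4 + u) \<noteq> None \<and> syms K (S m) (4 + v) \<noteq> None)"
      using assms by (auto simp: S_def syms_cell cell_wtape m_def simp del: cell.simps)
  qed (use T in \<open>auto simp: S_def fun_upd_idem\<close>)
  \<comment> \<open>Exactly the heads that started at the smaller position have fallen off, both of
    them on a tie, so two bits determine the order.\<close>
  have "(syms K (S m) (4 + u) = None) = (e u \<le> e v)" "(syms K (S m) (4 + v) = None) = (e v \<le> e u)"
    using K assms by (auto simp: S_def syms_cell cell_wtape m_def simp del: cell.simps)
  then have 2: "runs K (wr 2 (\<lambda>s. g (s (4 + u) = None) (s (4 + v) = None)) Stay) (S m) 1
      ((S' 0)(3 := wtape y (int m)))"
    using runs_wr[of 2 K "\<lambda>s. g (s (4 + u) = None) (s (4 + v) = None)" Stay "S m"] K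
    by (auto simp: S_def S'_def T2_def fun_upd_twist[of _ 2])
  have 3: "runs K (mv {3} MoveLeft) ((S' 0)(3 := wtape y (int m))) 1 (S' 0)"
    by (rule runs_mv) (use K in \<open>auto simp: S'_def\<close>)
  have 4: "runs K (While (\<lambda>s. s 3 \<noteq> None) (Seq (mv {4 + u, 4 + v} MoveRight) (mv {3} MoveLeft)))
      (S' 0) (m * ((1 + 1) + 2) + 1) (S' m)"
  proof (rule runs_While[where S = S'])
    fix i assume i: "i < m"
    have "runs K (Seq (mv {4 + u, 4 + v} MoveRight) (mv {3} MoveLeft)) (S' i) (1 + 1) (S' (Suc i))"
      by (rule runs_Seq[where T' = "(S' (Suc i))(3 := wtape y (int m - 1 - int i))"];
          rule runs_mv; use K assms(4) in \<open>auto simp: S'_def\<close>)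
    moreover have "syms K (S' i) 3 \<noteq> None"
      using K assms i by (auto simp: S'_def syms_cell cell_wtape m_def simp del: cell.simps)
    ultimately show "syms K (S' i) 3 \<noteq> None \<and>
       runs K (Seq (mv {4 + u, 4 + v} MoveRight) (mv {3} MoveLeft)) (S' i) (1 + 1) (S' (Suc i))"
      by blast
  next
    show "\<not> syms K (S' m) 3 \<noteq> None"
      by (auto simp: S'_def syms_cell cell_wtape simp del: cell.simps)
  qed auto
  have 5: "runs K (mv {3} MoveRight) (S' m) 1 T2"
    by (rule runs_mv) (use K T assms(4) in \<open>auto simp: S'_def T2_def\<close>)
  have "runs K (compare u v g) T ((m * ((1 + 1) + 2) + 1) + (1 + (1 + ((m * ((1 + 1) + 2) + 1) + 1)))) T2"
    unfolding compare_def by (rule runs_Seq[OF 1 runs_Seq[OF 2 runs_Seq[OF 3 runs_Seq[OF 4 5]]]])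
  moreover have "m \<le> length y" using assms by (auto simp: m_def)
  ultimately show ?thesis unfolding T2_def by (rule_tac runs_mono) auto
qed

text \<open>A variable may have the value \<open>length y\<close>. Its head then reads a blank at
  once, which would stop the lockstep before any move, so the guard answers false in this
  case.\<close>

definition test :: "nat \<Rightarrow> nat \<Rightarrow> (bool \<Rightarrow> bool \<Rightarrow> bool) \<Rightarrow> com" where
  "test u v g = If (\<lambda>s. s (4 + u) \<noteq> None \<and> s (4 + v) \<noteq> None) (compare u v g) (wr 2 (\<lambda>_. False) Stay)"

lemma runs_test:
  assumes "vars y d e T" "u < V" "v < V" "u \<noteq> v"
  shows "runs K (test u v g) T (8 * length y + 8)
    (T(2 := put (e u < length y \<and> e v < length y \<and> g (e u \<le> e v) (e v \<le> e u)) (T 2)))"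
proof -
  have T: "T (4 + u) = wtape y (int (e u))" "T (4 + v) = wtape y (int (e v))"
    using assms by (auto simp: vars_def)
  have K: "4 + u < K" "4 + v < K" using V assms by auto
  have b: "(syms K T (4 + u) \<noteq> None \<and> syms K T (4 + v) \<noteq> None) \<longleftrightarrow> e u < length y \<and> e v < length y"
    using T K by (auto simp: syms_cell cell_wtape simp del: cell.simps)
  have "runs K (test u v g) T ((8 * length y + 6) + 2)
    (T(2 := put (e u < length y \<and> e v < length y \<and> g (e u \<le> e v) (e v \<le> e u)) (T 2)))"
    unfolding test_def
  proof (rule runs_If; unfold b)
    assume "e u < length y \<and> e v < length y"
    then show "runs K (compare u v g) T (8 * length y + 6)
      (T(2 := put (e u < length y \<and> e v < length y \<and> g (e u \<le> e v) (e v \<le> e u)) (T 2)))"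
      using runs_compare[OF assms, of g] by simp
  next
    assume "\<not> (e u < length y \<and> e v < length y)"
    then have False: "(e u < length y \<and> e v < length y \<and> g (e u \<le> e v) (e v \<le> e u)) = False" by blast
    show "runs K (wr 2 (\<lambda>_. False) Stay) T (8 * length y + 6)
      (T(2 := put (e u < length y \<and> e v < length y \<and> g (e u \<le> e v) (e v \<le> e u)) (T 2)))"
      unfolding False using runs_mono[OF runs_wr[of 2 K "\<lambda>_. False" Stay T], of "8 * length y + 6"] V by simp
  qed
  then show ?thesis by (simp add: algebra_simps)
qed

lemma dec_test:
  assumes "u < V" "v < V" "u \<noteq> v"
  shows "dec d (\<lambda>y e. e u < length y \<and> e v < length y \<and> g (e u \<le> e v) (e v \<le> e u))"
  unfolding dec_def
proof (intro exI allI impI)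
  fix y e T assume "vars y d e T"
  from runs_test[OF this assms, of g]
  show "runs K (test u v g) T (poly ([:8:] * [:0,1:] + [:8:]) (length y))
    (T(2 := put (e u < length y \<and> e v < length y \<and> g (e u \<le> e v) (e v \<le> e u)) (T 2)))"
    by (simp add: algebra_simps)
qed

lemma dec_less:
  assumes "u < V" "v < V" "u \<noteq> v"
  shows "dec d (\<lambda>y e. e v < length y \<and> e u < e v)"
proof -
  have "(\<lambda>y e. e v < length y \<and> e u < e v) =
     (\<lambda>(y :: bool list) e. e u < length y \<and> e v < length y \<and> e u \<le> e v \<and> \<not> e v \<le> e u)"
    by (auto simp: fun_eq_iff)
  then show ?thesis using dec_test[OF assms, of d "\<lambda>a b. a \<and> \<not> b"] by simp
qed

lemma dec_eq:
  assumes "u < V" "v < V" "u \<noteq> v"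
  shows "dec d (\<lambda>y e. e v < length y \<and> e u = e v)"
proof -
  have "(\<lambda>y e. e v < length y \<and> e u = e v) =
     (\<lambda>(y :: bool list) e. e u < length y \<and> e v < length y \<and> e u \<le> e v \<and> e v \<le> e u)"
    by (auto simp: fun_eq_iff)
  then show ?thesis using dec_test[OF assms, of d "\<lambda>a b. a \<and> b"] by simp
qed

section \<open>Arithmetic by counting\<close>

definition cnt :: "nat \<Rightarrow> nat \<Rightarrow> (bool list \<Rightarrow> (nat \<Rightarrow> nat) \<Rightarrow> nat) \<Rightarrow> bool" where
  "cnt d w G \<longleftrightarrow> (\<exists>c (p :: nat poly). \<forall>y e k T. vars y d (e(w := k)) T \<longrightarrow>
     (\<exists>b. runs K c T (poly p (length y))
        (T(2 := put b (T 2), 4 + w := wtape y (int (min (length y) (k + G y e)))))))"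

text \<open>Adding one is a move of the head of \<open>w\<close>, which the guard refuses on the
  blank behind the word; this is the saturation at \<open>length y\<close>. The last premise says
  that the test does not look at the counter, whose value \<open>k\<close> depends on what was
  counted before.\<close>

lemma cnt_of_bool:
  assumes "dec d P" "w < V" "\<And>y e k. P y (e(w := k)) = P y e"
  shows "cnt d w (\<lambda>y e. of_bool (P y e))"
proof -
  obtain c p where c: "\<And>y e T. vars y d e T \<Longrightarrow>
     runs K c T (poly p (length y)) (T(2 := put (P y e) (T 2)))"
    using assms unfolding dec_def by blast
  let ?b = "\<lambda>s. s 2 = Some True \<and> s (4 + w) \<noteq> None"
  show ?thesis unfolding cnt_def
  proof (rule exI[of _ "Seq c (If ?b (mv {4 + w} MoveRight) skip)"],
      rule exI[of _ "p + [:3:]"], intro allI impI)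
    fix y e k T assume *: "vars y d (e(w := k)) T"
    define T1 where "T1 = T(2 := put (P y e) (T 2))"
    have 1: "runs K c T (poly p (length y)) T1"
      using c[OF *] assms(3) by (simp add: T1_def)
    have K: "4 + w < K" "2 < K" using V assms(2) by auto
    have T: "T (4 + w) = wtape y (int k)" "k \<le> length y" using varsD[OF * assms(2)] by auto
    have 2: "runs K (If ?b (mv {4 + w} MoveRight) skip) T1 (1 + 2)
       (T(2 := put (P y e) (T 2), 4 + w := wtape y (int (min (length y) (k + of_bool (P y e))))))"
    proof (rule runs_If)
      assume b: "?b (syms K T1)"
      then have "P y e" "k < length y"
        using T K by (auto simp: T1_def syms_cell cell_wtape simp del: cell.simps split: if_splits)
      then show "runs K (mv {4 + w} MoveRight) T1 1
       (T(2 := put (P y e) (T 2), 4 + w := wtape y (int (min (length y) (k + of_bool (P y e))))))"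
        by (intro runs_mv) (use T K in \<open>auto simp: T1_def\<close>)
    next
      assume b: "\<not> ?b (syms K T1)"
      then have "\<not> P y e \<or> k = length y"
        using T K by (auto simp: T1_def syms_cell cell_wtape simp del: cell.simps split: if_splits)
      then have "T1 = T(2 := put (P y e) (T 2), 4 + w := wtape y (int (min (length y) (k + of_bool (P y e)))))"
        using T by (auto simp: T1_def fun_upd_idem)
      then show "runs K skip T1 1
       (T(2 := put (P y e) (T 2), 4 + w := wtape y (int (min (length y) (k + of_bool (P y e))))))"
        using runs_skip[of K T1] by simp
    qed
    from runs_Seq[OF 1 2]
    have "runs K (Seq c (If ?b (mv {4 + w} MoveRight) skip)) T (poly (p + [:3:]) (length y))
       (T(2 := put (P y e) (T 2), 4 + w := wtape y (int (min (length y) (k + of_bool (P y e))))))"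
      by (rule runs_mono) simp
    then show "\<exists>b. runs K (Seq c (If ?b (mv {4 + w} MoveRight) skip)) T (poly (p + [:3:]) (length y))
       (T(2 := put b (T 2), 4 + w := wtape y (int (min (length y) (k + of_bool (P y e))))))"
      by blast
  qed
qed

lemma cnt_add:
  assumes "cnt d w G" "cnt d w H" "w < d"
  shows "cnt d w (\<lambda>y e. G y e + H y e)"
proof -
  obtain c p where c: "\<And>y e k T. vars y d (e(w := k)) T \<Longrightarrow>
     (\<exists>b. runs K c T (poly p (length y))
        (T(2 := put b (T 2), 4 + w := wtape y (int (min (length y) (k + G y e))))))"
    using assms(1) unfolding cnt_def by blast
  obtain c' q where c': "\<And>y e k T. vars y d (e(w := k)) T \<Longrightarrow>
     (\<exists>b. runs K c' T (poly q (length y))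
        (T(2 := put b (T 2), 4 + w := wtape y (int (min (length y) (k + H y e))))))"
    using assms(2) unfolding cnt_def by blast
  show ?thesis unfolding cnt_def
  proof (rule exI[of _ "Seq c c'"], rule exI[of _ "p + q"], intro allI impI)
    fix y e k T assume *: "vars y d (e(w := k)) T"
    define k1 where "k1 = min (length y) (k + G y e)"
    obtain b1 where r1: "runs K c T (poly p (length y)) (T(2 := put b1 (T 2), 4 + w := wtape y (int k1)))"
      using c[OF *] unfolding k1_def by blast
    have "vars y d (e(w := k1)) (T(2 := put b1 (T 2), 4 + w := wtape y (int k1)))"
      using vars_set[of y d "e(w := k)" "T(2 := put b1 (T 2))" w d k1] * assms(3) by (simp add: k1_def)
    from c'[OF this] obtain b2 where r2: "runs K c' (T(2 := put b1 (T 2), 4 + w := wtape y (int k1)))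
       (poly q (length y)) (T(2 := put b2 (T 2), 4 + w := wtape y (int (min (length y) (k1 + H y e)))))"
      by (auto simp: fun_upd_twist[of "4 + w" 2])
    have "min (length y) (k1 + H y e) = min (length y) (k + (G y e + H y e))"
      by (auto simp: k1_def)
    then show "\<exists>b. runs K (Seq c c') T (poly (p + q) (length y))
        (T(2 := put b (T 2), 4 + w := wtape y (int (min (length y) (k + (G y e + H y e))))))"
      using runs_Seq[OF r1 r2] by (intro exI[of _ b2]) (simp only: poly_add)
  qed
qed

text \<open>The counter is never reset between rounds, so repeating the body for every value of the
  loop variable already sums.\<close>

lemma cnt_sum:
  assumes "cnt (Suc d) w G" "w < d" "d < V"
  shows "cnt d w (\<lambda>y e. \<Sum>a < length y. G y (e(d := a)))"
proof -
  obtain c p where c: "\<And>y e k T. vars y (Suc d) (e(w := k)) T \<Longrightarrow>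
     (\<exists>b. runs K c T (poly p (length y))
        (T(2 := put b (T 2), 4 + w := wtape y (int (min (length y) (k + G y e))))))"
    using assms(1) unfolding cnt_def by blast
  let ?body = "Seq c (mv {4 + d} MoveRight)"
  let ?loop = "While (\<lambda>s. s (4 + d) \<noteq> None) ?body"
  show ?thesis unfolding cnt_def
  proof (rule exI[of _ "Seq (wr 2 (\<lambda>_. False) Stay) (Seq ?loop (rewind (4 + d)))"],
      rule exI[of _ "[:1:] + [:0,1:] * (p + [:3:]) + [:1:] + ([:3:] * [:0,1:] + [:3:])"], intro allI impI)
    fix y e k T assume *: "vars y d (e(w := k)) T"
    \<comment> \<open>Truncating after every round gives the same as truncating the whole sum,
      because the summands are natural numbers.\<close>
    define f where "f = (\<lambda>i. min (length y) (k + (\<Sum>a < i. G y (e(d := a)))))"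
    define I where "I = (\<lambda>i T'. \<exists>b. T' = T(2 := put b (T 2), 4 + w := wtape y (int (f i)), 4 + d := wtape y (int i)))"
    have K: "4 + d < K" "4 + w < K" using V assms by auto
    have T: "T (4 + d) = wtape y 0" "T (4 + w) = wtape y (int k)" "k \<le> length y"
      using varsD[OF *, of d] varsD[OF *, of w] assms by auto
    define T0 where "T0 = T(2 := put False (T 2))"
    have 0: "runs K (wr 2 (\<lambda>_. False) Stay) T 1 T0"
      using runs_wr[of 2 K "\<lambda>_. False" Stay T] V by (simp add: T0_def)
    have "\<exists>T'. runs K ?loop T0 ((length y - 0) * ((poly p (length y) + 1) + 2) + 1) T' \<and> I (length y) T'"
    proof (rule runs_While_inv)
      show "I 0 T0" using T by (auto simp: I_def f_def T0_def fun_upd_idem intro!: exI[of _ False])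
    next
      fix i T' assume i: "I i T'" "i < length y"
      obtain b where T': "T' = T(2 := put b (T 2), 4 + w := wtape y (int (f i)), 4 + d := wtape y (int i))"
        using i by (auto simp: I_def)
      have "vars y (Suc d) ((e(w := k))(w := f i)) (T(2 := put b (T 2), 4 + w := wtape y (int (f i))))"
        using vars_set[of y d "e(w := k)" "T(2 := put b (T 2))" w "Suc d" "f i"] * assms(2) by (simp add: f_def)
      from vars_set[OF this, of d "Suc d" i] assms(2) i(2)
      have "vars y (Suc d) ((e(d := i))(w := f i)) T'"
        by (simp add: T' fun_upd_twist[of w d])
      from c[OF this] obtain b' where r': "runs K c T' (poly p (length y))
        (T'(2 := put b' (T' 2), 4 + w := wtape y (int (min (length y) (f i + G y (e(d := i)))))))"
        by blast
      have "min (length y) (f i + G y (e(d := i))) = f (Suc i)" by (auto simp: f_def)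
      then have "T'(2 := put b' (T' 2), 4 + w := wtape y (int (min (length y) (f i + G y (e(d := i)))))) =
         T(2 := put b' (T 2), 4 + w := wtape y (int (f (Suc i))), 4 + d := wtape y (int i))"
        using assms(2) by (auto simp: T' fun_eq_iff)
      then have r'': "runs K c T' (poly p (length y))
         (T(2 := put b' (T 2), 4 + w := wtape y (int (f (Suc i))), 4 + d := wtape y (int i)))"
        using r' by simp
      have "runs K ?body T' (poly p (length y) + 1)
        (T(2 := put b' (T 2), 4 + w := wtape y (int (f (Suc i))), 4 + d := wtape y (int (Suc i))))"
        by (rule runs_Seq[OF r'']) (rule runs_mv, use K assms(2) in auto)
      moreover have "syms K T' (4 + d) \<noteq> None"
        using K i by (simp add: T' syms_cell cell_wtape del: cell.simps)
      ultimately show "syms K T' (4 + d) \<noteq> None \<and>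
        (\<exists>T''. runs K ?body T' (poly p (length y) + 1) T'' \<and> I (Suc i) T'')"
        by (auto simp: I_def)
    next
      fix T' assume "I (length y) T'"
      then show "\<not> syms K T' (4 + d) \<noteq> None"
        by (auto simp: I_def syms_cell cell_wtape simp del: cell.simps)
    qed simp
    then obtain b where r: "runs K ?loop T0 (length y * ((poly p (length y) + 1) + 2) + 1)
        (T(2 := put b (T 2), 4 + w := wtape y (int (f (length y))), 4 + d := wtape y (int (length y))))"
      by (auto simp: I_def)
    have "runs K (rewind (4 + d))
      (T(2 := put b (T 2), 4 + w := wtape y (int (f (length y))), 4 + d := wtape y (int (length y))))
      (3 * length y + 3) (T(2 := put b (T 2), 4 + w := wtape y (int (f (length y)))))"
      using runs_rewind[of "4 + d" K
        "T(2 := put b (T 2), 4 + w := wtape y (int (f (length y))), 4 + d := wtape y (int (length y)))" y "length y"]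
        K T assms(2) by (simp add: fun_upd_idem)
    from runs_Seq[OF 0 runs_Seq[OF r this]]
    have "runs K (Seq (wr 2 (\<lambda>_. False) Stay) (Seq ?loop (rewind (4 + d)))) T
       (poly ([:1:] + [:0,1:] * (p + [:3:]) + [:1:] + ([:3:] * [:0,1:] + [:3:])) (length y))
       (T(2 := put b (T 2), 4 + w := wtape y (int (f (length y)))))"
      by (rule runs_mono) (simp add: algebra_simps)
    then show "\<exists>b. runs K (Seq (wr 2 (\<lambda>_. False) Stay) (Seq ?loop (rewind (4 + d)))) T
       (poly ([:1:] + [:0,1:] * (p + [:3:]) + [:1:] + ([:3:] * [:0,1:] + [:3:])) (length y))
       (T(2 := put b (T 2), 4 + w := wtape y (int (min (length y) (k + (\<Sum>a < length y. G y (e(d := a))))))))"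
      unfolding f_def by blast
  qed
qed

text \<open>Saturation is harmless here: the count is compared with a position inside the word, and
  a saturated counter stands outside it. The free variable \<open>d\<close> serves as the counter;
  it starts at 0 and is rewound afterwards.\<close>

lemma dec_cnt:
  assumes "cnt (Suc d) d G" "v < d" "d < V"
  shows "dec d (\<lambda>y e. e v < length y \<and> G y e = e v)"
proof -
  obtain c p where c: "\<And>y e k T. vars y (Suc d) (e(d := k)) T \<Longrightarrow>
     (\<exists>b. runs K c T (poly p (length y))
        (T(2 := put b (T 2), 4 + d := wtape y (int (min (length y) (k + G y e))))))"
    using assms(1) unfolding cnt_def by blast
  show ?thesis unfolding dec_def
  proof (intro exI allI impI)
    fix y e T assume *: "vars y d e T"
    have T: "T (4 + d) = wtape y 0" "e d = 0"
      using varsD[OF *, of d] assms by auto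
    have "vars y (Suc d) (e(d := 0)) T"
      using vars_set[OF *, of d "Suc d" 0] T by (simp add: fun_upd_idem)
    from c[OF this] obtain b where 1: "runs K c T (poly p (length y))
        (T(2 := put b (T 2), 4 + d := wtape y (int (min (length y) (G y e)))))" by auto
    let ?m = "min (length y) (G y e)"
    have "vars y (Suc d) (e(d := ?m)) (T(2 := put b (T 2), 4 + d := wtape y (int ?m)))"
      using vars_set[of y d e "T(2 := put b (T 2))" d "Suc d" ?m] * by simp
    from runs_test[OF this, of d v "\<lambda>a b. a \<and> b"]
    have "runs K (test d v (\<and>)) (T(2 := put b (T 2), 4 + d := wtape y (int ?m))) (8 * length y + 8)
     (T(4 + d := wtape y (int ?m), 2 := put (?m < length y \<and> e v < length y \<and> ?m \<le> e v \<and> e v \<le> ?m) (T 2)))"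
      using assms by (simp add: fun_upd_twist[of "4 + d" 2])
    moreover have "(?m < length y \<and> e v < length y \<and> ?m \<le> e v \<and> e v \<le> ?m) = (e v < length y \<and> G y e = e v)"
      by auto
    ultimately have 2: "runs K (test d v (\<and>)) (T(2 := put b (T 2), 4 + d := wtape y (int ?m))) (8 * length y + 8)
     (T(4 + d := wtape y (int ?m), 2 := put (e v < length y \<and> G y e = e v) (T 2)))"
      by simp
    have 3: "runs K (rewind (4 + d))
       (T(4 + d := wtape y (int ?m), 2 := put (e v < length y \<and> G y e = e v) (T 2))) (3 * length y + 3)
       (T(2 := put (e v < length y \<and> G y e = e v) (T 2)))"
      using runs_rewind[of "4 + d" K
         "T(4 + d := wtape y (int ?m), 2 := put (e v < length y \<and> G y e = e v) (T 2))" y ?m] assms V T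
      by (simp add: fun_upd_idem fun_upd_twist[of "4 + d" 2])
    from runs_Seq[OF 1 runs_Seq[OF 2 3]]
    show "runs K (Seq c (Seq (test d v (\<and>)) (rewind (4 + d)))) T
       (poly (p + ([:8:] * [:0,1:] + [:8:] + ([:3:] * [:0,1:] + [:3:]))) (length y))
       (T(2 := put (e v < length y \<and> G y e = e v) (T 2)))"
      by (rule runs_mono) simp
  qed
qed

section \<open>Printing on the oracle tape\<close>

definition outp :: "nat \<Rightarrow> (bool list \<Rightarrow> (nat \<Rightarrow> nat) \<Rightarrow> bool list) \<Rightarrow> bool" where
  "outp d S \<longleftrightarrow> (\<exists>c (p :: nat poly). \<forall>y e z T. vars y d e T \<longrightarrow> T 1 = wtape z (int (length z)) \<longrightarrow>
     (\<exists>b. runs K c T (poly p (length y))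
        (T(2 := put b (T 2), 1 := wtape (z @ S y e) (int (length (z @ S y e)))))))"

lemma outpE:
  assumes "outp d S"
  obtains c and p :: "nat poly" where
    "\<And>y e z T. vars y d e T \<Longrightarrow> T 1 = wtape z (int (length z)) \<Longrightarrow>
       (\<exists>b. runs K c T (poly p (length y))
          (T(2 := put b (T 2), 1 := wtape (z @ S y e) (int (length (z @ S y e))))))"
  using assms unfolding outp_def by blast

lemma decE:
  assumes "dec d P"
  obtains c and p :: "nat poly" where
    "\<And>y e T. vars y d e T \<Longrightarrow> runs K c T (poly p (length y)) (T(2 := put (P y e) (T 2)))"
  using assms unfolding dec_def by blast

lemma outp_Nil: "outp d (\<lambda>_ _. [])"
  unfolding outp_def
proof (rule exI[of _ "wr 2 (\<lambda>_. False) Stay"], rule exI[of _ "[:1:]"], intro allI impI)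
  fix y z :: "bool list" and e and T :: tapes assume "T 1 = wtape z (int (length z))"
  then have "T(2 := put False (T 2)) = T(2 := put False (T 2), 1 := wtape z (int (length z)))"
    by (auto simp: fun_eq_iff)
  then show "\<exists>b. runs K (wr 2 (\<lambda>_. False) Stay) T (poly [:1:] (length y))
     (T(2 := put b (T 2), 1 := wtape (z @ []) (int (length (z @ [])))))"
    using runs_wr[of 2 K "\<lambda>_. False" Stay T] V by (intro exI[of _ False]) (simp del: fst_conv)
qed

lemma outp_bit:
  assumes "dec d P" shows "outp d (\<lambda>y e. [P y e])"
proof -
  from decE[OF assms] obtain c p where c: "\<And>y e T. vars y d e T \<Longrightarrow>
     runs K c T (poly p (length y)) (T(2 := put (P y e) (T 2)))" by blast
  show ?thesis unfolding outp_def
  proof (rule exI[of _ "Seq c (wr 1 (\<lambda>s. s 2 = Some True) MoveRight)"], rule exI[of _ "p + [:1:]"],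
      intro allI impI)
    fix y e z T assume *: "vars y d e T" "T 1 = wtape z (int (length z))"
    have K: "1 < K" "2 < K" using V by auto
    have "shift MoveRight (put (P y e) (T 1)) = wtape (z @ [P y e]) (int (length (z @ [P y e])))"
      unfolding *(2) put_wtape by simp
    then have "runs K (wr 1 (\<lambda>s. s 2 = Some True) MoveRight) (T(2 := put (P y e) (T 2))) 1
       (T(2 := put (P y e) (T 2), 1 := wtape (z @ [P y e]) (int (length (z @ [P y e])))))"
      using runs_wr[of 1 K "\<lambda>s. s 2 = Some True" MoveRight "T(2 := put (P y e) (T 2))"] K
      by (simp add: syms_cell)
    from runs_Seq[OF c[OF *(1)] this]
    show "\<exists>b. runs K (Seq c (wr 1 (\<lambda>s. s 2 = Some True) MoveRight)) T (poly (p + [:1:]) (length y))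
       (T(2 := put b (T 2), 1 := wtape (z @ [P y e]) (int (length (z @ [P y e])))))"
      by (intro exI[of _ "P y e"]) (rule runs_mono, assumption, simp)
  qed
qed

lemma outp_append:
  assumes "outp d S" "outp d R" shows "outp d (\<lambda>y e. S y e @ R y e)"
proof -
  from outpE[OF assms(1)] obtain c and p :: "nat poly" where
    c: "\<And>y e z T. vars y d e T \<Longrightarrow> T 1 = wtape z (int (length z)) \<Longrightarrow>
       (\<exists>b. runs K c T (poly p (length y))
          (T(2 := put b (T 2), 1 := wtape (z @ S y e) (int (length (z @ S y e))))))"
    by blast
  from outpE[OF assms(2)] obtain c' and q :: "nat poly" where
    c': "\<And>y e z T. vars y d e T \<Longrightarrow> T 1 = wtape z (int (length z)) \<Longrightarrow>
       (\<exists>b. runs K c' T (poly q (length y))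
          (T(2 := put b (T 2), 1 := wtape (z @ R y e) (int (length (z @ R y e))))))"
    by blast
  show ?thesis unfolding outp_def
  proof (rule exI[of _ "Seq c c'"], rule exI[of _ "p + q"], intro allI impI)
    fix y e z T assume *: "vars y d e T" "T 1 = wtape z (int (length z))"
    obtain b where b: "runs K c T (poly p (length y))
          (T(2 := put b (T 2), 1 := wtape (z @ S y e) (int (length (z @ S y e)))))"
      using c[OF *] by blast
    obtain b' where b': "runs K c' (T(2 := put b (T 2), 1 := wtape (z @ S y e) (int (length (z @ S y e)))))
         (poly q (length y))
         (T(2 := put b' (T 2), 1 := wtape ((z @ S y e) @ R y e) (int (length ((z @ S y e) @ R y e)))))"
      using c'[of y e "T(2 := put b (T 2), 1 := wtape (z @ S y e) (int (length (z @ S y e))))" "z @ S y e"] *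
      by (auto simp: fun_upd_twist[of 1 2])
    from runs_Seq[OF b b']
    show "\<exists>b. runs K (Seq c c') T (poly (p + q) (length y))
        (T(2 := put b (T 2), 1 := wtape (z @ S y e @ R y e) (int (length (z @ S y e @ R y e)))))"
      by (intro exI[of _ b']) (simp only: poly_add append_assoc)
  qed
qed

lemma outp_if:
  assumes "dec d P" "outp d S" shows "outp d (\<lambda>y e. if P y e then S y e else [])"
proof -
  from decE[OF assms(1)] obtain c p where c: "\<And>y e T. vars y d e T \<Longrightarrow>
     runs K c T (poly p (length y)) (T(2 := put (P y e) (T 2)))" by blast
  from outpE[OF assms(2)] obtain c' and q :: "nat poly" where
    c': "\<And>y e z T. vars y d e T \<Longrightarrow> T 1 = wtape z (int (length z)) \<Longrightarrow>
       (\<exists>b. runs K c' T (poly q (length y))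
          (T(2 := put b (T 2), 1 := wtape (z @ S y e) (int (length (z @ S y e))))))"
    by blast
  show ?thesis unfolding outp_def
  proof (rule exI[of _ "Seq c (If (\<lambda>s. s 2 = Some True) c' skip)"], rule exI[of _ "p + (q + [:1:] + [:2:])"],
      intro allI impI)
    fix y e z T assume *: "vars y d e T" "T 1 = wtape z (int (length z))"
    let ?T = "T(2 := put (P y e) (T 2))"
    have s: "syms K ?T 2 = Some (P y e)" using V by (simp add: syms_cell)
    have "\<exists>b. runs K (If (\<lambda>s. s 2 = Some True) c' skip) ?T (poly q (length y) + 1 + 2)
      (T(2 := put b (T 2), 1 := wtape (z @ (if P y e then S y e else []))
          (int (length (z @ (if P y e then S y e else []))))))"
    proof (cases "P y e")
      case True
      obtain b where "runs K c' ?T (poly q (length y))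
          (T(2 := put b (T 2), 1 := wtape (z @ S y e) (int (length (z @ S y e)))))"
        using c'[of y e ?T z] * by (auto simp: fun_upd_twist[of 1 2])
      then have "runs K (If (\<lambda>s. s 2 = Some True) c' skip) ?T (poly q (length y) + 1 + 2)
          (T(2 := put b (T 2), 1 := wtape (z @ S y e) (int (length (z @ S y e)))))"
        using True s by (intro runs_If) (auto intro: runs_mono)
      then show ?thesis using True by (intro exI[of _ b]) (simp only: if_True)
    next
      case False
      have "?T = T(2 := put False (T 2), 1 := wtape z (int (length z)))"
        using False *(2) by (auto simp: fun_eq_iff)
      then have "runs K skip ?T (poly q (length y) + 1)
         (T(2 := put False (T 2), 1 := wtape z (int (length z))))"
        using runs_mono[OF runs_skip[of K ?T], of "poly q (length y) + 1"] by simp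
      then have "runs K (If (\<lambda>s. s 2 = Some True) c' skip) ?T (poly q (length y) + 1 + 2)
         (T(2 := put False (T 2), 1 := wtape z (int (length z))))"
        using False s by (intro runs_If) auto
      then show ?thesis using False by (intro exI[of _ False]) (simp only: if_False append_Nil2)
    qed
    then obtain b where "runs K (If (\<lambda>s. s 2 = Some True) c' skip) ?T (poly q (length y) + 1 + 2)
      (T(2 := put b (T 2), 1 := wtape (z @ (if P y e then S y e else []))
          (int (length (z @ (if P y e then S y e else []))))))" by blast
    from runs_Seq[OF c[OF *(1)] this]
    show "\<exists>b. runs K (Seq c (If (\<lambda>s. s 2 = Some True) c' skip)) T (poly (p + (q + [:1:] + [:2:])) (length y))
      (T(2 := put b (T 2), 1 := wtape (z @ (if P y e then S y e else []))
          (int (length (z @ (if P y e then S y e else []))))))"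
      by (intro exI[of _ b]) (rule runs_mono, assumption, simp)
  qed
qed

lemma outp_for:
  assumes "outp (Suc d) S" "d < V"
  shows "outp d (\<lambda>y e. concat (map (\<lambda>a. S y (e(d := a))) [0..<length y]))"
proof -
  from outpE[OF assms(1)] obtain c and p :: "nat poly" where
    c: "\<And>y e z T. vars y (Suc d) e T \<Longrightarrow> T 1 = wtape z (int (length z)) \<Longrightarrow>
       (\<exists>b. runs K c T (poly p (length y))
          (T(2 := put b (T 2), 1 := wtape (z @ S y e) (int (length (z @ S y e))))))"
    by blast
  let ?body = "Seq c (mv {4 + d} MoveRight)"
  let ?loop = "While (\<lambda>s. s (4 + d) \<noteq> None) ?body"
  let ?prog = "Seq (wr 2 (\<lambda>_. False) Stay) (Seq ?loop (rewind (4 + d)))"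
  let ?p = "[:1:] + ([:0,1:] * (p + [:3:]) + [:1:] + ([:3:] * [:0,1:] + [:3:]))"
  show ?thesis unfolding outp_def
  proof (rule exI[of _ ?prog], rule exI[of _ ?p], intro allI impI)
    fix y e z T assume *: "vars y d e T" "T 1 = wtape z (int (length z))"
    define f where "f = (\<lambda>i. z @ concat (map (\<lambda>a. S y (e(d := a))) [0..<i]))"
    define I where "I = (\<lambda>i T'. \<exists>b. T' = T(2 := put b (T 2), 1 := wtape (f i) (int (length (f i))),
       4 + d := wtape y (int i)))"
    have K: "4 + d < K" using V assms by auto
    have T: "T (4 + d) = wtape y 0" using varsD[OF *(1), of d] assms by auto
    define T0 where "T0 = T(2 := put False (T 2))"
    have 0: "runs K (wr 2 (\<lambda>_. False) Stay) T 1 T0"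
      using runs_wr[of 2 K "\<lambda>_. False" Stay T] V by (simp add: T0_def)
    have "\<exists>T'. runs K ?loop T0 ((length y - 0) * ((poly p (length y) + 1) + 2) + 1) T' \<and> I (length y) T'"
    proof (rule runs_While_inv)
      show "I 0 T0" using T *(2) by (auto simp: I_def f_def T0_def fun_eq_iff intro!: exI[of _ False])
    next
      fix i T' assume i: "I i T'" "i < length y"
      obtain b where T': "T' = T(2 := put b (T 2), 1 := wtape (f i) (int (length (f i))),
          4 + d := wtape y (int i))"
        using i by (auto simp: I_def)
      have "vars y (Suc d) (e(d := i)) T'"
        using vars_set[of y d e "T(2 := put b (T 2), 1 := wtape (f i) (int (length (f i))))" d "Suc d" i] * i(2)
        by (simp add: T')
      from c[OF this, of "f i"] obtain b' where r': "runs K c T' (poly p (length y))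
        (T'(2 := put b' (T' 2), 1 := wtape (f i @ S y (e(d := i))) (int (length (f i @ S y (e(d := i)))))))"
        by (auto simp: T')
      have f: "f i @ S y (e(d := i)) = f (Suc i)" by (simp add: f_def)
      have "T'(2 := put b' (T' 2), 1 := wtape (f (Suc i)) (int (length (f (Suc i))))) =
         T(2 := put b' (T 2), 1 := wtape (f (Suc i)) (int (length (f (Suc i)))), 4 + d := wtape y (int i))"
        by (auto simp: T' fun_eq_iff)
      then have r'': "runs K c T' (poly p (length y))
         (T(2 := put b' (T 2), 1 := wtape (f (Suc i)) (int (length (f (Suc i)))), 4 + d := wtape y (int i)))"
        using r' unfolding f by (simp only:)
      have "runs K ?body T' (poly p (length y) + 1)
        (T(2 := put b' (T 2), 1 := wtape (f (Suc i)) (int (length (f (Suc i)))), 4 + d := wtape y (int (Suc i))))"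
        by (rule runs_Seq[OF r'']) (rule runs_mv, use K in auto)
      moreover have "syms K T' (4 + d) \<noteq> None"
        using K i by (simp add: T' syms_cell cell_wtape del: cell.simps)
      ultimately show "syms K T' (4 + d) \<noteq> None \<and>
        (\<exists>T''. runs K ?body T' (poly p (length y) + 1) T'' \<and> I (Suc i) T'')"
        unfolding I_def by blast
    next
      fix T' assume "I (length y) T'"
      then show "\<not> syms K T' (4 + d) \<noteq> None"
        by (auto simp: I_def syms_cell cell_wtape simp del: cell.simps)
    qed simp
    then obtain b where r: "runs K ?loop T0 (length y * ((poly p (length y) + 1) + 2) + 1)
        (T(2 := put b (T 2), 1 := wtape (f (length y)) (int (length (f (length y)))),
           4 + d := wtape y (int (length y))))"
      unfolding I_def by auto
    have "runs K (rewind (4 + d))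
      (T(2 := put b (T 2), 1 := wtape (f (length y)) (int (length (f (length y)))),
           4 + d := wtape y (int (length y))))
      (3 * length y + 3) (T(2 := put b (T 2), 1 := wtape (f (length y)) (int (length (f (length y))))))"
      using runs_rewind[of "4 + d" K
        "T(2 := put b (T 2), 1 := wtape (f (length y)) (int (length (f (length y)))),
           4 + d := wtape y (int (length y)))" y "length y"]
        K T by (simp add: fun_upd_idem)
    from runs_Seq[OF 0 runs_Seq[OF r this]]
    have "runs K ?prog T (poly ?p (length y))
      (T(2 := put b (T 2), 1 := wtape (f (length y)) (int (length (f (length y))))))"
      by (rule runs_mono) (simp add: algebra_simps)
    then show "\<exists>b. runs K ?prog T (poly ?p (length y))
      (T(2 := put b (T 2), 1 := wtape (z @ concat (map (\<lambda>a. S y (e(d := a))) [0..<length y]))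
         (int (length (z @ concat (map (\<lambda>a. S y (e(d := a))) [0..<length y]))))))"
      unfolding f_def by blast
  qed
qed

end

section \<open>The gadget graph\<close>

definition graph_of :: "nat \<Rightarrow> (nat \<Rightarrow> nat \<Rightarrow> bool) \<Rightarrow> nat ugraph" where
  "graph_of n A = ({..<n}, {{i, j} | i j. i < n \<and> j < n \<and> A i j})"

definition sym_irrefl :: "nat \<Rightarrow> (nat \<Rightarrow> nat \<Rightarrow> bool) \<Rightarrow> bool" where
  "sym_irrefl n A \<longleftrightarrow> (\<forall>i < n. \<not> A i i) \<and> (\<forall>i < n. \<forall>j < n. A i j \<longrightarrow> A j i)"

text \<open>The order makes the triple unique, so \<open>is_nbr\<close> can speak of the
  \<open>k\<close>-th neighbour without a choice function. All quantifiers range over vertices,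
  hence over positions of the input word.\<close>

definition nbrs3 :: "nat \<Rightarrow> (nat \<Rightarrow> nat \<Rightarrow> bool) \<Rightarrow> nat \<Rightarrow> nat \<Rightarrow> nat \<Rightarrow> nat \<Rightarrow> bool" where
  "nbrs3 n A v a b c \<longleftrightarrow> a < b \<and> b < c \<and> c < n \<and> A v a \<and> A v b \<and> A v c \<and>
     (\<forall>w < n. A v w \<longrightarrow> w = a \<or> w = b \<or> w = c)"

definition cubic :: "nat \<Rightarrow> (nat \<Rightarrow> nat \<Rightarrow> bool) \<Rightarrow> bool" where
  "cubic n A \<longleftrightarrow> sym_irrefl n A \<and> (\<forall>v < n. \<exists>a < n. \<exists>b < n. \<exists>c < n. nbrs3 n A v a b c)"

definition is_nbr :: "nat \<Rightarrow> (nat \<Rightarrow> nat \<Rightarrow> bool) \<Rightarrow> nat \<Rightarrow> nat \<Rightarrow> nat \<Rightarrow> bool" where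
  "is_nbr n A k v u \<longleftrightarrow> (\<exists>a < n. \<exists>b < n.
     if k = 0 then nbrs3 n A v u a b else if k = 1 then nbrs3 n A v a u b else nbrs3 n A v a b u)"

text \<open>Vertex \<open>5 v + k\<close> of the reduction graph is the copy of the \<open>k\<close>-th neighbour of \<open>v\<close> in the
  triangle of \<open>v\<close> for \<open>k < 3\<close>, the vertex forcing the copies of \<open>v\<close> to agree for \<open>k = 3\<close>, and
  the vertex \<open>v\<close> of a disjoint copy of the original graph for \<open>k = 4\<close>.\<close>

definition gadget :: "nat \<Rightarrow> (nat \<Rightarrow> nat \<Rightarrow> bool) \<Rightarrow> nat \<Rightarrow> nat \<Rightarrow> nat \<Rightarrow> nat \<Rightarrow> bool" where
  "gadget n A k l v u \<longleftrightarrow>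
     (k < 3 \<and> l < 3 \<and> k \<noteq> l) \<and> v = u \<or> (k < 3 \<and> l = 3) \<and> is_nbr n A k v u \<or>
     (k = 3 \<and> l < 3) \<and> is_nbr n A l u v \<or> (k = 4 \<and> l = 4) \<and> A v u"

definition gadget_adj :: "nat \<Rightarrow> (nat \<Rightarrow> nat \<Rightarrow> bool) \<Rightarrow> nat \<Rightarrow> nat \<Rightarrow> bool" where
  "gadget_adj n A i j = gadget n A (i mod 5) (j mod 5) (i div 5) (j div 5)"

definition gadget_graph :: "nat \<Rightarrow> (nat \<Rightarrow> nat \<Rightarrow> bool) \<Rightarrow> nat ugraph" where
  "gadget_graph n A = graph_of (5 * n) (gadget_adj n A)"

section \<open>Graphs given by relations, partitions given by colourings\<close>

lemma verts_graph_of [simp]: "verts (graph_of n A) = {..<n}"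
  by (simp add: graph_of_def)

lemma edge_graph_of:
  assumes "sym_irrefl n A"
  shows "{i, j} \<in> edges (graph_of n A) \<longleftrightarrow> i < n \<and> j < n \<and> A i j"
  using assms by (auto simp: graph_of_def sym_irrefl_def doubleton_eq_iff)

lemma graph_instance_graph_of:
  assumes "sym_irrefl n A" shows "graph_instance (graph_of n A)"
proof -
  have "card {i, j} = 2" if "i < n" "j < n" "A i j" for i j
    using that assms by (cases "i = j") (auto simp: sym_irrefl_def)
  then show ?thesis
    by (auto simp: graph_instance_def simple_graph_def graph_of_def)
qed

lemma neighbors_graph_of:
  assumes "sym_irrefl n A" "v < n"
  shows "neighbors (graph_of n A) v = {u. u < n \<and> A v u}"
  using assms edge_graph_of[OF assms(1)]
  by (auto simp: neighbors_def sym_irrefl_def)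

lemma graph_instance_eq_graph_of:
  assumes "graph_instance G" "verts G = {..<n}"
  shows "G = graph_of n (\<lambda>i j. {i, j} \<in> edges G)" "sym_irrefl n (\<lambda>i j. {i, j} \<in> edges G)"
proof -
  have e: "e \<in> edges G \<Longrightarrow> e \<subseteq> {..<n} \<and> card e = 2" for e
    using assms by (auto simp: graph_instance_def simple_graph_def)
  have "\<exists>i j. e = {i, j} \<and> i < n \<and> j < n \<and> {i, j} \<in> edges G" if "e \<in> edges G" for e
    using e[OF that] that by (auto simp: card_2_iff)
  then have "edges G = {{i, j} | i j. i < n \<and> j < n \<and> {i, j} \<in> edges G}" by blast
  then show "G = graph_of n (\<lambda>i j. {i, j} \<in> edges G)"
    using assms(2) by (simp add: graph_of_def prod_eq_iff)
  have "{i} \<notin> edges G" for i using e[of "{i}"] by auto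
  then show "sym_irrefl n (\<lambda>i j. {i, j} \<in> edges G)"
    by (auto simp: sym_irrefl_def insert_commute)
qed

lemma card_3_sorted:
  assumes "card (S :: nat set) = 3"
  obtains a b c where "S = {a, b, c}" "a < b" "b < c"
proof -
  have fin: "finite S" using assms by (intro card_ge_0_finite) simp
  define xs where "xs = sorted_list_of_set S"
  have xs: "length xs = 3" "sorted_wrt (<) xs" "set xs = S"
    using fin assms by (auto simp: xs_def)
  then obtain a b c where "xs = [a, b, c]"
    by (auto simp: numeral_3_eq_3 length_Suc_conv)
  then show ?thesis using that xs by auto
qed

lemma regular_3_iff_cubic:
  assumes "sym_irrefl n A"
  shows "regular 3 (graph_of n A) \<longleftrightarrow> cubic n A"
proof -
  have "card {u. u < n \<and> A v u} = 3 \<longleftrightarrow> (\<exists>a < n. \<exists>b < n. \<exists>c < n. nbrs3 n A v a b c)" (is "?L = ?R") for v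
  proof
    assume ?L
    then obtain a b c where abc: "{u. u < n \<and> A v u} = {a, b, c}" "a < b" "b < c"
      by (rule card_3_sorted)
    then have "a < n \<and> A v a" "b < n \<and> A v b" "c < n \<and> A v c" by blast+
    with abc show ?R unfolding nbrs3_def by blast
  next
    assume ?R
    then obtain a b c where abc: "nbrs3 n A v a b c" by blast
    then have "a < b" "b < c" "{u. u < n \<and> A v u} = {a, b, c}"
      unfolding nbrs3_def by auto
    then show ?L by simp
  qed
  then show ?thesis
    using assms by (auto simp: regular_def cubic_def neighbors_graph_of)
qed

lemma bipartite_graph_of_minus:
  "bipartite ({..<n}, edges (graph_of n A) - F) \<longleftrightarrow>
     (\<exists>c :: nat \<Rightarrow> bool. \<forall>i j. i < n \<longrightarrow> j < n \<longrightarrow> A i j \<longrightarrow> {i, j} \<notin> F \<longrightarrow> c i \<noteq> c j)"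
  (is "?L = ?R")
proof
  assume ?L
  then obtain S T where ST: "S \<union> T = {..<n}" "S \<inter> T = {}"
     "\<And>e. e \<in> edges (graph_of n A) - F \<Longrightarrow> e \<inter> S \<noteq> {} \<and> e \<inter> T \<noteq> {}"
    unfolding bipartite_def by auto
  have "(i \<in> S) \<noteq> (j \<in> S)" if "i < n" "j < n" "A i j" "{i, j} \<notin> F" for i j
    using ST(3)[of "{i, j}"] ST(2) that by (auto simp: graph_of_def)
  then show ?R by (intro exI[of _ "\<lambda>i. i \<in> S"]) blast
next
  assume ?R
  then obtain c :: "nat \<Rightarrow> bool" where
    c: "\<And>i j. i < n \<Longrightarrow> j < n \<Longrightarrow> A i j \<Longrightarrow> {i, j} \<notin> F \<Longrightarrow> c i \<noteq> c j"
    by blast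
  show ?L unfolding bipartite_def
  proof (intro exI conjI ballI)
    show "{i. i < n \<and> c i} \<union> {i. i < n \<and> \<not> c i} = verts ({..<n}, edges (graph_of n A) - F)" by auto
    show "{i. i < n \<and> c i} \<inter> {i. i < n \<and> \<not> c i} = {}" by auto
    fix e assume "e \<in> edges ({..<n}, edges (graph_of n A) - F)"
    then obtain i j where e: "e = {i, j}" "i < n" "j < n" "A i j" "{i, j} \<notin> F"
      by (auto simp: graph_of_def)
    with c[OF e(2-5)] show "e \<inter> {i. i < n \<and> c i} \<noteq> {}" "e \<inter> {i. i < n \<and> \<not> c i} \<noteq> {}"
      by auto
  qed
qed

lemma bipartite_graph_of:
  "bipartite (graph_of n A) \<longleftrightarrow>
     (\<exists>c :: nat \<Rightarrow> bool. \<forall>i j. i < n \<longrightarrow> j < n \<longrightarrow> A i j \<longrightarrow> c i \<noteq> c j)"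
proof -
  have "graph_of n A = ({..<n}, edges (graph_of n A) - {})" by (simp add: graph_of_def)
  then show ?thesis using bipartite_graph_of_minus[of n A "{}"] by simp
qed

lemma NAE_graph_of:
  assumes "sym_irrefl n A"
  shows "(\<exists>S T. NAE_decomposition (graph_of n A) S T) \<longleftrightarrow>
     (\<exists>c :: nat \<Rightarrow> bool. \<forall>v < n. \<exists>u < n. \<exists>w < n. A v u \<and> A v w \<and> c u \<and> \<not> c w)" (is "?L = ?R")
proof
  assume ?L
  then obtain S T where ST: "S \<union> T = {..<n}" "S \<inter> T = {}"
     "\<And>v. v < n \<Longrightarrow> neighbors (graph_of n A) v \<inter> S \<noteq> {} \<and> neighbors (graph_of n A) v \<inter> T \<noteq> {}"
    by (auto simp: NAE_decomposition_def)
  have "\<exists>u < n. \<exists>w < n. A v u \<and> A v w \<and> u \<in> S \<and> \<not> w \<in> S" if "v < n" for v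
    using ST(3)[OF that] ST(2) unfolding neighbors_graph_of[OF assms that] by blast
  then show ?R by (intro exI[of _ "\<lambda>i. i \<in> S"]) blast
next
  assume ?R
  then obtain c :: "nat \<Rightarrow> bool" where
    c: "\<And>v. v < n \<Longrightarrow> \<exists>u < n. \<exists>w < n. A v u \<and> A v w \<and> c u \<and> \<not> c w" by blast
  have "NAE_decomposition (graph_of n A) {i. i < n \<and> c i} {i. i < n \<and> \<not> c i}"
    unfolding NAE_decomposition_def
  proof (intro conjI ballI)
    fix v assume "v \<in> verts (graph_of n A)"
    then have v: "v < n" by simp
    show "neighbors (graph_of n A) v \<inter> {i. i < n \<and> c i} \<noteq> {}"
      "neighbors (graph_of n A) v \<inter> {i. i < n \<and> \<not> c i} \<noteq> {}"
      using c[OF v] unfolding neighbors_graph_of[OF assms v] by blast+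
  qed auto
  then show ?L by blast
qed

lemma div_mod_5: "5 * v + k = 5 * w + l \<Longrightarrow> k < 5 \<Longrightarrow> l < 5 \<Longrightarrow> v = w \<and> k = l" for v k w l :: nat
  by presburger

text \<open>The enumeration \<open>N\<close> serves the proofs; \<open>gadget_adj\<close> is defined
  without it so that a program can evaluate it.\<close>

locale cubic_graph =
  fixes n :: nat and A :: "nat \<Rightarrow> nat \<Rightarrow> bool" and N :: "nat \<Rightarrow> nat \<Rightarrow> nat"
  assumes sym_irrefl: "sym_irrefl n A"
    and nbrs: "\<And>v. v < n \<Longrightarrow> nbrs3 n A v (N 0 v) (N 1 v) (N 2 v)"
begin

lemma less_3: "k < 3 \<longleftrightarrow> k = 0 \<or> k = 1 \<or> k = (2 :: nat)"
  by auto

lemma N_less: "v < n \<Longrightarrow> k < 3 \<Longrightarrow> N k v < n"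
  using nbrs[of v] by (auto simp: nbrs3_def less_3)

lemma N_inj: "v < n \<Longrightarrow> k < 3 \<Longrightarrow> l < 3 \<Longrightarrow> N k v = N l v \<longleftrightarrow> k = l"
  using nbrs[of v] by (auto simp: nbrs3_def less_3)

lemma A_iff: "v < n \<Longrightarrow> u < n \<Longrightarrow> A v u \<longleftrightarrow> (\<exists>k < 3. u = N k v)"
  using nbrs[of v] by (auto simp: nbrs3_def less_3)

lemma A_sym: "v < n \<Longrightarrow> u < n \<Longrightarrow> A v u \<longleftrightarrow> A u v"
  using sym_irrefl by (auto simp: sym_irrefl_def)

lemma nbrs3_unique:
  assumes "v < n" "nbrs3 n A v a b c" shows "a = N 0 v" "b = N 1 v" "c = N 2 v"
proof -
  have abc: "a < b" "b < c" and N: "N 0 v < N 1 v" "N 1 v < N 2 v"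
    using assms(2) nbrs[OF assms(1)] by (auto simp: nbrs3_def)
  have "{a, b, c} = {w. w < n \<and> A v w}"
    using assms(2) unfolding nbrs3_def by auto
  also have "\<dots> = {N 0 v, N 1 v, N 2 v}"
    using nbrs[OF assms(1)] unfolding nbrs3_def by auto
  finally have eq: "{a, b, c} = {N 0 v, N 1 v, N 2 v}" .
  have sorted: "sorted_list_of_set {a, b, c} = [a, b, c]" if "a < b" "b < c" for a b c :: nat
    using that by simp
  have "[a, b, c] = [N 0 v, N 1 v, N 2 v]"
    using sorted[OF abc] sorted[OF N] unfolding eq by simp
  then show "a = N 0 v" "b = N 1 v" "c = N 2 v" by auto
qed

lemma is_nbr_iff:
  assumes "v < n" "k < 3"
  shows "is_nbr n A k v u \<longleftrightarrow> u = N k v"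
proof -
  have eq: "nbrs3 n A v a b c \<longleftrightarrow> a = N 0 v \<and> b = N 1 v \<and> c = N 2 v" for a b c
  proof
    assume *: "nbrs3 n A v a b c"
    show "a = N 0 v \<and> b = N 1 v \<and> c = N 2 v"
      by (intro conjI nbrs3_unique[OF assms(1) *])
  next
    assume *: "a = N 0 v \<and> b = N 1 v \<and> c = N 2 v"
    then show "nbrs3 n A v a b c" by (simp only: nbrs[OF assms(1)])
  qed
  have N: "N 0 v < n" "N 1 v < n" "N 2 v < n" using N_less[OF assms(1)] by auto
  consider "k = 0" | "k = 1" | "k = 2" using assms(2) by (auto simp: less_3)
  then show ?thesis
  proof cases
    case 1
    then show ?thesis unfolding is_nbr_def eq using N by auto
  next
    case 2
    then show ?thesis unfolding is_nbr_def eq using N by auto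
  next
    case 3
    then show ?thesis unfolding is_nbr_def eq using N by auto
  qed
qed

section \<open>The reduction graph is cubic\<close>

abbreviation "H \<equiv> gadget_adj n A"

lemma H_triangle: "v < n \<Longrightarrow> k < 3 \<Longrightarrow> l < 3 \<Longrightarrow> k \<noteq> l \<Longrightarrow> H (5 * v + k) (5 * v + l)"
  by (simp add: gadget_adj_def gadget_def)

lemma H_link: "v < n \<Longrightarrow> k < 3 \<Longrightarrow> H (5 * v + k) (5 * N k v + 3)"
  by (simp add: gadget_adj_def gadget_def is_nbr_iff)

lemma H_copy: "v < n \<Longrightarrow> u < n \<Longrightarrow> A v u \<Longrightarrow> H (5 * v + 4) (5 * u + 4)"
  by (simp add: gadget_adj_def gadget_def)

text \<open>Eliminates \<open>div\<close> and \<open>mod\<close> once and for all: an edge lies in a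
  triangle, links a corner to the vertex it stands for (in either direction), or belongs to the
  copy.\<close>

lemma H_cases:
  assumes "H i j" "i < 5 * n" "j < 5 * n"
  obtains (triangle) v k l where "v < n" "k < 3" "l < 3" "k \<noteq> l" "i = 5 * v + k" "j = 5 * v + l"
  | (link) v k where "v < n" "k < 3" "i = 5 * v + k" "j = 5 * N k v + 3"
  | (link') v k where "v < n" "k < 3" "j = 5 * v + k" "i = 5 * N k v + 3"
  | (copy) v u where "v < n" "u < n" "A v u" "i = 5 * v + 4" "j = 5 * u + 4"
proof -
  have i: "i = 5 * (i div 5) + i mod 5" "i div 5 < n" and j: "j = 5 * (j div 5) + j mod 5" "j div 5 < n"
    using assms by auto
  from assms(1) consider
      "i mod 5 < 3" "j mod 5 < 3" "i mod 5 \<noteq> j mod 5" "i div 5 = j div 5"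
    | "i mod 5 < 3" "j mod 5 = 3" "j div 5 = N (i mod 5) (i div 5)"
    | "j mod 5 < 3" "i mod 5 = 3" "i div 5 = N (j mod 5) (j div 5)"
    | "i mod 5 = 4" "j mod 5 = 4" "A (i div 5) (j div 5)"
    using i j by (auto simp: gadget_adj_def gadget_def is_nbr_iff)
  then show ?thesis
  proof cases
    case 1
    then show ?thesis using triangle[of "i div 5" "i mod 5" "j mod 5"] i j by metis
  next
    case 2
    then show ?thesis using link[of "i div 5" "i mod 5"] i j by metis
  next
    case 3
    then show ?thesis using link'[of "j div 5" "j mod 5"] i j by metis
  next
    case 4
    then show ?thesis using copy[of "i div 5" "j div 5"] i j by metis
  qed
qed

lemma H_sym_irrefl: "sym_irrefl (5 * n) H"
  unfolding sym_irrefl_def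
proof (intro conjI allI impI)
  fix i assume i: "i < 5 * n"
  then have "i div 5 < n" by auto
  then show "\<not> H i i"
    using sym_irrefl by (auto simp: gadget_adj_def gadget_def sym_irrefl_def)
next
  fix i j assume "i < 5 * n" "j < 5 * n" "H i j"
  then have "i div 5 < n" "j div 5 < n" by auto
  then have "A (i div 5) (j div 5) = A (j div 5) (i div 5)" by (rule A_sym)
  then show "H j i"
    using \<open>H i j\<close> by (auto simp: gadget_adj_def gadget_def)
qed

lemma H_sym: "i < 5 * n \<Longrightarrow> j < 5 * n \<Longrightarrow> H i j \<Longrightarrow> H j i"
  using H_sym_irrefl unfolding sym_irrefl_def by blast

lemma card_nbrs: "v < n \<Longrightarrow> card {u. u < n \<and> A v u} = 3"
proof -
  assume v: "v < n"
  have "{u. u < n \<and> A v u} = {N 0 v, N 1 v, N 2 v}"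
    using v A_iff[OF v] N_less[OF v] by (auto simp: less_3)
  then show ?thesis using nbrs[OF v] by (auto simp: nbrs3_def)
qed

text \<open>A corner sees the two other corners and one link. The vertex \<open>5 * v + 3\<close>
  sees one corner for each neighbour of \<open>v\<close>, because by symmetry these are the vertices
  that have \<open>v\<close> among their neighbours. The vertex \<open>5 * v + 4\<close> inherits
  its degree from the original graph.\<close>

lemma H_regular: "regular 3 (gadget_graph n A)"
proof -
  have "card {j. j < 5 * n \<and> H i j} = 3" if i: "i < 5 * n" for i
  proof -
    define v where "v = i div 5"
    have v: "v < n" and iv: "i = 5 * v + i mod 5" using i by (auto simp: v_def)
    consider "i mod 5 < 3" | "i mod 5 = 3" | "i mod 5 = 4"
      using mod_less_divisor[of 5 i] by linarith
    then show ?thesis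
    proof cases
      case 1
      define k where "k = i mod 5"
      have ik: "i = 5 * v + k" "k < 3" using 1 iv by (auto simp: k_def)
      have "{j. j < 5 * n \<and> H i j} = (\<lambda>l. 5 * v + l) ` ({..<3} - {k}) \<union> {5 * N k v + 3}" (is "?S = ?T")
      proof
        show "?S \<subseteq> ?T"
        proof
          fix j assume "j \<in> ?S"
          then have "H i j" "j < 5 * n" by auto
          from this(1) i this(2) show "j \<in> ?T"
          proof (cases rule: H_cases)
            case (triangle v' k' l)
            then have "v' = v" "k' = k" using ik div_mod_5[of v k v' k'] by auto
            then show ?thesis using triangle by auto
          next
            case (link v' k')
            then have "v' = v" "k' = k" using ik div_mod_5[of v k v' k'] by auto
            then show ?thesis using link by auto
          next
            case (link' v' k')
            then show ?thesis using ik div_mod_5[of v k "N k' v'" 3] by auto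
          next
            case (copy v' u)
            then show ?thesis using ik div_mod_5[of v k v' 4] by auto
          qed
        qed
        show "?T \<subseteq> ?S"
        proof
          fix j assume "j \<in> ?T"
          then consider l where "j = 5 * v + l" "l < 3" "l \<noteq> k" | "j = 5 * N k v + 3" by auto
          then show "j \<in> ?S"
            using H_triangle[OF v, of k] H_link[OF v, of k] N_less[OF v, of k] v ik by cases auto
        qed
      qed
      moreover have "card ((\<lambda>l. 5 * v + l) ` ({..<3} - {k})) = 2"
        using ik(2) by (subst card_image) (auto simp: inj_on_def)
      moreover have "5 * N k v + 3 \<notin> (\<lambda>l. 5 * v + l) ` ({..<3} - {k})"
        using div_mod_5[of v _ "N k v" 3] by fastforce
      ultimately show ?thesis by simp
    next
      case 2
      then have i3: "i = 5 * v + 3" using iv by simp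
      \<comment> \<open>The index of \<open>v\<close> among the neighbours of \<open>w\<close>. The
        default 2 is correct for the \<open>w\<close> adjacent to \<open>v\<close>, the only ones
        considered.\<close>
      define idx where "idx = (\<lambda>w. if N 0 w = v then 0 else if N 1 w = v then 1 else (2 :: nat))"
      have idx: "idx w < 3 \<and> N (idx w) w = v" if "w < n" "A w v" for w
        using A_iff[of w v] that v by (auto simp: idx_def less_3)
      have "{j. j < 5 * n \<and> H i j} = (\<lambda>w. 5 * w + idx w) ` {w. w < n \<and> A v w}" (is "?S = ?T")
      proof
        show "?S \<subseteq> ?T"
        proof
          fix j assume "j \<in> ?S"
          then have "H i j" "j < 5 * n" by auto
          from this(1) i this(2) show "j \<in> ?T"
          proof (cases rule: H_cases)
            case (triangle v' k' l)
            then show ?thesis using i3 div_mod_5[of v 3 v' k'] by auto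
          next
            case (link v' k')
            then show ?thesis using i3 div_mod_5[of v 3 v' k'] by auto
          next
            case (link' w k)
            then have "N k w = v" using i3 div_mod_5[of v 3 "N k w" 3] by auto
            then have "A v w" using A_iff[of w v] A_sym[of w v] link' v by auto
            moreover have "idx w = k"
              using idx[of w] N_inj[of w k "idx w"] link' \<open>N k w = v\<close> \<open>A v w\<close> A_sym[of w v] v by auto
            ultimately show ?thesis using link' by auto
          next
            case (copy v' u)
            then show ?thesis using i3 div_mod_5[of v 3 v' 4] by auto
          qed
        qed
        show "?T \<subseteq> ?S"
        proof
          fix j assume "j \<in> ?T"
          then obtain w where w: "w < n" "A v w" "j = 5 * w + idx w" by auto
          have k: "idx w < 3" "N (idx w) w = v" using idx[of w] w A_sym[of w v] v by auto
          have "H j i" using H_link[OF w(1) k(1)] k(2) w i3 by simp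
          moreover have "j < 5 * n" using w k by simp
          ultimately show "j \<in> ?S" using H_sym[of j i] i by simp
        qed
      qed
      moreover have "inj_on (\<lambda>w. 5 * w + idx w) {w. w < n \<and> A v w}"
      proof (rule inj_onI)
        fix w w' assume "w \<in> {w. w < n \<and> A v w}" "w' \<in> {w. w < n \<and> A v w}"
          "5 * w + idx w = 5 * w' + idx w'"
        moreover have "idx w < 3" "idx w' < 3" by (auto simp: idx_def)
        ultimately show "w = w'" using div_mod_5[of w "idx w" w' "idx w'"] by auto
      qed
      ultimately show ?thesis using card_nbrs[OF v] by (simp add: card_image)
    next
      case 3
      then have i4: "i = 5 * v + 4" using iv by simp
      have "{j. j < 5 * n \<and> H i j} = (\<lambda>w. 5 * w + 4) ` {w. w < n \<and> A v w}" (is "?S = ?T")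
      proof
        show "?S \<subseteq> ?T"
        proof
          fix j assume "j \<in> ?S"
          then have "H i j" "j < 5 * n" by auto
          from this(1) i this(2) show "j \<in> ?T"
          proof (cases rule: H_cases)
            case (triangle v' k' l)
            then show ?thesis using i4 div_mod_5[of v 4 v' k'] by auto
          next
            case (link v' k')
            then show ?thesis using i4 div_mod_5[of v 4 v' k'] by auto
          next
            case (link' v' k)
            then show ?thesis using i4 div_mod_5[of v 4 "N k v'" 3] by auto
          next
            case (copy v' u)
            then have "v' = v" using i4 by auto
            then show ?thesis using copy by auto
          qed
        qed
        show "?T \<subseteq> ?S"
        proof
          fix j assume "j \<in> ?T"
          then obtain w where w: "w < n" "A v w" "j = 5 * w + 4" by auto
          then show "j \<in> ?S" using H_copy[OF v w(1,2)] i4 by simp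
        qed
      qed
      moreover have "inj_on (\<lambda>w. 5 * w + 4) {w. w < n \<and> A v w}" by (auto simp: inj_on_def)
      ultimately show ?thesis using card_nbrs[OF v] by (simp add: card_image)
    qed
  qed
  then show ?thesis
    using neighbors_graph_of[OF H_sym_irrefl] by (auto simp: regular_def gadget_graph_def)
qed

section \<open>Deletion sets and not-all-equal colourings\<close>

definition triangle :: "nat \<Rightarrow> nat set set" where
  "triangle v = {{5 * v + k, 5 * v + l} | k l. k < 3 \<and> l < 3 \<and> k \<noteq> l}"

lemma triangle_disjoint: "e \<in> triangle v \<Longrightarrow> e \<in> triangle w \<Longrightarrow> v = w"
proof -
  assume "e \<in> triangle v" "e \<in> triangle w"
  then obtain k l k' l' where "{5 * v + k, 5 * v + l} = {5 * w + k', 5 * w + l'}"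
    "k < 3" "l < 3" "k' < 3" "l' < 3" by (auto simp: triangle_def)
  then show "v = w" unfolding doubleton_eq_iff by presburger
qed

text \<open>Two of the three corners share a colour, so the edge between them must be in
  \<open>F\<close>; disjointness of the triangles makes the choice injective.\<close>

lemma proper_cut_hits_triangles:
  fixes c :: "nat \<Rightarrow> bool"
  assumes "\<And>i j. i < 5 * n \<Longrightarrow> j < 5 * n \<Longrightarrow> H i j \<Longrightarrow> {i, j} \<notin> F \<Longrightarrow> c i \<noteq> c j"
  obtains f where "\<And>v. v < n \<Longrightarrow> f v \<in> F \<inter> triangle v" "inj_on f {..<n}"
proof -
  have "\<exists>e. e \<in> F \<inter> triangle v" if v: "v < n" for v
  proof -
    have "c (5 * v) = c (5 * v + 1) \<or> c (5 * v) = c (5 * v + 2) \<or> c (5 * v + 1) = c (5 * v + 2)"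
      by blast
    then obtain k l where kl: "k < 3" "l < 3" "k \<noteq> l" "c (5 * v + k) = c (5 * v + l)"
      using that[of 0 1] that[of 0 2] that[of 1 2] by auto
    then have "{5 * v + k, 5 * v + l} \<in> F"
      using assms[of "5 * v + k" "5 * v + l"] H_triangle[OF v kl(1-3)] v by auto
    then show ?thesis using kl unfolding triangle_def by blast
  qed
  then obtain f where f: "\<And>v. v < n \<Longrightarrow> f v \<in> F \<inter> triangle v" by metis
  moreover have "inj_on f {..<n}"
    using f triangle_disjoint by (intro inj_onI) (metis Int_iff lessThan_iff)
  ultimately show ?thesis using that by blast
qed

lemma finite_edges_H: "finite (edges (gadget_graph n A))"
proof -
  have "edges (gadget_graph n A) \<subseteq> Pow {..<5 * n}"
    by (auto simp: gadget_graph_def graph_of_def)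
  then show ?thesis by (rule finite_subset) simp
qed

lemma bipartite_H_minus:
  "bipartite (verts (gadget_graph n A), edges (gadget_graph n A) - F) \<longleftrightarrow>
     (\<exists>c :: nat \<Rightarrow> bool. \<forall>i j. i < 5 * n \<longrightarrow> j < 5 * n \<longrightarrow> H i j \<longrightarrow> {i, j} \<notin> F \<longrightarrow> c i \<noteq> c j)"
  using bipartite_graph_of_minus[of "5 * n" H F] by (simp add: gadget_graph_def)

text \<open>Every deletion set that leaves a bipartite graph has at least \<open>n\<close> edges,
  one per triangle, so equality only asks for one with at most \<open>n\<close>.\<close>

lemma min_edge_deletion_eq_n_iff:
  "min_edge_deletion (gadget_graph n A) = n \<longleftrightarrow>
     (\<exists>F. F \<subseteq> edges (gadget_graph n A) \<and> card F \<le> n \<and>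
        bipartite (verts (gadget_graph n A), edges (gadget_graph n A) - F))"
    (is "?L \<longleftrightarrow> ?R")
proof -
  let ?G = "gadget_graph n A"
  let ?M = "{card F | F. F \<subseteq> edges ?G \<and> bipartite (verts ?G, edges ?G - F)}"
  have "graph_instance ?G" unfolding gadget_graph_def by (rule graph_instance_graph_of[OF H_sym_irrefl])
  then have fin: "finite ?M" "?M \<noteq> {}"
    using min_edge_deletion_welldefined[of ?G] unfolding graph_instance_def by blast+
  have lower: "n \<le> card F" if F: "F \<subseteq> edges ?G" "bipartite (verts ?G, edges ?G - F)" for F
  proof -
    obtain c :: "nat \<Rightarrow> bool" where
      "\<And>i j. i < 5 * n \<Longrightarrow> j < 5 * n \<Longrightarrow> H i j \<Longrightarrow> {i, j} \<notin> F \<Longrightarrow> c i \<noteq> c j"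
      using F(2) unfolding bipartite_H_minus by blast
    then obtain f where f: "\<And>v. v < n \<Longrightarrow> f v \<in> F \<inter> triangle v" "inj_on f {..<n}"
      using proper_cut_hits_triangles[of F c] by blast
    have "card (f ` {..<n}) \<le> card F"
      using f(1) finite_subset[OF F(1) finite_edges_H] by (intro card_mono) auto
    then show ?thesis by (simp add: card_image[OF f(2)])
  qed
  show ?thesis
  proof
    assume L: ?L
    have "Min ?M \<in> ?M" by (rule Min_in[OF fin])
    then show ?R using L unfolding min_edge_deletion_def by auto
  next
    assume ?R
    then obtain F where F: "F \<subseteq> edges ?G" "card F \<le> n" "bipartite (verts ?G, edges ?G - F)" by blast
    have "card F = n" using lower[OF F(1,3)] F(2) by simp
    then have "n \<in> ?M" using F by blast
    moreover have "\<forall>m \<in> ?M. n \<le> m" using lower by blast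
    ultimately show ?L unfolding min_edge_deletion_def using fin(1) by (intro Min_eqI) auto
  qed
qed

lemma min_edge_deletion_imp_NAE:
  assumes "min_edge_deletion (gadget_graph n A) = n"
  shows "bipartite (graph_of n A)" "\<exists>S T. NAE_decomposition (graph_of n A) S T"
proof -
  let ?G = "gadget_graph n A"
  obtain F where F: "F \<subseteq> edges ?G" "card F \<le> n" "bipartite (verts ?G, edges ?G - F)"
    using assms min_edge_deletion_eq_n_iff by blast
  obtain c :: "nat \<Rightarrow> bool" where
    c: "\<And>i j. i < 5 * n \<Longrightarrow> j < 5 * n \<Longrightarrow> H i j \<Longrightarrow> {i, j} \<notin> F \<Longrightarrow> c i \<noteq> c j"
    using F(3) unfolding bipartite_H_minus by blast
  then obtain f where f: "\<And>v. v < n \<Longrightarrow> f v \<in> F \<inter> triangle v" "inj_on f {..<n}"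
    using proper_cut_hits_triangles[of F c] by blast
  have finF: "finite F" by (rule finite_subset[OF F(1) finite_edges_H])
  \<comment> \<open>\<open>F\<close> has at most \<open>n\<close> elements and contains the
    \<open>n\<close> chosen ones, so nothing is left for other edges.\<close>
  have F_eq: "F = f ` {..<n}"
    using f(1) F(2) card_image[OF f(2)] finF by (intro card_seteq[symmetric]) auto
  \<comment> \<open>Both ends of a triangle edge have residue below 3, so an end of residue 3 or 4
    keeps an edge out of \<open>F\<close>.\<close>
  have cut: "c i \<noteq> c j" if "i < 5 * n" "j < 5 * n" "H i j" "j mod 5 = 3 \<or> j mod 5 = 4" for i j
  proof (rule c[OF that(1-3)])
    show "{i, j} \<notin> F"
    proof
      assume "{i, j} \<in> F"
      then obtain v where "v < n" "{i, j} = f v" using F_eq by auto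
      then have "{i, j} \<in> triangle v" using f(1) by simp
      then obtain k l where "{i, j} = {5 * v + k, 5 * v + l}" "k < 3" "l < 3" by (auto simp: triangle_def)
      then have "j mod 5 < 3" unfolding doubleton_eq_iff by auto
      then show False using that(4) by auto
    qed
  qed
  show "bipartite (graph_of n A)"
    unfolding bipartite_graph_of
    using cut[OF _ _ H_copy] by (intro exI[of _ "\<lambda>v. c (5 * v + 4)"]) auto
  have "\<exists>u < n. \<exists>w < n. A v u \<and> A v w \<and> c (5 * u + 3) \<and> \<not> c (5 * w + 3)" if v: "v < n" for v
  proof (rule ccontr)
    assume no: "\<not> ?thesis"
    \<comment> \<open>If all neighbours of \<open>v\<close> agree, the links force the corners to
      agree. Then all edges of the triangle are deleted, although only \<open>f v\<close> is, so two
      different edges would coincide.\<close>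
    have "{5 * v + k, 5 * v + l} = f v" if kl: "k < 3" "l < 3" "k \<noteq> l" for k l
    proof -
      have "c (5 * N k v + 3) = c (5 * N l v + 3)"
        using no N_less[OF v] A_iff[OF v] kl by blast
      moreover have "c (5 * v + k) \<noteq> c (5 * N k v + 3)" "c (5 * v + l) \<noteq> c (5 * N l v + 3)"
        using cut[OF _ _ H_link[OF v kl(1)]] cut[OF _ _ H_link[OF v kl(2)]]
          N_less[OF v kl(1)] N_less[OF v kl(2)] v kl by auto
      ultimately have "c (5 * v + k) = c (5 * v + l)" by blast
      then have "{5 * v + k, 5 * v + l} \<in> F"
        using c[OF _ _ H_triangle[OF v kl]] v kl by auto
      then obtain w where w: "w < n" "{5 * v + k, 5 * v + l} = f w" using F_eq by auto
      moreover have "{5 * v + k, 5 * v + l} \<in> triangle v" using kl by (auto simp: triangle_def)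
      ultimately show ?thesis using f(1)[of w] triangle_disjoint[of "f w" v w] by auto
    qed
    from this[of 0 1] this[of 0 2] have "{5 * v + 0, 5 * v + 1} = {5 * v + 0, 5 * v + 2}" by simp
    then show False by (simp add: doubleton_eq_iff)
  qed
  then show "\<exists>S T. NAE_decomposition (graph_of n A) S T"
    unfolding NAE_graph_of[OF sym_irrefl] by (intro exI[of _ "\<lambda>v. c (5 * v + 3)"]) blast
qed

lemma NAE_imp_min_edge_deletion:
  assumes "bipartite (graph_of n A)" "\<exists>S T. NAE_decomposition (graph_of n A) S T"
  shows "min_edge_deletion (gadget_graph n A) = n"
proof -
  let ?G = "gadget_graph n A"
  obtain g :: "nat \<Rightarrow> bool" where g: "\<And>i j. i < n \<Longrightarrow> j < n \<Longrightarrow> A i j \<Longrightarrow> g i \<noteq> g j"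
    using assms(1) unfolding bipartite_graph_of by blast
  obtain d :: "nat \<Rightarrow> bool" where
    d: "\<And>v. v < n \<Longrightarrow> \<exists>u < n. \<exists>w < n. A v u \<and> A v w \<and> d u \<and> \<not> d w"
    using assms(2) unfolding NAE_graph_of[OF sym_irrefl] by blast
  \<comment> \<open>A corner takes the opposite of the colour \<open>d\<close> at the neighbour it
    stands for, which cuts all links; the copy is cut by \<open>g\<close>.\<close>
  define c where "c = (\<lambda>i. if i mod 5 = 4 then g (i div 5) else if i mod 5 = 3 then d (i div 5)
     else \<not> d (N (i mod 5) (i div 5)))"
  define F where "F = {{i, j} | i j. i < 5 * n \<and> j < 5 * n \<and> H i j \<and> c i = c j}"
  \<comment> \<open>The one uncut edge in the triangle of \<open>v\<close>: of three Boolean colours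
    that are not all equal, exactly one pair agrees.\<close>
  define h where "h = (\<lambda>v. if d (N 0 v) = d (N 1 v) then {5 * v, 5 * v + 1}
     else if d (N 0 v) = d (N 2 v) then {5 * v, 5 * v + 2} else {5 * v + 1, 5 * v + 2})"
  have F_G: "F \<subseteq> edges ?G"
    unfolding F_def gadget_graph_def graph_of_def by auto
  have "F \<subseteq> h ` {..<n}"
  proof
    fix e assume "e \<in> F"
    then obtain i j where e: "e = {i, j}" "i < 5 * n" "j < 5 * n" "H i j" "c i = c j"
      by (auto simp: F_def)
    from e(4,2,3) show "e \<in> h ` {..<n}"
    proof (cases rule: H_cases)
      case (triangle v k l)
      then have kl: "d (N k v) = d (N l v)" using e(5) by (auto simp: c_def)
      have "\<exists>k < 3. d (N k v)" "\<exists>k < 3. \<not> d (N k v)"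
        using d[OF triangle(1)] A_iff[OF triangle(1)] by blast+
      then have "e = h v"
        using kl triangle e(1) unfolding less_3 by (auto simp: h_def insert_commute)
      then show ?thesis using triangle(1) by blast
    next
      case (link v k)
      then show ?thesis using e(5) by (auto simp: c_def)
    next
      case (link' v k)
      then show ?thesis using e(5) by (auto simp: c_def)
    next
      case (copy v u)
      then show ?thesis using e(5) g[of v u] by (auto simp: c_def)
    qed
  qed
  then have "card F \<le> card (h ` {..<n})" by (intro card_mono) auto
  also have "\<dots> \<le> n" using card_image_le[of "{..<n}" h] by simp
  finally have "card F \<le> n" .
  moreover have "bipartite (verts ?G, edges ?G - F)"
    unfolding bipartite_H_minus by (rule exI[of _ c]) (auto simp: F_def)
  ultimately show ?thesis using min_edge_deletion_eq_n_iff F_G by blast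
qed

end

lemma cubic_graph_ex:
  assumes "cubic n A" obtains N where "cubic_graph n A N"
proof -
  have "\<forall>v. \<exists>a b c. v < n \<longrightarrow> nbrs3 n A v a b c" using assms unfolding cubic_def by blast
  then obtain a b c where "\<And>v. v < n \<Longrightarrow> nbrs3 n A v (a v) (b v) (c v)" by metis
  then have "cubic_graph n A (\<lambda>k. if k = 0 then a else if k = 1 then b else c)"
    using assms by (auto simp: cubic_graph_def cubic_def)
  then show ?thesis by (rule that)
qed

theorem gadget_graph_correct:
  assumes "cubic n A"
  shows "graph_instance (gadget_graph n A)" "regular 3 (gadget_graph n A)"
    "min_edge_deletion (gadget_graph n A) = n \<longleftrightarrow>
       bipartite (graph_of n A) \<and> (\<exists>S T. NAE_decomposition (graph_of n A) S T)"
proof -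
  obtain N where "cubic_graph n A N" using cubic_graph_ex[OF assms] .
  then interpret cubic_graph n A N .
  show "graph_instance (gadget_graph n A)"
    unfolding gadget_graph_def by (rule graph_instance_graph_of[OF H_sym_irrefl])
  show "regular 3 (gadget_graph n A)" by (rule H_regular)
  show "min_edge_deletion (gadget_graph n A) = n \<longleftrightarrow>
       bipartite (graph_of n A) \<and> (\<exists>S T. NAE_decomposition (graph_of n A) S T)"
    using min_edge_deletion_imp_NAE NAE_imp_min_edge_deletion by blast
qed

section \<open>Recognising instances and writing the gadget graph\<close>

definition hdr :: "bool list \<Rightarrow> nat" where
  "hdr y = length (takeWhile id y)"

definition adj :: "bool list \<Rightarrow> nat \<Rightarrow> nat \<Rightarrow> nat \<Rightarrow> bool" where
  "adj y n i j \<longleftrightarrow> n + 1 + i * n + j < length y \<and> y ! (n + 1 + i * n + j)"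

text \<open>Here \<open>y\<close> is the input followed by one more \<open>False\<close>. That bit
  supplies a terminating zero for every input, so \<open>hdr y < length y\<close> always holds; it
  and the zero of the encoding make up the \<open>2\<close> in the length.\<close>

definition valid :: "bool list \<Rightarrow> nat \<Rightarrow> bool" where
  "valid y n \<longleftrightarrow> length y = n + n * n + 2 \<and> cubic n (adj y n)"

section \<open>Words that encode cubic graphs\<close>

lemma length_concat_map_map:
  "length (concat (map (\<lambda>i. map (f i) [0..<m]) [0..<n])) = n * m"
  by (induction n) auto

lemma nth_concat_map_map:
  "i < n \<Longrightarrow> j < m \<Longrightarrow> concat (map (\<lambda>i. map (f i) [0..<m]) [0..<n]) ! (i * m + j) = f i j"
proof (induction n)
  case (Suc n)
  show ?case
  proof (cases "i = n")
    case True
    then show ?thesis using Suc.prems by (simp add: nth_append length_concat_map_map)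
  next
    case False
    then have "i < n" using Suc.prems by simp
    then have "i * m + m \<le> n * m" by (metis Suc_leI mult_Suc add.commute mult_le_mono1)
    then have "i * m + j < n * m" using Suc.prems(2) by linarith
    then show ?thesis using Suc \<open>i < n\<close> by (simp add: nth_append length_concat_map_map)
  qed
qed simp

lemma matrix_list_eqI:
  assumes "length M = n * m" "\<And>i j. i < n \<Longrightarrow> j < m \<Longrightarrow> M ! (i * m + j) = f i j"
  shows "M = concat (map (\<lambda>i. map (f i) [0..<m]) [0..<n])"
proof (rule nth_equalityI)
  show "length M = length (concat (map (\<lambda>i. map (f i) [0..<m]) [0..<n]))"
    using assms by (simp only: length_concat_map_map)
  fix p assume "p < length M"
  then have p: "p < n * m" using assms by simp
  then have m: "0 < m" by (cases m) auto
  have "p div m < n" using p by (simp add: less_mult_imp_div_less)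
  moreover have "p mod m < m" using m by simp
  moreover have "p div m * m + p mod m = p" by simp
  ultimately show "M ! p = concat (map (\<lambda>i. map (f i) [0..<m]) [0..<n]) ! p"
    using assms(2) nth_concat_map_map by metis
qed

lemma encode_graph_of:
  assumes "sym_irrefl n A"
  shows "encode_graph (graph_of n A) =
    replicate n True @ False # concat (map (\<lambda>i. map (A i) [0..<n]) [0..<n])"
proof -
  have "map (\<lambda>i. map (\<lambda>j. {i, j} \<in> edges (graph_of n A)) [0..<n]) [0..<n] = map (\<lambda>i. map (A i) [0..<n]) [0..<n]"
    by (intro map_cong refl) (auto simp: edge_graph_of[OF assms])
  then show ?thesis by (simp only: encode_graph_def Let_def verts_graph_of card_lessThan)
qed

lemma hdr_replicate: "hdr (replicate n True @ False # z) = n"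
  unfolding hdr_def by (induction n) auto

lemma hdr_split:
  assumes "\<not> y ! hdr y" "hdr y < length y"
  shows "y = replicate (hdr y) True @ False # drop (Suc (hdr y)) y"
proof -
  have "takeWhile id y = replicate (hdr y) True"
    unfolding hdr_def by (intro replicate_eqI) (auto dest: set_takeWhileD)
  moreover have "dropWhile id y = y ! hdr y # drop (Suc (hdr y)) y"
    using assms(2) by (simp add: hdr_def dropWhile_eq_drop Cons_nth_drop_Suc)
  ultimately show ?thesis using assms(1) takeWhile_dropWhile_id[of id y] by simp
qed

lemma hdr_less: "hdr (x @ [False]) < length (x @ [False])"
  unfolding hdr_def by (induction x) auto

lemma nth_hdr: "hdr y < length y \<Longrightarrow> \<not> y ! hdr y"
  using nth_length_takeWhile[of id y] by (simp add: hdr_def)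

lemma adj_encode:
  assumes "length M = n * n" "i < n" "j < n"
  shows "adj ((replicate n True @ False # M) @ [False]) n i j = M ! (i * n + j)"
proof -
  have "i * n + n \<le> n * n" using assms(2) by (metis Suc_leI mult_Suc add.commute mult_le_mono1)
  then have "i * n + j < n * n" using assms(3) by linarith
  then show ?thesis using assms by (auto simp: adj_def nth_append)
qed

text \<open>With \<open>encode_imp_valid\<close>, this makes \<open>valid\<close> recognise exactly
  the encodings of cubic graphs, so no malformed word is accepted by accident.\<close>

lemma valid_imp_encode:
  assumes "valid (x @ [False]) n" "n = hdr (x @ [False])"
  shows "x = encode_graph (graph_of n (adj (x @ [False]) n))"
proof -
  let ?y = "x @ [False]"
  define M where "M = take (n * n) (drop (Suc n) ?y)"
  have len: "length ?y = n + n * n + 2" and cub: "cubic n (adj ?y n)"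
    using assms(1) by (auto simp: valid_def)
  have y: "?y = replicate n True @ False # drop (Suc n) ?y"
    using hdr_split[of ?y] hdr_less[of x] nth_hdr[of ?y] assms(2) by simp
  have "x = take (n + n * n + 1) ?y" using len by simp
  also have "\<dots> = replicate n True @ False # M"
    by (subst y) (simp add: M_def)
  finally have x: "x = replicate n True @ False # M" .
  have M: "length M = n * n" using len by (simp add: M_def)
  have "M = concat (map (\<lambda>i. map (adj ?y n i) [0..<n]) [0..<n])"
  proof (rule matrix_list_eqI[OF M])
    fix i j assume "i < n" "j < n"
    from adj_encode[OF M this] show "M ! (i * n + j) = adj ?y n i j" by (simp add: x)
  qed
  then show ?thesis using encode_graph_of[of n "adj ?y n"] cub x by (simp add: cubic_def)
qed

lemma encode_imp_valid:
  assumes "graph_instance G" "regular 3 G" "x = encode_graph G" "n = hdr (x @ [False])"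
  shows "valid (x @ [False]) n" "G = graph_of n (adj (x @ [False]) n)"
proof -
  obtain m where "verts G = {..<m}" using assms(1) by (auto simp: graph_instance_def)
  note G = graph_instance_eq_graph_of[OF assms(1) this]
  define A where "A = (\<lambda>i j. {i, j} \<in> edges G)"
  define M where "M = concat (map (\<lambda>i. map (A i) [0..<m]) [0..<m])"
  have GA: "G = graph_of m A" "sym_irrefl m A" using G by (simp_all add: A_def)
  have x: "x = replicate m True @ False # M"
    unfolding assms(3) M_def by (subst GA(1)) (rule encode_graph_of[OF GA(2)])
  have n: "n = m" unfolding assms(4) x using hdr_replicate[of m "M @ [False]"] by simp
  have M: "length M = n * n" by (simp add: M_def length_concat_map_map n)
  have adj: "adj (x @ [False]) n i j = A i j" if "i < n" "j < n" for i j
    using adj_encode[OF M that] nth_concat_map_map[of i m j m A] that by (simp add: x n M_def)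
  have "graph_of m A = graph_of n (adj (x @ [False]) n)"
    using adj by (auto simp: graph_of_def n)
  then show G': "G = graph_of n (adj (x @ [False]) n)" using GA by simp
  have "sym_irrefl n (adj (x @ [False]) n)"
    using GA(2) adj unfolding n sym_irrefl_def by simp
  moreover have "length (x @ [False]) = n + n * n + 2" using M by (simp add: x n)
  ultimately show "valid (x @ [False]) n"
    using regular_3_iff_cubic assms(2) G' by (simp add: valid_def)
qed

text \<open>\<open>valid\<close> says nothing about bipartiteness; that part of membership comes
  from the copy of the graph inside the gadget graph.\<close>

lemma NAE_iff_min_edge_deletion:
  fixes x :: "bool list"
  defines "y \<equiv> x @ [False]"
  defines "n \<equiv> hdr y"
  shows "x \<in> cubic_bipartite_NAE \<longleftrightarrow>
    valid y n \<and> min_edge_deletion (gadget_graph n (adj y n)) = n" (is "?L \<longleftrightarrow> ?R")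
proof
  assume ?L
  then obtain G where G: "x = encode_graph G" "graph_instance G" "regular 3 G" "bipartite G"
    "\<exists>A B. NAE_decomposition G A B" by (auto simp: cubic_bipartite_NAE_def)
  have "valid y n" "G = graph_of n (adj y n)"
    using encode_imp_valid[OF G(2,3,1), of n] by (auto simp: y_def n_def)
  then show ?R using gadget_graph_correct(3)[of n "adj y n"] G(4,5) by (auto simp: valid_def)
next
  assume R: ?R
  then have cub: "cubic n (adj y n)" by (simp add: valid_def)
  have si: "sym_irrefl n (adj y n)" using cub by (simp add: cubic_def)
  have "x = encode_graph (graph_of n (adj y n))"
    using valid_imp_encode[of x n] R by (simp add: y_def n_def)
  moreover have "regular 3 (graph_of n (adj y n))" using regular_3_iff_cubic[OF si] cub by simp
  moreover have "graph_instance (graph_of n (adj y n))" by (rule graph_instance_graph_of[OF si])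
  ultimately show ?L using gadget_graph_correct(3)[OF cub] R
    unfolding cubic_bipartite_NAE_def by blast
qed

text \<open>Lets a program visit the vertices \<open>5 * v + k\<close> by a loop over positions
  \<open>v\<close> with the five values of \<open>k\<close> unrolled, so that no position is ever
  multiplied by 5.\<close>

lemma concat_map_mult:
  "concat (map f [0..<5 * n]) = concat (map (\<lambda>v. concat (map (\<lambda>k. f (5 * v + k)) [0..<5])) [0..<n])"
proof (induction n)
  case (Suc n)
  have "[0..<5 * Suc n] = [0..<5 * n] @ [5 * n..<5 * n + 5]"
    using upt_add_eq_append[of 0 "5 * n" 5] by (simp add: algebra_simps)
  moreover have "[5 * n..<5 * n + 5] = map (\<lambda>k. 5 * n + k) [0..<5]"
    by (simp add: upt_rec)
  moreover have "[0..<Suc n] = [0..<n] @ [n]" by simp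
  ultimately show ?case using Suc by (simp add: o_def del: upt_Suc mult_Suc_right)
qed simp

lemma map_concat_singleton: "map f xs = concat (map (\<lambda>x. [f x]) xs)"
  by (induction xs) auto

lemma concat_map_if_less:
  assumes "n < N" "\<And>a. a < n \<Longrightarrow> f a = g a"
  shows "concat (map (\<lambda>a. if n < N \<and> a < n then f a else []) [0..<N]) = concat (map g [0..<n])"
proof -
  have "[0..<N] = [0..<n] @ [n..<N]" using upt_add_eq_append[of 0 n "N - n"] assms(1) by simp
  moreover have "concat (map (\<lambda>a. if n < N \<and> a < n then f a else []) [n..<N]) = []" by auto
  moreover have "map (\<lambda>a. if n < N \<and> a < n then f a else []) [0..<n] = map g [0..<n]"
    using assms by auto
  ultimately show ?thesis by (simp only: map_append concat_append append_Nil2)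
qed

section \<open>Evaluating adjacency and validity on the input word\<close>

context layout
begin

lemma dec_cong:
  assumes "dec d P" "\<And>y e. (\<And>v. v < V \<Longrightarrow> e v \<le> length y) \<Longrightarrow> P y e = Q y e"
  shows "dec d Q"
proof -
  from decE[OF assms(1)] obtain c p where c: "\<And>y e T. vars y d e T \<Longrightarrow>
     runs K c T (poly p (length y)) (T(2 := put (P y e) (T 2)))" by blast
  have "P y e = Q y e" if "vars y d e T" for y e T
    using that by (intro assms(2)) (auto simp: vars_def)
  then show ?thesis unfolding dec_def using c by (intro exI[of _ c] exI[of _ p]) simp
qed

text \<open>A value is in range iff it equals some position of the word, and quantifiers run over
  exactly these.\<close>

lemma dec_in_range:
  assumes "v < d" "d < V" shows "dec d (\<lambda>y e. e v < length y)"
proof -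
  have "dec (Suc d) (\<lambda>y e. e v < length y \<and> e d = e v)"
    using assms by (intro dec_eq) auto
  from dec_ex[OF this assms(2)] show ?thesis
    by (rule dec_cong) (use assms in auto)
qed

lemma sum_of_bool_less: "(\<Sum>a < N. of_bool (v < N \<and> a < v)) = (if v < N then v else (0 :: nat))"
proof (cases "v < N")
  case True
  then have "{..<N} \<inter> {a. a < v} = {..<v}" by auto
  then show ?thesis using True by (simp add: sum.If_cases of_bool_def)
qed simp

text \<open>What counting the positions below \<open>v\<close> yields: for \<open>v\<close> outside
  the word the guarded comparison always fails, and the count is 0.\<close>

definition clip :: "bool list \<Rightarrow> nat \<Rightarrow> nat" where
  "clip y v = (if v < length y then v else 0)"

lemma cnt_var:
  assumes "v < d" "w < d" "v \<noteq> w" "d < V"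
  shows "cnt d w (\<lambda>y e. clip y (e v))"
proof -
  have "cnt (Suc d) w (\<lambda>y e. of_bool (e v < length y \<and> e d < e v))"
    using assms by (intro cnt_of_bool dec_less) auto
  from cnt_sum[OF this] have "cnt d w (\<lambda>y e. \<Sum>a < length y. of_bool (e v < length y \<and> a < e v))"
    using assms by simp
  then show ?thesis by (simp only: sum_of_bool_less clip_def)
qed

text \<open>A product is the number of pairs of positions below the two factors.\<close>

lemma cnt_mult:
  assumes "u < d" "v < d" "w < d" "u \<noteq> w" "v \<noteq> w" "Suc d < V"
  shows "cnt d w (\<lambda>y e. clip y (e u) * clip y (e v))"
proof -
  have "cnt (Suc (Suc d)) w (\<lambda>y e. of_bool ((e u < length y \<and> e d < e u) \<and> (e v < length y \<and> e (Suc d) < e v)))"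
    using assms by (intro cnt_of_bool dec_conj dec_less) auto
  from cnt_sum[OF cnt_sum[OF this]]
  have "cnt d w (\<lambda>y e. \<Sum>a < length y. \<Sum>b < length y.
      of_bool ((e u < length y \<and> a < e u) \<and> (e v < length y \<and> b < e v)))"
    using assms by simp
  moreover have "(\<Sum>a < N. \<Sum>b < N. of_bool ((i < N \<and> a < i) \<and> (j < N \<and> b < j))) =
     (if i < N then i else 0) * (if j < N then j else (0 :: nat))" for N i j
  proof -
    have "(\<Sum>a < N. \<Sum>b < N. of_bool ((i < N \<and> a < i) \<and> (j < N \<and> b < j))) =
      (\<Sum>a < N. of_bool (i < N \<and> a < i)) * (\<Sum>b < N. of_bool (j < N \<and> b < j) :: nat)"
      by (simp only: of_bool_conj sum_product)
    then show ?thesis by (simp only: sum_of_bool_less)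
  qed
  ultimately show ?thesis by (simp only: clip_def)
qed

lemma cnt_1: "w < V \<Longrightarrow> cnt d w (\<lambda>_ _. 1)"
  using cnt_of_bool[OF dec_const[of d True], of w] by simp

definition adj_at :: "bool list \<Rightarrow> (nat \<Rightarrow> nat) \<Rightarrow> nat \<Rightarrow> nat \<Rightarrow> bool" where
  "adj_at y e i j \<longleftrightarrow> e 0 < length y \<and> e i < length y \<and> e j < length y \<and> adj y (e 0) (e i) (e j)"

text \<open>The position of the matrix entry is guessed by a quantifier and checked by counting.
  This takes four further variables: the guess, the counter and the two loops of the
  product.\<close>

lemma dec_adj:
  assumes "0 < d" "i < d" "j < d" "d + 3 < V"
  shows "dec d (\<lambda>y e. adj_at y e i j)"
proof -
  have "dec (Suc d) (\<lambda>y e. e d < length y \<and>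
      clip y (e 0) + 1 + clip y (e i) * clip y (e 0) + clip y (e j) = e d)"
    using assms by (intro dec_cnt cnt_add cnt_var cnt_mult cnt_1) auto
  moreover have "dec (Suc d) (\<lambda>y e. e d < length y \<and> y ! e d)"
    using assms by (intro dec_bit) auto
  moreover have "d < V" using assms by simp
  ultimately have "dec d (\<lambda>y e. \<exists>a < length y. ((e(d := a)) d < length y \<and>
      clip y ((e(d := a)) 0) + 1 + clip y ((e(d := a)) i) * clip y ((e(d := a)) 0) + clip y ((e(d := a)) j) = (e(d := a)) d)
      \<and> (e(d := a)) d < length y \<and> y ! ((e(d := a)) d))"
    by (rule dec_ex[OF dec_conj])
  then have 1: "dec d (\<lambda>y e. \<exists>a < length y.
      clip y (e 0) + 1 + clip y (e i) * clip y (e 0) + clip y (e j) = a \<and> y ! a)"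
    by (rule dec_cong) (use assms in auto)
  have "dec d (\<lambda>y e. (e 0 < length y \<and> e i < length y \<and> e j < length y) \<and> (\<exists>a < length y.
      clip y (e 0) + 1 + clip y (e i) * clip y (e 0) + clip y (e j) = a \<and> y ! a))"
    using assms by (intro dec_conj 1 dec_in_range) auto
  then show ?thesis
    by (rule dec_cong) (auto simp: adj_at_def adj_def clip_def)
qed

definition nbrs3_at :: "bool list \<Rightarrow> (nat \<Rightarrow> nat) \<Rightarrow> nat \<Rightarrow> nat \<Rightarrow> nat \<Rightarrow> nat \<Rightarrow> bool" where
  "nbrs3_at y e v a b c \<longleftrightarrow> e 0 < length y \<and> e v < length y \<and>
     nbrs3 (e 0) (adj y (e 0)) (e v) (e a) (e b) (e c)"

text \<open>The distinctness premises are those of \<open>dec_less\<close> along the chain from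
  \<open>a\<close> over \<open>b\<close> and \<open>c\<close> to variable 0, which holds the number
  of vertices.\<close>

lemma dec_nbrs3:
  assumes "0 < d" "v < d" "a < d" "b < d" "c < d" "a \<noteq> b" "b \<noteq> c" "0 < c" "d + 4 < V"
  shows "dec d (\<lambda>y e. nbrs3_at y e v a b c)"
proof -
  have "dec (Suc d) (\<lambda>y e. (e 0 < length y \<and> e d < e 0) \<longrightarrow> adj_at y e v d \<longrightarrow>
     (e a < length y \<and> e d = e a) \<or> (e b < length y \<and> e d = e b) \<or> (e c < length y \<and> e d = e c))"
    using assms by (intro dec_imp dec_disj dec_eq dec_less dec_adj) auto
  moreover have "d < V" using assms by simp
  ultimately have "dec d (\<lambda>y e. \<forall>w < length y. (((e(d := w)) 0 < length y \<and> (e(d := w)) d < (e(d := w)) 0) \<longrightarrow>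
     adj_at y (e(d := w)) v d \<longrightarrow>
     ((e(d := w)) a < length y \<and> (e(d := w)) d = (e(d := w)) a) \<or>
     ((e(d := w)) b < length y \<and> (e(d := w)) d = (e(d := w)) b) \<or>
     ((e(d := w)) c < length y \<and> (e(d := w)) d = (e(d := w)) c)))"
    by (rule dec_all)
  then have all: "dec d (\<lambda>y e. \<forall>w < length y. (e 0 < length y \<and> w < e 0) \<longrightarrow>
     (e v < length y \<and> adj y (e 0) (e v) w) \<longrightarrow>
     (e a < length y \<and> w = e a) \<or> (e b < length y \<and> w = e b) \<or> (e c < length y \<and> w = e c))"
    by (rule dec_cong) (use assms in \<open>auto simp: adj_at_def\<close>)
  have "dec d (\<lambda>y e. (e b < length y \<and> e a < e b) \<and> (e c < length y \<and> e b < e c) \<and>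
     (e 0 < length y \<and> e c < e 0) \<and> adj_at y e v a \<and> adj_at y e v b \<and> adj_at y e v c \<and>
     (\<forall>w < length y. (e 0 < length y \<and> w < e 0) \<longrightarrow>
       (e v < length y \<and> adj y (e 0) (e v) w) \<longrightarrow>
       (e a < length y \<and> w = e a) \<or> (e b < length y \<and> w = e b) \<or> (e c < length y \<and> w = e c)))"
    using assms by (intro dec_conj all dec_less dec_adj) auto
  then show ?thesis
  proof (rule dec_cong)
    fix y :: "bool list" and e :: "nat \<Rightarrow> nat"
    show "((e b < length y \<and> e a < e b) \<and> (e c < length y \<and> e b < e c) \<and>
     (e 0 < length y \<and> e c < e 0) \<and> adj_at y e v a \<and> adj_at y e v b \<and> adj_at y e v c \<and>
     (\<forall>w < length y. (e 0 < length y \<and> w < e 0) \<longrightarrow>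
       (e v < length y \<and> adj y (e 0) (e v) w) \<longrightarrow>
       (e a < length y \<and> w = e a) \<or> (e b < length y \<and> w = e b) \<or> (e c < length y \<and> w = e c))) =
     nbrs3_at y e v a b c" (is "?L = ?R")
    proof
      assume ?L
      then show ?R unfolding nbrs3_at_def nbrs3_def adj_at_def by (meson less_trans)
    next
      assume ?R
      moreover from this have "e c < length y" "e b < length y" "e a < length y"
        unfolding nbrs3_at_def nbrs3_def by linarith+
      ultimately show ?L unfolding nbrs3_at_def nbrs3_def adj_at_def by blast
    qed
  qed
qed

definition is_nbr_at :: "nat \<Rightarrow> bool list \<Rightarrow> (nat \<Rightarrow> nat) \<Rightarrow> nat \<Rightarrow> nat \<Rightarrow> bool" where
  "is_nbr_at k y e v u \<longleftrightarrow> e 0 < length y \<and> e v < length y \<and>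
     is_nbr (e 0) (adj y (e 0)) k (e v) (e u)"

lemma dec_is_nbr:
  assumes "0 < d" "v < d" "0 < u" "u < d" "d + 6 < V"
  shows "dec d (\<lambda>y e. is_nbr_at k y e v u)"
proof -
  have level: "dec (Suc (Suc d)) (\<lambda>y e. if k = 0 then nbrs3_at y e v u d (Suc d)
      else if k = 1 then nbrs3_at y e v d u (Suc d) else nbrs3_at y e v d (Suc d) u)"
    using assms by (cases "k = 0"; cases "k = 1") (auto intro!: dec_nbrs3)
  have V': "d < V" "Suc d < V" using assms by auto
  have "dec d (\<lambda>y e. \<exists>a < length y. \<exists>b < length y. e 0 < length y \<and> e v < length y \<and>
      (if k = 0 then nbrs3 (e 0) (adj y (e 0)) (e v) (e u) a b
       else if k = 1 then nbrs3 (e 0) (adj y (e 0)) (e v) a (e u) b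
       else nbrs3 (e 0) (adj y (e 0)) (e v) a b (e u)))"
    by (rule dec_cong[OF dec_ex[OF dec_ex[OF level V'(2)] V'(1)]]) (use assms in \<open>simp add: nbrs3_at_def\<close>)
  then show ?thesis
  proof (rule dec_cong)
    fix y :: "bool list" and e :: "nat \<Rightarrow> nat"
    have bound: "a < n \<and> b < n \<and> c < n" if "nbrs3 n B w a b c" for n B w a b c
      using that by (auto simp: nbrs3_def)
    show "(\<exists>a < length y. \<exists>b < length y. e 0 < length y \<and> e v < length y \<and>
      (if k = 0 then nbrs3 (e 0) (adj y (e 0)) (e v) (e u) a b
       else if k = 1 then nbrs3 (e 0) (adj y (e 0)) (e v) a (e u) b
       else nbrs3 (e 0) (adj y (e 0)) (e v) a b (e u))) = is_nbr_at k y e v u"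
      unfolding is_nbr_at_def is_nbr_def
      by (cases "k = 0"; cases "k = 1") (auto, (meson bound less_trans)+)
  qed
qed

lemma dec_gadget:
  assumes "0 < d" "0 < v" "0 < u" "v < d" "u < d" "v \<noteq> u" "d + 6 < V"
  shows "dec d (\<lambda>y e. e 0 < length y \<and> e v < length y \<and> e u < length y \<and>
    gadget (e 0) (adj y (e 0)) k l (e v) (e u))"
proof -
  have "dec d (\<lambda>y e. (e 0 < length y \<and> e v < length y \<and> e u < length y) \<and>
    ((k < 3 \<and> l < 3 \<and> k \<noteq> l) \<and> (e u < length y \<and> e v = e u) \<or>
     (k < 3 \<and> l = 3) \<and> is_nbr_at k y e v u \<or>
     (k = 3 \<and> l < 3) \<and> is_nbr_at l y e u v \<or> (k = 4 \<and> l = 4) \<and> adj_at y e v u))"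
    using assms by (intro dec_conj dec_disj dec_const dec_eq dec_is_nbr dec_adj dec_in_range) auto
  then show ?thesis
    by (rule dec_cong) (auto simp: gadget_def is_nbr_at_def adj_at_def)
qed

text \<open>Regularity needs the most variables: the number of vertices, a vertex, its three
  neighbours, and the five used inside \<open>dec_nbrs3\<close>, which are the variables 0 to
  9.\<close>

lemma dec_valid:
  assumes "9 < V"
  shows "dec 1 (\<lambda>y e. e 0 < length y \<and> valid y (e 0))"
proof -
  have V': "1 < V" "Suc 1 < V" "Suc (Suc 1) < V" "Suc (Suc (Suc 1)) < V" using assms by auto
  \<comment> \<open>The length is not itself a position, so the condition is stated for the last
    position \<open>l\<close>, the one with no position above it.\<close>
  have len: "dec 1 (\<lambda>y e. \<exists>l < length y. (\<forall>m < length y. \<not> l < m) \<and>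
      clip y (e 0) + 1 + clip y (e 0) * clip y (e 0) = l)"
  proof -
    have "dec (Suc (Suc 1)) (\<lambda>y e. \<not> (e (Suc 1) < length y \<and> e 1 < e (Suc 1)))"
      using assms by (intro dec_not dec_less) auto
    from dec_all[OF this V'(2)] have 1: "dec (Suc 1) (\<lambda>y e. \<forall>m < length y. \<not> e 1 < m)"
      by (rule dec_cong) auto
    have 2: "dec (Suc 1) (\<lambda>y e. e 1 < length y \<and>
        clip y (e 0) + 1 + clip y (e 0) * clip y (e 0) = e 1)"
      using assms by (intro dec_cnt cnt_add cnt_var cnt_mult cnt_1) auto
    show ?thesis by (rule dec_cong[OF dec_ex[OF dec_conj[OF 1 2] V'(1)]]) auto
  qed
  have irr: "dec 1 (\<lambda>y e. \<forall>i < length y. (e 0 < length y \<and> i < e 0) \<longrightarrow> \<not> adj y (e 0) i i)"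
  proof -
    have "dec (Suc 1) (\<lambda>y e. (e 0 < length y \<and> e 1 < e 0) \<longrightarrow> \<not> adj_at y e 1 1)"
      using assms by (intro dec_imp dec_not dec_less dec_adj) auto
    from dec_all[OF this V'(1)] show ?thesis by (rule dec_cong) (auto simp: adj_at_def)
  qed
  have sym: "dec 1 (\<lambda>y e. \<forall>i < length y. \<forall>j < length y. (e 0 < length y \<and> i < e 0) \<longrightarrow>
     (e 0 < length y \<and> j < e 0) \<longrightarrow> adj y (e 0) i j \<longrightarrow> adj y (e 0) j i)"
  proof -
    have "dec (Suc (Suc 1)) (\<lambda>y e. (e 0 < length y \<and> e 1 < e 0) \<longrightarrow> (e 0 < length y \<and> e (Suc 1) < e 0) \<longrightarrow>
       adj_at y e 1 (Suc 1) \<longrightarrow> adj_at y e (Suc 1) 1)"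
      using assms by (intro dec_imp dec_not dec_less dec_adj) auto
    from dec_all[OF dec_all[OF this V'(2)] V'(1)] show ?thesis
      by (rule dec_cong) (auto simp: adj_at_def)
  qed
  have reg: "dec 1 (\<lambda>y e. \<forall>v < length y. (e 0 < length y \<and> v < e 0) \<longrightarrow>
     (\<exists>a < length y. \<exists>b < length y. \<exists>c < length y. nbrs3 (e 0) (adj y (e 0)) v a b c))"
  proof -
    have "dec (Suc (Suc (Suc (Suc 1)))) (\<lambda>y e. nbrs3_at y e 1 (Suc 1) (Suc (Suc 1)) (Suc (Suc (Suc 1))))"
      using assms by (intro dec_nbrs3) auto
    from dec_ex[OF dec_ex[OF dec_ex[OF this V'(4)] V'(3)] V'(2)]
    have "dec (Suc 1) (\<lambda>y e. \<exists>a < length y. \<exists>b < length y. \<exists>c < length y.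
       e 0 < length y \<and> e 1 < length y \<and> nbrs3 (e 0) (adj y (e 0)) (e 1) a b c)"
      by (rule dec_cong) (auto simp: nbrs3_at_def)
    then have "dec (Suc 1) (\<lambda>y e. (e 0 < length y \<and> e 1 < e 0) \<longrightarrow>
      (\<exists>a < length y. \<exists>b < length y. \<exists>c < length y.
       e 0 < length y \<and> e 1 < length y \<and> nbrs3 (e 0) (adj y (e 0)) (e 1) a b c))"
      using assms by (intro dec_imp dec_less) auto
    from dec_all[OF this V'(1)] show ?thesis by (rule dec_cong) auto
  qed
  have rng: "dec 1 (\<lambda>y e. e 0 < length y)" using assms by (intro dec_in_range) auto
  from dec_conj[OF rng dec_conj[OF len dec_conj[OF irr dec_conj[OF sym reg]]]] show ?thesis
  proof (rule dec_cong)
    fix y :: "bool list" and e :: "nat \<Rightarrow> nat"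
    define n where "n = e 0"
    define A where "A = adj y n"
    have len_iff: "(\<exists>l < length y. (\<forall>m < length y. \<not> l < m) \<and> clip y n + 1 + clip y n * clip y n = l)
       \<longleftrightarrow> length y = n + n * n + 2" if n: "n < length y"
    proof -
      have "(\<exists>l < length y. (\<forall>m < length y. \<not> l < m) \<and> n + 1 + n * n = l) \<longleftrightarrow> length y = n + n * n + 2"
      proof
        assume "\<exists>l < length y. (\<forall>m < length y. \<not> l < m) \<and> n + 1 + n * n = l"
        then have "n + 1 + n * n < length y" "\<not> (Suc (n + 1 + n * n) < length y)" by auto
        then show "length y = n + n * n + 2" by linarith
      qed auto
      then show ?thesis using n by (simp add: clip_def)
    qed
    have bound: "a < n \<and> b < n \<and> c < n" if "nbrs3 n A v a b c" for v a b c
      using that by (auto simp: nbrs3_def)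
    have ex: "(\<exists>a < length y. \<exists>b < length y. \<exists>c < length y. nbrs3 n A v a b c) \<longleftrightarrow>
       (\<exists>a < n. \<exists>b < n. \<exists>c < n. nbrs3 n A v a b c)" if "n < length y" for v
      using bound[of v] that by (meson less_trans)
    have all: "(\<forall>i < length y. i < n \<longrightarrow> P i) \<longleftrightarrow> (\<forall>i < n. P i)"
      if "n < length y" for P
      using that by auto
    have all2: "(\<forall>i < length y. \<forall>j < length y. i < n \<longrightarrow> j < n \<longrightarrow> P i j)
       \<longleftrightarrow> (\<forall>i < n. \<forall>j < n. P i j)"
      if "n < length y" for P
      using that by auto
    show "(e 0 < length y \<and>
        (\<exists>l < length y. (\<forall>m < length y. \<not> l < m) \<and> clip y (e 0) + 1 + clip y (e 0) * clip y (e 0) = l) \<and>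
        (\<forall>i < length y. (e 0 < length y \<and> i < e 0) \<longrightarrow> \<not> adj y (e 0) i i) \<and>
        (\<forall>i < length y. \<forall>j < length y. (e 0 < length y \<and> i < e 0) \<longrightarrow>
           (e 0 < length y \<and> j < e 0) \<longrightarrow> adj y (e 0) i j \<longrightarrow> adj y (e 0) j i) \<and>
        (\<forall>v < length y. (e 0 < length y \<and> v < e 0) \<longrightarrow>
     (\<exists>a < length y. \<exists>b < length y. \<exists>c < length y. nbrs3 (e 0) (adj y (e 0)) v a b c))) =
      (e 0 < length y \<and> valid y (e 0))"
      unfolding n_def[symmetric] A_def[symmetric]
      by (rule conj_cong[OF refl])
        (simp only: simp_thms len_iff all all2 ex valid_def cubic_def sym_irrefl_def conj_assoc A_def[symmetric])
  qed
qed

lemma outp_concat_map: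
  assumes "\<And>k. outp d (S k)"
  shows "outp d (\<lambda>y e. concat (map (\<lambda>k. S k y e) ks))"
proof (induction ks)
  case Nil
  then show ?case using outp_Nil by simp
next
  case (Cons k ks)
  then show ?case using outp_append[OF assms[of k] Cons] by simp
qed

lemma outp_for_less:
  assumes "outp (Suc d) S" "0 < d" "d < V"
  shows "outp d (\<lambda>y e. concat (map (\<lambda>a. if e 0 < length y \<and> a < e 0 then S y (e(d := a)) else []) [0..<length y]))"
proof -
  have "outp (Suc d) (\<lambda>y e. if e 0 < length y \<and> e d < e 0 then S y e else [])"
    using assms by (intro outp_if dec_less) auto
  from outp_for[OF this assms(3)] show ?thesis using assms(2) by simp
qed

text \<open>Loops run over all positions of the word, so each vertex loop is filtered by
  \<open>e 0\<close>. The guards make this a total function of the word, whether or not it encodes a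
  graph.\<close>

definition gadget_code :: "bool list \<Rightarrow> (nat \<Rightarrow> nat) \<Rightarrow> bool list" where
  "gadget_code y e = concat (map (\<lambda>a. if e 0 < length y \<and> a < e 0 then concat (map (\<lambda>k. [True]) [0..<5]) else []) [0..<length y])
    @ [False] @ concat (map (\<lambda>v. if e 0 < length y \<and> v < e 0 then
      concat (map (\<lambda>k. concat (map (\<lambda>u. if e 0 < length y \<and> u < e 0 then
        concat (map (\<lambda>l. [e 0 < length y \<and> v < length y \<and> u < length y \<and> gadget (e 0) (adj y (e 0)) k l v u]) [0..<5])
      else []) [0..<length y])) [0..<5])
    else []) [0..<length y])"

lemma outp_gadget_code:
  assumes "9 < V"
  shows "outp 1 gadget_code"
proof -
  have b: "outp (Suc 1) (\<lambda>_ _. concat (map (\<lambda>k. [True]) [0..<5]))"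
    by (intro outp_concat_map outp_bit dec_const)
  have f: "outp 1 (\<lambda>_ _. [False])" by (intro outp_bit dec_const)
  have V': "1 < V" "Suc 1 < V" using assms by auto
  have "outp (Suc (Suc 1)) (\<lambda>y e. concat (map (\<lambda>l. [e 0 < length y \<and> e 1 < length y \<and> e (Suc 1) < length y \<and>
      gadget (e 0) (adj y (e 0)) k l (e 1) (e (Suc 1))]) [0..<5]))" for k
    using assms by (intro outp_concat_map outp_bit dec_gadget) auto
  from outp_for_less[OF this _ V'(2)]
  have "outp (Suc 1) (\<lambda>y e. concat (map (\<lambda>u. if e 0 < length y \<and> u < e 0 then
      concat (map (\<lambda>l. [e 0 < length y \<and> e 1 < length y \<and> u < length y \<and>
      gadget (e 0) (adj y (e 0)) k l (e 1) u]) [0..<5]) else []) [0..<length y]))" for k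
    by (simp cong: if_cong)
  from outp_for_less[OF outp_concat_map[OF this] _ V'(1)]
  have m: "outp 1 (\<lambda>y e. concat (map (\<lambda>v. if e 0 < length y \<and> v < e 0 then
      concat (map (\<lambda>k. concat (map (\<lambda>u. if e 0 < length y \<and> u < e 0 then
        concat (map (\<lambda>l. [e 0 < length y \<and> v < length y \<and> u < length y \<and> gadget (e 0) (adj y (e 0)) k l v u]) [0..<5])
      else []) [0..<length y])) [0..<5])
    else []) [0..<length y]))"
    by (simp cong: if_cong)
  show ?thesis
    unfolding gadget_code_def[abs_def] using assms
    by (intro outp_append m f outp_for_less[OF b]) auto
qed

end

lemma (in layout) gadget_code_eq:
  assumes "valid y (e 0)" "e 0 < length y"
  shows "gadget_code y e = encode_graph (gadget_graph (e 0) (adj y (e 0)))"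
proof -
  define n where "n = e 0"
  define A where "A = adj y n"
  have n: "n < length y" "n \<le> length y" using assms by (auto simp: n_def)
  have cub: "cubic n A" using assms by (simp add: valid_def n_def A_def)
  then obtain N where "cubic_graph n A N" by (rule cubic_graph_ex)
  then have si: "sym_irrefl (5 * n) (gadget_adj n A)" by (rule cubic_graph.H_sym_irrefl)
  have "replicate (5 * n) True = concat (map (\<lambda>_. [True]) [0..<5 * n])"
    by (simp add: map_concat_singleton[symmetric] map_replicate_const)
  also have "\<dots> = concat (map (\<lambda>v. concat (map (\<lambda>k. [True]) [0..<5])) [0..<n])"
    by (rule concat_map_mult)
  finally have 1: "replicate (5 * n) True = concat (map (\<lambda>v. concat (map (\<lambda>k. [True]) [0..<5])) [0..<n])" .
  have row: "map (gadget_adj n A (5 * v + k)) [0..<5 * n] =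
     concat (map (\<lambda>u. concat (map (\<lambda>l. [gadget n A k l v u]) [0..<5])) [0..<n])" if "k < 5" for v k
  proof -
    have "concat (map (\<lambda>l. [gadget_adj n A (5 * v + k) (5 * u + l)]) [0..<5]) =
      concat (map (\<lambda>l. [gadget n A k l v u]) [0..<5])" for u
      using that by (intro arg_cong[where f = concat] map_cong) (auto simp: gadget_adj_def)
    note eq = this
    show ?thesis
      unfolding map_concat_singleton[of "gadget_adj n A (5 * v + k)"]
      by (subst concat_map_mult) (simp only: eq)
  qed
  have "concat (map (\<lambda>i. map (gadget_adj n A i) [0..<5 * n]) [0..<5 * n]) =
    concat (map (\<lambda>v. concat (map (\<lambda>k. map (gadget_adj n A (5 * v + k)) [0..<5 * n]) [0..<5])) [0..<n])"
    by (rule concat_map_mult)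
  also have "\<dots> = concat (map (\<lambda>v. concat (map (\<lambda>k. concat (map (\<lambda>u.
      concat (map (\<lambda>l. [gadget n A k l v u]) [0..<5])) [0..<n])) [0..<5])) [0..<n])"
    by (intro arg_cong[where f = concat] map_cong refl row) auto
  finally have 2: "concat (map (\<lambda>i. map (gadget_adj n A i) [0..<5 * n]) [0..<5 * n]) =
     concat (map (\<lambda>v. concat (map (\<lambda>k. concat (map (\<lambda>u.
      concat (map (\<lambda>l. [gadget n A k l v u]) [0..<5])) [0..<n])) [0..<5])) [0..<n])" .
  have in_range: "(n < length y \<and> v < length y \<and> u < length y \<and> P) \<longleftrightarrow> P" if "v < n" "u < n" for v u P
    using n that by auto
  have inner: "concat (map (\<lambda>u. if n < length y \<and> u < n then
        concat (map (\<lambda>l. [n < length y \<and> v < length y \<and> u < length y \<and> gadget n A k l v u]) [0..<5])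
      else []) [0..<length y]) =
      concat (map (\<lambda>u. concat (map (\<lambda>l. [gadget n A k l v u]) [0..<5])) [0..<n])" if "v < n" for v k
    by (rule concat_map_if_less[OF n(1)]) (simp only: in_range[OF that])
  have "gadget_code y e = concat (map (\<lambda>v. concat (map (\<lambda>k. [True]) [0..<5])) [0..<n]) @ [False] @
     concat (map (\<lambda>v. concat (map (\<lambda>k. concat (map (\<lambda>u.
      concat (map (\<lambda>l. [gadget n A k l v u]) [0..<5])) [0..<n])) [0..<5])) [0..<n])"
    unfolding gadget_code_def n_def[symmetric] A_def[symmetric]
    by (intro arg_cong2[where f = append] refl concat_map_if_less n(1)) (simp only: inner)
  then show ?thesis
    unfolding gadget_graph_def encode_graph_of[OF si] n_def[symmetric] A_def[symmetric] 1[symmetric] 2[symmetric]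
    by simp
qed

section \<open>Assembling the oracle machine\<close>

lemma tape_stringI:
  assumes "\<And>i. i < length z \<Longrightarrow> c (h + int i) = Some (z ! i)" "c (h + int (length z)) = None"
  shows "tape_string (c, h) = z"
proof -
  have "(LEAST n. c (h + int n) = None) = length z"
    using assms by (intro Least_equality) (auto simp: not_less[symmetric])
  then show ?thesis using assms by (auto simp: tape_string_def intro!: nth_equalityI)
qed

text \<open>The premise exhibits some blank, without which the \<open>LEAST\<close> in
  \<open>tape_string\<close> would be unspecified.\<close>

lemma tape_stringD:
  assumes "c (h + int m) = None"
  defines "z \<equiv> tape_string (c, h)"
  shows "length z \<le> m" "\<And>i. i < length z \<Longrightarrow> c (h + int i) = Some (z ! i)"
    "c (h + int (length z)) = None"
proof -
  have len: "length z = (LEAST n. c (h + int n) = None)" by (simp add: z_def tape_string_def)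
  show "length z \<le> m" unfolding len by (rule Least_le) (rule assms(1))
  show "c (h + int (length z)) = None" unfolding len by (rule LeastI) (rule assms(1))
  fix i assume i: "i < length z"
  then have "c (h + int i) \<noteq> None" unfolding len by (rule not_less_Least)
  then show "c (h + int i) = Some (z ! i)" using i by (auto simp: z_def tape_string_def)
qed

lemma tape_string_wtape: "tape_string (wtape (y @ z) (int (length y))) = z"
  by (rule tape_stringI) (auto simp: tape_of_def nat_add_distrib)

lemma wtape_0: "wtape y 0 = tape_of y" by (simp add: tape_of_def)

subsection \<open>Tapes during a computation\<close>

text \<open>A string is read to the right of the head, so its length is controlled by the head
  position and the blanks on the right; contents on the left do not matter.\<close>

definition confined :: "nat \<Rightarrow> tape \<Rightarrow> bool" where
  "confined B = (\<lambda>(c, h). \<bar>h\<bar> \<le> int B \<and> (\<forall>i \<ge> int B. c i = None))"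

lemma confined_act: "confined B t \<Longrightarrow> confined (Suc B) (act a t)"
  by (cases t; cases a; cases "snd a") (auto simp: confined_def split: dir.splits)

lemma step_confined:
  assumes "query M = None" "\<forall>t \<in> set ts. confined B t" "step M orc (q, ts) = (q', ts')"
  shows "\<forall>t \<in> set ts'. confined (Suc B) t"
proof (cases "q = halt M")
  case True
  have "confined B t \<Longrightarrow> confined (Suc B) t" for t by (auto simp: confined_def)
  then show ?thesis using True assms by (auto simp: step_def)
next
  case False
  then obtain acts where ts': "ts' = map2 act acts ts"
    using assms by (auto simp: step_def split: prod.splits)
  show ?thesis unfolding ts' using assms(2) by (auto dest!: set_zip_rightD intro: confined_act)
qed

lemma steps_confined:
  assumes "query M = None" "(step M orc ^^ t) (init M x) = (q, ts)"
  shows "\<forall>u \<in> set ts. confined (length x + t) u"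
  using assms(2)
proof (induction t arbitrary: q ts)
  case 0
  then show ?case by (auto simp: init_def confined_def tape_of_def)
next
  case (Suc t)
  obtain q1 ts1 where 1: "(step M orc ^^ t) (init M x) = (q1, ts1)" by fastforce
  show ?case using step_confined[OF assms(1) Suc.IH[OF 1]] Suc.prems 1 by simp
qed

subsection \<open>Simulating a machine\<close>

text \<open>Structured programs have no finite control of their own, so the state of the simulated machine
  is kept on additional tapes: the one for state \<open>q\<close> carries a mark iff \<open>q\<close> is current.\<close>

definition mark :: "bool \<Rightarrow> symbol" where "mark b = (if b then Some True else None)"

definition mark_tape :: "bool \<Rightarrow> tape" where "mark_tape b = ((\<lambda>_. None)(0 := mark b), 0)"

text \<open>Tapes below 20 belong to the reduction: four service tapes and sixteen variables. The
  simulation must leave them as in \<open>T0\<close>.\<close>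

definition sim_rel :: "tm \<Rightarrow> tapes \<Rightarrow> tapes \<Rightarrow> config \<Rightarrow> bool" where
  "sim_rel M T0 T = (\<lambda>(q, ts). q < num_states M \<and> length ts = num_tapes M \<and> (\<forall>i < 20. T i = T0 i) \<and>
     (\<forall>j < num_tapes M. T (20 + j) = ts ! j) \<and>
     (\<forall>j < num_states M. T (20 + num_tapes M + j) = mark_tape (j = q)))"

definition sim_delta :: "tm \<Rightarrow> (nat \<Rightarrow> symbol) \<Rightarrow> nat \<times> (symbol \<times> dir) list" where
  "sim_delta M s = delta M (LEAST q. s (20 + num_tapes M + q) = Some True)
     (map (\<lambda>j. s (20 + j)) [0..<num_tapes M])"

definition sim_step :: "tm \<Rightarrow> com" where
  "sim_step M = Act (\<lambda>s i.
     if i < 20 then (s i, Stay)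
     else if i < 20 + num_tapes M then snd (sim_delta M s) ! (i - 20)
     else (mark (i - (20 + num_tapes M) = fst (sim_delta M s)), Stay))"

definition sim_loop :: "tm \<Rightarrow> com" where
  "sim_loop M = While (\<lambda>s. s (20 + num_tapes M + halt M) \<noteq> Some True) (sim_step M)"

definition sim_tapes :: "tm \<Rightarrow> nat" where
  "sim_tapes M = 20 + num_tapes M + num_states M"

lemma cell_mark_tape: "cell (mark_tape b) = mark b"
  by (simp add: mark_tape_def)

lemma mark_eq: "mark b = Some True \<longleftrightarrow> b"
  by (simp add: mark_def)

lemma sim_rel_mark:
  assumes "sim_rel M T0 T (q, ts)" "j < num_states M"
  shows "syms (sim_tapes M) T (20 + num_tapes M + j) = Some True \<longleftrightarrow> j = q"
proof -
  have "T (20 + num_tapes M + j) = mark_tape (j = q)" using assms by (simp add: sim_rel_def)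
  then show ?thesis using assms(2) by (simp add: syms_cell cell_mark_tape mark_eq sim_tapes_def)
qed

lemma sim_delta_eq:
  assumes "sim_rel M T0 T (q, ts)"
  shows "sim_delta M (syms (sim_tapes M) T) = delta M q (map (\<lambda>(c, h). c h) ts)"
proof -
  have q: "q < num_states M" and ts: "length ts = num_tapes M"
    "\<And>j. j < num_tapes M \<Longrightarrow> T (20 + j) = ts ! j"
    using assms by (auto simp: sim_rel_def)
  have "(LEAST p. syms (sim_tapes M) T (20 + num_tapes M + p) = Some True) = q"
  proof (rule Least_equality)
    show "syms (sim_tapes M) T (20 + num_tapes M + q) = Some True" using sim_rel_mark[OF assms q] by simp
    fix p assume p: "syms (sim_tapes M) T (20 + num_tapes M + p) = Some True"
    show "q \<le> p"
    proof (rule ccontr)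
      assume "\<not> q \<le> p"
      then show False using sim_rel_mark[OF assms, of p] p q by simp
    qed
  qed
  moreover have "map (\<lambda>j. syms (sim_tapes M) T (20 + j)) [0..<num_tapes M] = map (\<lambda>(c, h). c h) ts"
    using ts by (intro nth_equalityI) (auto simp: syms_def sim_tapes_def split_beta)
  ultimately show ?thesis by (simp add: sim_delta_def)
qed

text \<open>An action may depend on all symbols at once, and the marks put the current state among
  the symbols, so one action performs a whole transition.\<close>

lemma runs_sim_step:
  assumes M: "wf_tm M" "query M = None" and R: "sim_rel M T0 T (q, ts)" and "q \<noteq> halt M"
  shows "\<exists>T'. runs (sim_tapes M) (sim_step M) T 1 T' \<and> sim_rel M T0 T' (step M orc (q, ts))"
proof -
  let ?K = "sim_tapes M"
  obtain q' acts where d: "delta M q (map (\<lambda>(c, h). c h) ts) = (q', acts)" by fastforce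
  have q: "q < num_states M" and ts: "length ts = num_tapes M"
    "\<And>j. j < num_tapes M \<Longrightarrow> T (20 + j) = ts ! j"
    and st: "\<And>j. j < num_states M \<Longrightarrow> T (20 + num_tapes M + j) = mark_tape (j = q)"
    and low: "\<And>i. i < 20 \<Longrightarrow> T i = T0 i"
    using R by (auto simp: sim_rel_def)
  have wf: "q' < num_states M" "length acts = num_tapes M"
    using M(1) q ts(1) d unfolding wf_tm_def by (metis fst_conv snd_conv length_map)+
  have sd: "sim_delta M (syms ?K T) = (q', acts)" using sim_delta_eq[OF R] d by simp
  have step: "step M orc (q, ts) = (q', map2 act acts ts)"
    using assms(2,4) d by (simp add: step_def)
  let ?f = "\<lambda>s i. if i < 20 then (s i, Stay)
     else if i < 20 + num_tapes M then snd (sim_delta M s) ! (i - 20)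
     else (mark (i - (20 + num_tapes M) = fst (sim_delta M s)), Stay)"
  have act_mark: "act (mark b, Stay) (mark_tape b') = mark_tape b" for b b'
    by (auto simp: mark_tape_def)
  have "sim_rel M T0 (act_all ?K ?f T) (step M orc (q, ts))"
    unfolding step sim_rel_def split
  proof (intro conjI allI impI)
    show "q' < num_states M" by (rule wf)
    show "length (map2 act acts ts) = num_tapes M" using wf ts by simp
    fix i :: nat assume "i < 20"
    moreover from this have "i < ?K" by (simp add: sim_tapes_def)
    ultimately have "act_all ?K ?f T i = T i"
      by (simp add: act_all_def act_read)
    then show "act_all ?K ?f T i = T0 i" using low \<open>i < 20\<close> by simp
  next
    fix j assume "j < num_tapes M"
    moreover from this have "20 + j < ?K" by (simp add: sim_tapes_def)
    ultimately show "act_all ?K ?f T (20 + j) = map2 act acts ts ! j"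
      using ts wf by (simp add: act_all_def sd)
  next
    fix j assume "j < num_states M"
    moreover from this have "20 + num_tapes M + j < ?K" by (simp add: sim_tapes_def)
    ultimately show "act_all ?K ?f T (20 + num_tapes M + j) = mark_tape (j = q')"
      using st[of j] by (simp add: act_all_def sd act_mark)
  qed
  then show ?thesis unfolding sim_step_def using runs_Act by blast
qed

lemma runs_sim_loop:
  assumes M: "wf_tm M" "query M = None" and R: "sim_rel M T0 T (q, ts)"
    and halt: "(step M orc ^^ t) (q, ts) = (halt M, ts')"
  shows "\<exists>T'. runs (sim_tapes M) (sim_loop M) T (3 * t + 1) T' \<and> sim_rel M T0 T' (halt M, ts')"
  using R halt
proof (induction t arbitrary: q ts T)
  case 0
  then have "\<not> syms (sim_tapes M) T (20 + num_tapes M + halt M) \<noteq> Some True"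
    using sim_rel_mark[OF 0(1), of "halt M"] M(1) by (simp add: wf_tm_def)
  then show ?case using 0 unfolding sim_loop_def runs_def
    by (intro exI[of _ T] conjI exI[of _ 1] exec.WhileF) auto
next
  case (Suc t)
  have h: "halt M < num_states M" using M(1) by (simp add: wf_tm_def)
  show ?case
  proof (cases "q = halt M")
    case True
    \<comment> \<open>The given run may rest in the halting state before its time is up; that state
      is a fixed point of \<open>step\<close>, so leaving the loop early changes nothing.\<close>
    have "(step M orc ^^ t) (q, ts) = (q, ts)" for t
      using True by (induction t) (simp_all add: step_def)
    then have "ts = ts'" using Suc.prems(2) by (metis prod.inject)
    moreover have "\<not> syms (sim_tapes M) T (20 + num_tapes M + halt M) \<noteq> Some True"
      using sim_rel_mark[OF Suc.prems(1) h] True by simp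
    ultimately show ?thesis using Suc.prems(1) True unfolding sim_loop_def runs_def
      by (intro exI[of _ T] conjI exI[of _ 1] exec.WhileF) auto
  next
    case False
    obtain T1 where T1: "runs (sim_tapes M) (sim_step M) T 1 T1" "sim_rel M T0 T1 (step M orc (q, ts))"
      using runs_sim_step[OF M Suc.prems(1) False] by blast
    obtain q1 ts1 where s: "step M orc (q, ts) = (q1, ts1)" by fastforce
    have "(step M orc ^^ t) (q1, ts1) = (halt M, ts')"
      using Suc.prems(2) s by (simp add: funpow_swap1)
    from Suc.IH[OF T1(2)[unfolded s] this]
    obtain T2 where T2: "runs (sim_tapes M) (sim_loop M) T1 (3 * t + 1) T2" "sim_rel M T0 T2 (halt M, ts')"
      by blast
    have b: "syms (sim_tapes M) T (20 + num_tapes M + halt M) \<noteq> Some True"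
      using sim_rel_mark[OF Suc.prems(1) h] False by simp
    obtain k l where kl: "k \<le> 1" "exec (sim_tapes M) (sim_step M) T k T1"
      "l \<le> 3 * t + 1" "exec (sim_tapes M) (sim_loop M) T1 l T2"
      using T1(1) T2(1) by (auto simp: runs_def)
    have "exec (sim_tapes M) (sim_loop M) T (k + 2 + l) T2"
      using exec.WhileT[of "\<lambda>s. s (20 + num_tapes M + halt M) \<noteq> Some True", OF b kl(2)] kl(4)
      by (simp add: sim_loop_def)
    moreover have "k + 2 + l \<le> 3 * Suc t + 1" using kl by simp
    ultimately show ?thesis using T2(2) unfolding runs_def by blast
  qed
qed

subsection \<open>The reduction\<close>

text \<open>Tape 0 keeps its head behind the input. Everything from there on is blank, so the final
  answer can be written there without erasing the input.\<close>

definition copy_input :: com where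
  "copy_input = Seq (While (\<lambda>s. s 0 \<noteq> None)
     (Act (\<lambda>s i. if i = 0 \<or> i = 20 then (s 0, MoveRight) else (s i, Stay)))) (rewind 20)"

lemma wtape_take_Suc:
  "k < length z \<Longrightarrow> shift MoveRight (put (z ! k) (wtape (take k z) (int k))) = wtape (take (Suc k) z) (int (Suc k))"
  using put_wtape[of "z ! k" "take k z"] by (simp add: take_Suc_conv_app_nth del: put.simps)

lemma runs_copy_input:
  assumes "20 < K" "T 0 = tape_of x" "T 20 = tape_of []"
  shows "runs K copy_input T (6 * length x + 4) (T(0 := wtape x (int (length x)), 20 := wtape x 0))"
proof -
  let ?f = "\<lambda>s i. if i = 0 \<or> i = 20 then (s 0, MoveRight) else (s i, Stay)"
  define S where "S = (\<lambda>k. T(0 := wtape x (int k), 20 := wtape (take k x) (int k)))"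
  have 1: "runs K (While (\<lambda>s. s 0 \<noteq> None) (Act ?f)) T (length x * (1 + 2) + 1) (S (length x))"
  proof (rule runs_While[where S = S])
    fix k assume k: "k < length x"
    have s0: "syms K (S k) 0 = Some (x ! k)"
      using k assms(1) by (simp add: S_def syms_cell cell_wtape del: cell.simps)
    have "act (Some (x ! k), MoveRight) (wtape x (int k)) = wtape x (int (Suc k))"
      using act_read[of 0 K "S k" MoveRight] s0 assms(1) by (simp add: S_def)
    moreover have "act (Some (x ! k), MoveRight) (wtape (take k x) (int k)) = wtape (take (Suc k) x) (int (Suc k))"
      using wtape_take_Suc[OF k] by (simp only: act_write)
    ultimately have "act_all K ?f (S k) = S (Suc k)"
      using assms(1) s0 by (auto simp: act_all_def fun_eq_iff act_read) (auto simp: S_def)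
    then show "syms K (S k) 0 \<noteq> None \<and> runs K (Act ?f) (S k) 1 (S (Suc k))"
      by (intro conjI runs_Act) (simp add: s0)
  next
    show "\<not> syms K (S (length x)) 0 \<noteq> None"
      by (simp add: S_def syms_cell cell_wtape del: cell.simps)
    show "S 0 = T" using assms by (simp add: S_def wtape_0 fun_upd_idem)
  qed simp
  have 2: "runs K (rewind 20) (S (length x)) (3 * length x + 3) (T(0 := wtape x (int (length x)), 20 := wtape x 0))"
    using runs_rewind[of 20 K "S (length x)" x "length x"] assms(1) by (simp add: S_def)
  show ?thesis unfolding copy_input_def by (rule runs_mono[OF runs_Seq[OF 1 2]]) simp
qed

text \<open>One pass makes seventeen copies, for the scratch tape and the sixteen variables, each
  extended by the extra \<open>False\<close>. All their heads move together, so tape 3 alone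
  controls the rewinding.\<close>

definition copy_output :: com where
  "copy_output =
     Seq (While (\<lambda>s. s 20 \<noteq> None)
       (Act (\<lambda>s i. if i \<in> {3..20} then (s 20, MoveRight) else (s i, Stay))))
    (Seq (Act (\<lambda>s i. if i \<in> {3..<20} then (Some False, Stay) else (s i, Stay)))
    (Seq (While (\<lambda>s. s 3 \<noteq> None) (mv {3..<20} MoveLeft)) (mv {3..<20} MoveRight)))"

lemma runs_copy_output:
  assumes K: "20 < K" and T: "\<And>i. 3 \<le> i \<Longrightarrow> i < 20 \<Longrightarrow> T i = tape_of []" "T 20 = (c, h)"
    and z: "\<And>i. i < length z \<Longrightarrow> c (h + int i) = Some (z ! i)" "c (h + int (length z)) = None"
  shows "\<exists>T'. runs K copy_output T (6 * length z + 7) T' \<and>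
     (\<forall>i. 3 \<le> i \<longrightarrow> i < 20 \<longrightarrow> T' i = wtape (z @ [False]) 0) \<and> (\<forall>i < 3. T' i = T i)"
proof -
  let ?f = "\<lambda>s i. if i \<in> {3..20} then (s 20, MoveRight) else (s i, Stay)"
  let ?g = "\<lambda>s i. if i \<in> {3..<20} then (Some False, Stay) else (s i, Stay)"
  let ?y = "z @ [False]"
  define S where "S = (\<lambda>k i. if 3 \<le> i \<and> i < 20 then wtape (take k z) (int k)
    else if i = 20 then (c, h + int k) else T i)"
  define R where "R = (\<lambda>k i. if 3 \<le> i \<and> i < 20 then wtape ?y (int (length z) - int k) else S (length z) i)"
  define E where "E = (\<lambda>i. if 3 \<le> i \<and> i < 20 then wtape ?y 0 else S (length z) i)"
  have 1: "runs K (While (\<lambda>s. s 20 \<noteq> None) (Act ?f)) T (length z * (1 + 2) + 1) (S (length z))"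
  proof (rule runs_While[where S = S])
    fix k assume k: "k < length z"
    have s: "syms K (S k) 20 = Some (z ! k)"
      using k K z by (simp add: S_def syms_cell)
    have "act (Some (z ! k), MoveRight) (c, h + int k) = (c, h + int (Suc k))"
      using z(1)[OF k] by (auto simp: fun_eq_iff)
    moreover have "act (Some (z ! k), MoveRight) (wtape (take k z) (int k)) = wtape (take (Suc k) z) (int (Suc k))"
      using wtape_take_Suc[OF k] by (simp only: act_write)
    ultimately have "act_all K ?f (S k) = S (Suc k)"
      using K s by (auto simp: act_all_def fun_eq_iff act_read) (auto simp: S_def)
    then show "syms K (S k) 20 \<noteq> None \<and> runs K (Act ?f) (S k) 1 (S (Suc k))"
      by (intro conjI runs_Act) (simp add: s)
  next
    show "\<not> syms K (S (length z)) 20 \<noteq> None"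
      using z(2) by (simp add: S_def syms_cell)
    show "S 0 = T" using T by (auto simp: S_def tape_of_def fun_eq_iff)
  qed simp
  have "act (Some False, Stay) (wtape z (int (length z))) = wtape ?y (int (length z))"
    by (simp only: act_write put_wtape shift_Stay)
  then have 2: "runs K (Act ?g) (S (length z)) 1 (R 0)"
    using K by (intro runs_Act) (auto simp: act_all_def fun_eq_iff act_read R_def, auto simp: S_def)
  have 3: "runs K (While (\<lambda>s. s 3 \<noteq> None) (mv {3..<20} MoveLeft)) (R 0) (length ?y * (1 + 2) + 1) (R (length ?y))"
  proof (rule runs_While[where S = R])
    fix k assume k: "k < length ?y"
    have "runs K (mv {3..<20} MoveLeft) (R k) 1 (R (Suc k))"
      by (rule runs_mv) (use K in \<open>auto simp: R_def\<close>)
    then show "syms K (R k) 3 \<noteq> None \<and> runs K (mv {3..<20} MoveLeft) (R k) 1 (R (Suc k))"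
      using k K by (simp add: R_def syms_cell cell_wtape del: cell.simps)
  qed (auto simp: R_def syms_cell cell_wtape simp del: cell.simps)
  have 4: "runs K (mv {3..<20} MoveRight) (R (length ?y)) 1 E"
    by (rule runs_mv) (use K in \<open>auto simp: R_def E_def\<close>)
  have "runs K copy_output T (6 * length z + 7) E"
    unfolding copy_output_def by (rule runs_mono[OF runs_Seq[OF 1 runs_Seq[OF 2 runs_Seq[OF 3 4]]]]) simp
  then show ?thesis by (intro exI[of _ E]) (auto simp: E_def S_def)
qed

definition find_hdr :: com where
  "find_hdr = While (\<lambda>s. s 4 = Some True) (mv {4} MoveRight)"

lemma runs_find_hdr:
  assumes "4 < K" "T 4 = wtape y 0" "hdr y < length y"
  shows "runs K find_hdr T (3 * length y + 1) (T(4 := wtape y (int (hdr y))))"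
proof -
  have "runs K find_hdr T (hdr y * (1 + 2) + 1) (T(4 := wtape y (int (hdr y))))"
    unfolding find_hdr_def
  proof (rule runs_While[where S = "\<lambda>k. T(4 := wtape y (int k))"])
    fix k assume k: "k < hdr y"
    then have "y ! k"
      unfolding hdr_def by (metis id_apply nth_mem set_takeWhileD takeWhile_nth)
    then have "syms K (T(4 := wtape y (int k))) 4 = Some True"
      using k assms by (simp add: syms_cell cell_wtape del: cell.simps)
    moreover have "runs K (mv {4} MoveRight) (T(4 := wtape y (int k))) 1 (T(4 := wtape y (int (Suc k))))"
      by (rule runs_mv) (use assms in auto)
    ultimately show "syms K (T(4 := wtape y (int k))) 4 = Some True \<and>
       runs K (mv {4} MoveRight) (T(4 := wtape y (int k))) 1 (T(4 := wtape y (int (Suc k))))" ..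
  next
    show "syms K (T(4 := wtape y (int (hdr y)))) 4 \<noteq> Some True"
      using assms nth_hdr[OF assms(3)] by (simp add: syms_cell cell_wtape del: cell.simps)
  qed (use assms in \<open>auto simp: fun_upd_idem\<close>)
  then show ?thesis by (rule runs_mono) (use assms in simp)
qed

text \<open>The answer is unary, so its length is matched against the head position on tape 4, which
  has exactly \<open>n\<close> cells left after the first move. That head also bounds the loop: the
  time does not depend on the length of the answer, which an oracle may choose freely on
  non-instances.\<close>

definition compare_answer :: com where
  "compare_answer = Seq (mv {4} MoveLeft)
    (Seq (While (\<lambda>s. s 1 \<noteq> None \<and> s 4 \<noteq> None) (Seq (mv {1} MoveRight) (mv {4} MoveLeft)))
         (wr 0 (\<lambda>s. s 1 = None \<and> s 4 = None) Stay))"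

lemma runs_compare_answer:
  assumes "4 < K" "T 4 = wtape y (int n)" "n < length y" "T 1 = tape_of a"
  shows "\<exists>T'. runs K compare_answer T (4 * length y + 3) T' \<and> T' 0 = put (length a = n) (T 0)"
proof -
  define m where "m = min (length a) n"
  define S where "S = (\<lambda>k. T(1 := wtape a (int k), 4 := wtape y (int n - 1 - int k)))"
  have 1: "runs K (mv {4} MoveLeft) T 1 (S 0)"
    by (rule runs_mv) (use assms in \<open>auto simp: S_def wtape_0\<close>)
  have 2: "runs K (While (\<lambda>s. s 1 \<noteq> None \<and> s 4 \<noteq> None) (Seq (mv {1} MoveRight) (mv {4} MoveLeft)))
     (S 0) (m * ((1 + 1) + 2) + 1) (S m)"
  proof (rule runs_While[where S = S])
    fix k assume k: "k < m"
    have "runs K (Seq (mv {1} MoveRight) (mv {4} MoveLeft)) (S k) (1 + 1) (S (Suc k))"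
      by (rule runs_Seq[where T' = "(S (Suc k))(4 := wtape y (int n - 1 - int k))"];
          rule runs_mv; use assms(1) in \<open>auto simp: S_def\<close>)
    moreover have "syms K (S k) 1 \<noteq> None" "syms K (S k) 4 \<noteq> None"
      using k assms by (auto simp: S_def syms_cell cell_wtape m_def simp del: cell.simps)
    ultimately show "(syms K (S k) 1 \<noteq> None \<and> syms K (S k) 4 \<noteq> None) \<and>
      runs K (Seq (mv {1} MoveRight) (mv {4} MoveLeft)) (S k) (1 + 1) (S (Suc k))" by blast
  next
    show "\<not> (syms K (S m) 1 \<noteq> None \<and> syms K (S m) 4 \<noteq> None)"
      by (auto simp: S_def syms_cell cell_wtape m_def simp del: cell.simps)
  qed auto
  have eq: "(syms K (S m) 1 = None \<and> syms K (S m) 4 = None) = (length a = n)"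
    using assms by (auto simp: S_def syms_cell cell_wtape m_def simp del: cell.simps)
  have 3: "runs K (wr 0 (\<lambda>s. s 1 = None \<and> s 4 = None) Stay) (S m) 1 ((S m)(0 := put (length a = n) (T 0)))"
    using runs_wr[of 0 K "\<lambda>s. s 1 = None \<and> s 4 = None" Stay "S m"] assms(1)
    unfolding eq by (simp add: S_def)
  have "m \<le> length y" using assms(3) by (simp add: m_def)
  then have "runs K compare_answer T (4 * length y + 3) ((S m)(0 := put (length a = n) (T 0)))"
    unfolding compare_answer_def by (intro runs_mono[OF runs_Seq[OF 1 runs_Seq[OF 2 3]]]) simp
  then show ?thesis by (intro exI[of _ "(S m)(0 := put (length a = n) (T 0))"]) simp
qed

lemma length_concat_map_upt:
  assumes "\<And>a. length (f a) \<le> B"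
  shows "length (concat (map f [0..<n])) \<le> n * B"
proof (induction n)
  case (Suc n)
  then show ?case using assms[of n] by simp
qed simp

lemma length_if_le: "length xs \<le> B \<Longrightarrow> length (if b then xs else []) \<le> B"
  by simp

text \<open>The bound must hold for every word, since the query is written before validity has been
  tested. The factor 25 comes from five vertices per vertex, in rows and in columns.\<close>

lemma (in layout) length_gadget_code:
  "length (gadget_code y e) \<le> 25 * length y * length y + 5 * length y + 1"
proof -
  let ?N = "length y"
  have "length (gadget_code y e) \<le> ?N * (5 * 1) + (1 + ?N * (5 * (?N * (5 * 1))))"
    unfolding gadget_code_def length_append
    by (intro add_mono length_concat_map_upt length_if_le) simp_all
  then show ?thesis by (simp add: algebra_simps)
qed

text \<open>Natural coefficients make polynomials monotone, so a bound in the length of the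
  simulated output becomes one in the length of the input by composition.\<close>

lemma poly_mono_nat: "x \<le> y \<Longrightarrow> poly p x \<le> poly p y" for p :: "nat poly"
  by (induction p) (auto intro: add_mono mult_mono)

definition start_tapes :: "bool list \<Rightarrow> tapes" where
  "start_tapes x = (\<lambda>i. if i = 0 then tape_of x else tape_of [])"

lemma init_query_tm:
  assumes "0 < K" shows "init (query_tm K c d) x = (0, map (start_tapes x) [0..<K])"
proof -
  have "map (start_tapes x) [0..<K] = start_tapes x 0 # map (start_tapes x) [1..<K]"
    using assms by (simp add: upt_conv_Cons)
  also have "map (start_tapes x) [1..<K] = replicate (K - 1) (tape_of [])"
    by (intro nth_equalityI) (auto simp: start_tapes_def)
  finally show ?thesis by (simp add: init_def query_tm_def start_tapes_def)
qed

definition run_machine :: "tm \<Rightarrow> com" where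
  "run_machine M = Seq copy_input (Seq (wr (20 + num_tapes M + start M) (\<lambda>_. True) Stay)
     (Seq (sim_loop M) (Seq copy_output find_hdr)))"

lemma runs_run_machine:
  assumes M: "wf_tm M" "query M = None"
    and halt: "(step M orc ^^ t) (init M x) = (halt M, ts)" "tape_string (ts ! 0) = z"
  defines "y \<equiv> z @ [False]"
  shows "length z \<le> 2 * (length x + t)"
    "\<exists>T. runs (sim_tapes M) (run_machine M) (start_tapes x) (6 * length x + 3 * t + 9 * length y + 14) T \<and>
       T 0 = wtape x (int (length x)) \<and> T 1 = tape_of [] \<and>
       (\<forall>i. 3 \<le> i \<longrightarrow> i < 20 \<longrightarrow> T i = wtape y (if i = 4 then int (hdr y) else 0))"
proof -
  let ?K = "sim_tapes M" and ?m = "num_tapes M"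
  have m: "2 \<le> ?m" and st: "start M < num_states M" using M(1) by (auto simp: wf_tm_def)
  have K: "20 + ?m + start M < ?K" "20 < ?K" using st m by (auto simp: sim_tapes_def)
  define T1 where "T1 = (start_tapes x)(0 := wtape x (int (length x)), 20 := wtape x 0)"
  define T2 where "T2 = T1(20 + ?m + start M := mark_tape True)"
  have 1: "runs ?K copy_input (start_tapes x) (6 * length x + 4) T1"
    unfolding T1_def by (rule runs_copy_input) (use K in \<open>auto simp: start_tapes_def\<close>)
  have "shift Stay (put True (T1 (20 + ?m + start M))) = mark_tape True"
    using m by (simp add: T1_def start_tapes_def mark_tape_def mark_def tape_of_def fun_eq_iff)
  then have 2: "runs ?K (wr (20 + ?m + start M) (\<lambda>_. True) Stay) T1 1 T2"
    using runs_wr[of "20 + ?m + start M" ?K "\<lambda>_. True" Stay T1] K by (simp add: T2_def)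
  have "sim_rel M T1 T2 (start M, tape_of x # replicate (?m - 1) (tape_of []))"
    unfolding sim_rel_def split
  proof (intro conjI allI impI)
    fix j assume "j < ?m"
    then show "T2 (20 + j) = (tape_of x # replicate (?m - 1) (tape_of [])) ! j"
      using m by (cases j) (auto simp: T2_def T1_def start_tapes_def wtape_0)
  next
    fix j assume "j < num_states M"
    \<comment> \<open>An absent mark is a blank, so all state tapes except that of the start state
      are correct from the beginning.\<close>
    have "tape_of [] = mark_tape False" by (simp add: tape_of_def mark_tape_def mark_def fun_eq_iff)
    then show "T2 (20 + ?m + j) = mark_tape (j = start M)"
      using m by (auto simp: T2_def T1_def start_tapes_def)
  qed (use m st in \<open>auto simp: T2_def\<close>)
  then have R: "sim_rel M T1 T2 (init M x)" by (simp add: init_def)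
  obtain q0 ts0 where i: "init M x = (q0, ts0)" by fastforce
  obtain T3 where 3: "runs ?K (sim_loop M) T2 (3 * t + 1) T3" and R3: "sim_rel M T1 T3 (halt M, ts)"
    using runs_sim_loop[OF M R[unfolded i] halt(1)[unfolded i]] by blast
  have ts: "length ts = ?m" and T3: "T3 20 = ts ! 0" "\<And>i. i < 20 \<Longrightarrow> T3 i = T1 i"
    using R3 m unfolding sim_rel_def split by (auto dest: spec[of _ 0])
  obtain c h where ch: "ts ! 0 = (c, h)" by fastforce
  have "ts ! 0 \<in> set ts" using ts m by (intro nth_mem) simp
  then have conf: "\<bar>h\<bar> \<le> int (length x + t)" "\<And>i. int (length x + t) \<le> i \<Longrightarrow> c i = None"
    using steps_confined[OF M(2) halt(1)] unfolding ch by (auto simp: confined_def)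
  have blank: "c (h + int (nat (int (length x + t) - h))) = None" using conf by simp
  have tape_z: "tape_string (c, h) = z" using halt(2) ch by simp
  note zD = tape_stringD[of c h "nat (int (length x + t) - h)", OF blank, unfolded tape_z]
  \<comment> \<open>The head may be as far left as \<open>- (length x + t)\<close>, and from
    \<open>length x + t\<close> on all cells are blank; this is where the factor 2 comes
    from.\<close>
  have "nat (int (length x + t) - h) \<le> 2 * (length x + t)"
    using conf(1) unfolding nat_le_iff abs_le_iff by simp
  with zD(1) show "length z \<le> 2 * (length x + t)" by (rule order_trans)
  obtain T4 where 4: "runs ?K copy_output T3 (6 * length z + 7) T4"
      "\<And>i. 3 \<le> i \<Longrightarrow> i < 20 \<Longrightarrow> T4 i = wtape y 0" "\<And>i. i < 3 \<Longrightarrow> T4 i = T3 i"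
    using runs_copy_output[of ?K T3 c h z] K zD(2,3) T3 ch
    by (auto simp: T1_def start_tapes_def y_def)
  have hdr: "hdr y < length y" unfolding y_def by (rule hdr_less)
  have 5: "runs ?K find_hdr T4 (3 * length y + 1) (T4(4 := wtape y (int (hdr y))))"
    by (rule runs_find_hdr[OF _ _ hdr]) (use K 4(2) in auto)
  let ?T = "T4(4 := wtape y (int (hdr y)))"
  have "runs ?K (run_machine M) (start_tapes x) (6 * length x + 3 * t + 9 * length y + 14) ?T"
    unfolding run_machine_def
    by (rule runs_mono[OF runs_Seq[OF 1 runs_Seq[OF 2 runs_Seq[OF 3 runs_Seq[OF 4(1) 5]]]]])
      (simp add: y_def)
  moreover have "?T 0 = wtape x (int (length x))" "?T 1 = tape_of []"
    using 4(3) T3 by (simp_all add: T1_def start_tapes_def)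
  ultimately show "\<exists>T. runs ?K (run_machine M) (start_tapes x) (6 * length x + 3 * t + 9 * length y + 14) T \<and>
       T 0 = wtape x (int (length x)) \<and> T 1 = tape_of [] \<and>
       (\<forall>i. 3 \<le> i \<longrightarrow> i < 20 \<longrightarrow> T i = wtape y (if i = 4 then int (hdr y) else 0))"
    using 4(2) by (intro exI[of _ ?T]) auto
qed

theorem karp_imp_turing_reducible:
  assumes "karp_reducible L cubic_bipartite_NAE"
  shows "turing_reducible L cubic_min_edge_deletion_bipartition"
proof -
  obtain f M and p :: "nat poly" where f: "\<And>x. x \<in> L \<longleftrightarrow> f x \<in> cubic_bipartite_NAE"
    and M: "wf_tm M" "query M = None" and run: "computes_in_time M (\<lambda>_. []) f (poly p)"
    using assms unfolding karp_reducible_def polytime_def by blast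
  define K where "K = sim_tapes M"
  have K: "20 < K" using M(1) by (simp add: K_def sim_tapes_def wf_tm_def)
  interpret layout K 16 by unfold_locales (use K in simp)
  from outpE[OF outp_gadget_code] obtain c_out and p_out :: "nat poly" where
    c_out: "\<And>y e z T. vars y 1 e T \<Longrightarrow> T 1 = wtape z (int (length z)) \<Longrightarrow>
       (\<exists>b. runs K c_out T (poly p_out (length y))
          (T(2 := put b (T 2), 1 := wtape (z @ gadget_code y e) (int (length (z @ gadget_code y e))))))"
    by auto
  from decE[OF dec_valid] obtain c_val and p_val :: "nat poly" where
    c_val: "\<And>y e T. vars y 1 e T \<Longrightarrow> runs K c_val T (poly p_val (length y))
       (T(2 := put (e 0 < length y \<and> valid y (e 0)) (T 2)))"
    by auto
  \<comment> \<open>The compiled machine asks exactly one query, unconditionally; whether it was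
    meaningful is decided in \<open>d\<close>, where the variables are still intact.\<close>
  define c where "c = Seq (run_machine M) (Seq c_out (rewind 1))"
  define d where "d = Seq c_val (If (\<lambda>s. s 2 = Some True) compare_answer (wr 0 (\<lambda>_. False) Stay))"
  \<comment> \<open>Bounds the length of \<open>y\<close>: an output of at most twice input length
    plus running time, and the appended bit.\<close>
  define r :: "nat poly" where "r = [:2:] * ([:0,1:] + p) + [:1:]"
  define Q1 :: "nat poly" where
    "Q1 = [:9:] * [:0,1:] + [:17:] + p_out + [:3:] * ([:25:] * [:0,1:] * [:0,1:] + [:5:] * [:0,1:] + [:1:])"
  define Q2 :: "nat poly" where "Q2 = p_val + ([:4:] * [:0,1:] + [:5:])"
  define P :: "nat poly" where
    "P = [:6:] * [:0,1:] + [:3:] * p + pcompose Q1 r + [:1:] + pcompose Q2 r"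
  have "wf_tm (query_tm K c d)" using K by (intro wf_query_tm) simp
  moreover have "computes_in_time (query_tm K c d) orc (char_fun L) (poly P)"
    if orc: "\<forall>(x, y) \<in> cubic_min_edge_deletion_bipartition. orc x = y" for orc
    unfolding computes_in_time_def
  proof
    fix x
    obtain t ts where t: "t \<le> poly p (length x)"
      "(step M (\<lambda>_. []) ^^ t) (init M x) = (halt M, ts)" "tape_string (ts ! 0) = f x"
      using run unfolding computes_in_time_def by blast
    define y where "y = f x @ [False]"
    define n where "n = hdr y"
    define e where "e = (\<lambda>_ :: nat. 0 :: nat)(0 := n)"
    define G where "G = gadget_graph n (adj y n)"
    have n: "n < length y" unfolding n_def y_def by (rule hdr_less)
    note R = runs_run_machine[OF M t(2,3), folded K_def y_def]
    obtain T1 where T1: "runs K (run_machine M) (start_tapes x) (6 * length x + 3 * t + 9 * length y + 14) T1"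
      "T1 0 = wtape x (int (length x))" "T1 1 = tape_of []"
      "\<And>i. 3 \<le> i \<Longrightarrow> i < 20 \<Longrightarrow> T1 i = wtape y (if i = 4 then int n else 0)"
      using R(2) unfolding n_def by blast
    have y_le: "length y \<le> poly r (length x)"
      using R(1) t(1) by (simp add: y_def r_def)
    have vars1: "vars y 1 e T1"
      unfolding vars_def using T1(4) n by (auto simp: e_def)
    obtain b where T2: "runs K c_out T1 (poly p_out (length y))
          (T1(2 := put b (T1 2), 1 := wtape (gadget_code y e) (int (length (gadget_code y e)))))"
      using c_out[OF vars1, of "[]"] T1(3) by (auto simp: wtape_0)
    define T3 where "T3 = T1(2 := put b (T1 2), 1 := wtape (gadget_code y e) 0)"
    have T3: "runs K (rewind 1)
        (T1(2 := put b (T1 2), 1 := wtape (gadget_code y e) (int (length (gadget_code y e)))))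
        (3 * length (gadget_code y e) + 3) T3"
      using runs_rewind[of 1 K "T1(2 := put b (T1 2), 1 := wtape (gadget_code y e) (int (length (gadget_code y e))))"
        "gadget_code y e" "length (gadget_code y e)"] K by (simp add: T3_def)
    have "6 * length x + 3 * t + 9 * length y + 14 + (poly p_out (length y) + (3 * length (gadget_code y e) + 3))
       \<le> 6 * length x + 3 * poly p (length x) + poly Q1 (length y)"
      using t(1) length_gadget_code[of y e] by (simp add: Q1_def algebra_simps)
    also have "\<dots> \<le> 6 * length x + 3 * poly p (length x) + poly (pcompose Q1 r) (length x)"
      using poly_mono_nat[OF y_le, of Q1] by (simp add: poly_pcompose)
    finally have "runs K c (start_tapes x)
      (6 * length x + 3 * poly p (length x) + poly (pcompose Q1 r) (length x)) T3"
      unfolding c_def using runs_mono[OF runs_Seq[OF T1(1) runs_Seq[OF T2 T3]]] by simp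
    then obtain u where u: "u \<le> 6 * length x + 3 * poly p (length x) + poly (pcompose Q1 r) (length x)"
      "exec K c (start_tapes x) u T3" by (auto simp: runs_def)
    have query: "tape_string (T3 1) = gadget_code y e"
      using tape_string_wtape[of "[]" "gadget_code y e"] by (simp add: T3_def)
    define T4 where "T4 = T3(1 := tape_of (orc (gadget_code y e)))"
    have vars4: "vars y 1 e T4" using vars1 by (simp add: T4_def T3_def)
    have e0: "e 0 = n" by (simp add: e_def)
    define T5 where "T5 = T4(2 := put (valid y n) (T4 2))"
    have T5: "runs K c_val T4 (poly p_val (length y)) T5"
      using c_val[OF vars4] n by (simp add: T5_def e0)
    have s2: "syms K T5 2 = Some (valid y n)" using K by (simp add: T5_def syms_cell)
    have T5_0: "T5 0 = wtape x (int (length x))" using T1(2) by (simp add: T5_def T4_def T3_def)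
    define ans where "ans = (valid y n \<and> length (orc (gadget_code y e)) = n)"
    have "\<exists>T6. runs K (If (\<lambda>s. s 2 = Some True) compare_answer (wr 0 (\<lambda>_. False) Stay)) T5
        (4 * length y + 3 + 2) T6 \<and> T6 0 = put ans (T5 0)"
    proof (cases "valid y n")
      case True
      obtain T6 where "runs K compare_answer T5 (4 * length y + 3) T6" "T6 0 = put ans (T5 0)"
        using runs_compare_answer[of K T5 y n "orc (gadget_code y e)"] K n T1(4)[of 4] True
        by (auto simp: T5_def T4_def T3_def ans_def)
      then show ?thesis using True s2 by (intro exI[of _ T6] conjI runs_If) auto
    next
      case False
      have "runs K (wr 0 (\<lambda>_. False) Stay) T5 (4 * length y + 3) (T5(0 := put False (T5 0)))"
        using runs_mono[OF runs_wr[of 0 K "\<lambda>_. False" Stay T5], of "4 * length y + 3"] K by simp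
      then show ?thesis using False s2
        by (intro exI[of _ "T5(0 := put False (T5 0))"] conjI runs_If) (auto simp: ans_def)
    qed
    then obtain T6 where T6: "runs K (If (\<lambda>s. s 2 = Some True) compare_answer (wr 0 (\<lambda>_. False) Stay)) T5
        (4 * length y + 3 + 2) T6" "T6 0 = put ans (T5 0)" by blast
    have "poly p_val (length y) + (4 * length y + 3 + 2) = poly Q2 (length y)"
      by (simp add: Q2_def)
    also have "\<dots> \<le> poly (pcompose Q2 r) (length x)"
      using poly_mono_nat[OF y_le, of Q2] by (simp add: poly_pcompose)
    finally have "runs K d T4 (poly (pcompose Q2 r) (length x)) T6"
      unfolding d_def using runs_mono[OF runs_Seq[OF T5 T6(1)]] by simp
    then obtain w where w: "w \<le> poly (pcompose Q2 r) (length x)" "exec K d T4 w T6"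
      by (auto simp: runs_def)
    have w2: "exec K d (T3(1 := tape_of (orc (tape_string (T3 1))))) w T6"
      using w(2) unfolding T4_def query .
    have "0 < K" "2 \<le> K" using K by auto
    then have steps: "(step (query_tm K c d) orc ^^ (u + 1 + w)) (init (query_tm K c d) x) =
      (halt (query_tm K c d), map T6 [0..<K])"
      by (simp only: init_query_tm query_tm_run[OF u(2), of d orc w T6, OF _ w2])
    have "ans \<longleftrightarrow> x \<in> L"
    proof (cases "valid y n")
      case True
      then have cub: "cubic n (adj y n)" by (simp add: valid_def)
      have "gadget_code y e = encode_graph G"
        using gadget_code_eq[of y e] True n by (simp add: e0 G_def)
      moreover have "(encode_graph G, encode_nat (min_edge_deletion G)) \<in> cubic_min_edge_deletion_bipartition"
        using gadget_graph_correct(1,2)[OF cub]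
        unfolding cubic_min_edge_deletion_bipartition_def G_def by blast
      ultimately have "length (orc (gadget_code y e)) = min_edge_deletion G"
        using orc by (auto simp: encode_nat_def)
      then show ?thesis
        using NAE_iff_min_edge_deletion[of "f x"] f[of x] True by (simp add: ans_def G_def y_def n_def)
    next
      \<comment> \<open>Here the oracle is unconstrained, but the first conjunct already makes
        \<open>ans\<close> false, as non-membership requires.\<close>
      case False
      then show ?thesis
        using NAE_iff_min_edge_deletion[of "f x"] f[of x] by (simp add: ans_def y_def n_def)
    qed
    \<comment> \<open>The bit was written behind the input, where the head still stands, so the
      string read from there is this bit alone.\<close>
    moreover have "tape_string (T6 0) = [ans]"
      using T6(2) tape_string_wtape[of x "[ans]"] put_wtape[of ans x] unfolding T5_0 by simp
    ultimately have "tape_string (map T6 [0..<K] ! 0) = char_fun L x"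
      using K by (simp add: char_fun_def)
    moreover have "u + 1 + w \<le> poly P (length x)"
      using u(1) w(1) by (simp add: P_def)
    ultimately show "\<exists>t \<le> poly P (length x). \<exists>ts.
        (step (query_tm K c d) orc ^^ t) (init (query_tm K c d) x) = (halt (query_tm K c d), ts) \<and>
        tape_string (ts ! 0) = char_fun L x"
      using steps by blast
  qed
  ultimately show ?thesis unfolding turing_reducible_def by blast
qed

theorem mainTheorem7:
  assumes "NP_complete cubic_bipartite_NAE"
  shows "NP_hard cubic_min_edge_deletion_bipartition"
  using assms karp_imp_turing_reducible unfolding NP_complete_def NP_hard_def by blast

end
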